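(* Let $(\alpha,\beta,\gamma)$ be an LR-stable triple of partitions. Then $(\alpha,\beta,\gamma)$ is H-stable.
   Context: For a partition $\lambda$ of $n$ (written $\lambda\vdash n$, $|\lambda|=n$), $V_\lambda$ denotes the associated irreducible complex representation of the symmetric group $S_n$. Partitions are viewed as vectors (padded with trailing zeros), so addition of partitions and multiplication by nonnegative integers are coordinatewise. Littlewood–Richardson coefficients: for $\mu\vdash n$, $\nu\vdash m$, $\lambda\vdash n+m$, $c_{\mu,\nu}^{\lambda}$ is the multiplicity of $V_\lambda$ in $\mathrm{Ind}_{S_n\times S_m}^{S_{n+m}}(V_\mu\otimes V_\nu)$. An LR-triple is a triple $(\alpha,\beta,\gamma)$ of partitions with $|\alpha|=|\beta|+|\gamma|$ and $c_{\beta,\gamma}^{\alpha}>0$. An LR-triple is LR-stable if for every triple of partitions $(\lambda,\mu,\nu)$ with $|\lambda|=|\mu|+|\nu|$ the sequence $\{c_{\mu+n\beta,\nu+n\gamma}^{\lambda+n\alpha}\}_n$ is eventually constant. Heisenberg product: let $V$ be a representation of $S_n$ and $W$ a representation of $S_m$. For an integer $l$ with $\max\{m,n\}\le l\le m+n$, put $p=l-m$, $q=n+m-l$, $r=l-n$. Embed $S_p\times S_q\times S_r$ in $S_n\times S_m=S_{p+q}\times S_{q+r}$ as the composite of $\mathrm{id}\times\Delta_{S_q}\times \mathrm{id}: S_p\times S_q\times S_r\to (S_p\times S_q)\times (S_q\times S_r)$ (with $\Delta_{S_q}$ the diagonal) with the standard Young subgroup inclusions $S_p\times S_q\subset S_{p+q}$,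 $S_q\times S_r\subset S_{q+r}$; also embed $S_p\times S_q\times S_r$ in $S_l=S_{p+q+r}$ as a Young subgroup. Put $(V\#W)_l=\mathrm{Ind}_{S_p\times S_q\times S_r}^{S_l}\mathrm{Res}^{S_n\times S_m}_{S_p\times S_q\times S_r}(V\otimes W)$ and $V\#W=\bigoplus_{l=\max\{n,m\}}^{n+m}(V\#W)_l$. The Heisenberg coefficient $h_{\mu,\nu}^{\lambda}$ is the multiplicity of $V_\lambda$ in $V_\mu\#V_\nu$. An H-triple is a triple $(\alpha,\beta,\gamma)$ of partitions with $\max\{|\beta|,|\gamma|\}\le|\alpha|\le|\beta|+|\gamma|$ and $h_{\beta,\gamma}^{\alpha}>0$. An H-triple is H-stable if for every triple of partitions $(\lambda,\mu,\nu)$ with $\max\{|\mu|,|\nu|\}\le|\lambda|\le|\mu|+|\nu|$ the sequence $\{h_{\mu+n\beta,\nu+n\gamma}^{\lambda+n\alpha}\}_n$ is eventually constant. *)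

theory Defs
  imports
    Complex_Main
    "HOL-Library.FuncSet"
    "HOL-Library.Function_Algebras"
    "HOL-Algebra.Sym_Groups"
begin

section \<open>Complex representations of a group\<close>

text \<open>
  All representation spaces are linear subspaces of a space \<open>'x \<Rightarrow> complex\<close> of complex
  valued functions, with pointwise addition (\<^theory>\<open>HOL-Library.Function_Algebras\<close>) and
  pointwise scalar multiplication.
\<close>

definition cscale :: "complex \<Rightarrow> ('x \<Rightarrow> complex) \<Rightarrow> 'x \<Rightarrow> complex"
  where "cscale c v = (\<lambda>x. c * v x)"

global_interpretation cfun: vector_space cscale
  by standard (auto simp: cscale_def fun_eq_iff algebra_simps)

record ('g, 'x) rep =
  rspace :: "('x \<Rightarrow> complex) set"
  action :: "'g \<Rightarrow> ('x \<Rightarrow> complex) \<Rightarrow> ('x \<Rightarrow> complex)"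

definition representation :: "'g monoid \<Rightarrow> ('g, 'x) rep \<Rightarrow> bool"
  where "representation G V \<longleftrightarrow>
    cfun.subspace (rspace V) \<and>
    (\<forall>g\<in>carrier G. \<forall>v\<in>rspace V. action V g v \<in> rspace V) \<and>
    (\<forall>g\<in>carrier G. \<forall>v\<in>rspace V. \<forall>w\<in>rspace V.
       action V g (v + w) = action V g v + action V g w) \<and>
    (\<forall>g\<in>carrier G. \<forall>c. \<forall>v\<in>rspace V. action V g (cscale c v) = cscale c (action V g v)) \<and>
    (\<forall>v\<in>rspace V. action V \<one>\<^bsub>G\<^esub> v = v) \<and>
    (\<forall>g\<in>carrier G. \<forall>h\<in>carrier G. \<forall>v\<in>rspace V.
       action V (g \<otimes>\<^bsub>G\<^esub> h) v = action V g (action V h v))"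

definition subrep :: "'g monoid \<Rightarrow> ('x \<Rightarrow> complex) set \<Rightarrow> ('g, 'x) rep \<Rightarrow> bool"
  where "subrep G U V \<longleftrightarrow> U \<subseteq> rspace V \<and> representation G (V\<lparr>rspace := U\<rparr>)"

definition irreducible_rep :: "'g monoid \<Rightarrow> ('g, 'x) rep \<Rightarrow> bool"
  where "irreducible_rep G V \<longleftrightarrow>
    representation G V \<and> rspace V \<noteq> {0} \<and>
    (\<forall>U. subrep G U V \<longrightarrow> U = {0} \<or> U = rspace V)"

definition iso_rep :: "'g monoid \<Rightarrow> ('g, 'x) rep \<Rightarrow> ('g, 'y) rep \<Rightarrow> bool"
  where "iso_rep G V W \<longleftrightarrow>
    (\<exists>\<phi>. bij_betw \<phi> (rspace V) (rspace W) \<and>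
       (\<forall>v\<in>rspace V. \<forall>w\<in>rspace V. \<phi> (v + w) = \<phi> v + \<phi> w) \<and>
       (\<forall>c. \<forall>v\<in>rspace V. \<phi> (cscale c v) = cscale c (\<phi> v)) \<and>
       (\<forall>g\<in>carrier G. \<forall>v\<in>rspace V. \<phi> (action V g v) = action W g (\<phi> v)))"

text \<open>\<open>W\<close> is the internal direct sum of the irreducible subrepresentations \<open>U 0, \<dots>, U (N - 1)\<close>.\<close>

definition irreducible_decomposition ::
    "'g monoid \<Rightarrow> ('g, 'x) rep \<Rightarrow> nat \<Rightarrow> (nat \<Rightarrow> ('x \<Rightarrow> complex) set) \<Rightarrow> bool"
  where "irreducible_decomposition G W N U \<longleftrightarrow>
    (\<forall>i<N. subrep G (U i) W \<and> irreducible_rep G (W\<lparr>rspace := U i\<rparr>)) \<and>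
    bij_betw (\<lambda>u. \<Sum>i<N. u i) (Pi\<^sub>E {..<N} U) (rspace W)"

text \<open>
  The number of summands isomorphic to \<open>V\<close> does not depend on the decomposition, and a
  decomposition exists for every finite-dimensional representation of a finite group.
\<close>

definition multiplicity_rep :: "'g monoid \<Rightarrow> ('g, 'x) rep \<Rightarrow> ('g, 'y) rep \<Rightarrow> nat"
  where "multiplicity_rep G V W =
    (THE k. \<exists>N U. irreducible_decomposition G W N U \<and>
                  k = card {i \<in> {..<N}. iso_rep G V (W\<lparr>rspace := U i\<rparr>)})"


section \<open>Tensor product, restriction, induction\<close>

text \<open>
  The external tensor product is realised inside the functions on \<open>'x \<times> 'y\<close>. An element
  \<open>(g, h)\<close> acts by applying \<open>g\<close> to each slice \<open>\<lambda>x. t (x, y)\<close>, which lies in \<open>V\<close>, and then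
  \<open>h\<close> to each slice \<open>\<lambda>y. t (x, y)\<close>, so that \<open>v \<otimes> w\<close> is sent to \<open>g v \<otimes> h w\<close>.
\<close>

definition pure_tensor :: "('x \<Rightarrow> complex) \<Rightarrow> ('y \<Rightarrow> complex) \<Rightarrow> 'x \<times> 'y \<Rightarrow> complex"
  where "pure_tensor v w = (\<lambda>(x, y). v x * w y)"

definition tensor_rep :: "('g, 'x) rep \<Rightarrow> ('h, 'y) rep \<Rightarrow> ('g \<times> 'h, 'x \<times> 'y) rep"
  where "tensor_rep V W =
    \<lparr> rspace = cfun.span {pure_tensor v w | v w. v \<in> rspace V \<and> w \<in> rspace W},
      action = (\<lambda>(g, h) t.
        let s = (\<lambda>(x, y). action V g (\<lambda>x'. t (x', y)) x)
        in (\<lambda>(x, y). action W h (\<lambda>y'. s (x, y')) y)) \<rparr>"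

definition res_rep :: "('h \<Rightarrow> 'g) \<Rightarrow> ('g, 'x) rep \<Rightarrow> ('h, 'x) rep"
  where "res_rep \<phi> V = \<lparr> rspace = rspace V, action = (\<lambda>h. action V (\<phi> h)) \<rparr>"

text \<open>
  For an embedding \<open>\<phi>\<close> of \<open>H\<close> into a finite group \<open>G\<close>, the induced representation is the space
  of all \<open>f : G \<rightarrow> V\<close> with \<open>f (g \<phi>(h)) = h\<inverse> f(g)\<close>, with \<open>G\<close> acting by left translation. Such an
  \<open>f\<close> is stored in uncurried form as a function on \<open>'g \<times> 'x\<close>, and is zero outside \<open>carrier G\<close>.
\<close>

definition ind_rep ::
    "'h monoid \<Rightarrow> 'g monoid \<Rightarrow> ('h \<Rightarrow> 'g) \<Rightarrow> ('h, 'x) rep \<Rightarrow> ('g, 'g \<times> 'x) rep"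
  where "ind_rep H G \<phi> V =
    \<lparr> rspace = {f. (\<forall>g x. g \<notin> carrier G \<longrightarrow> f (g, x) = 0) \<and>
                  (\<forall>g\<in>carrier G. (\<lambda>x. f (g, x)) \<in> rspace V) \<and>
                  (\<forall>g\<in>carrier G. \<forall>h\<in>carrier H.
                     (\<lambda>x. f (g \<otimes>\<^bsub>G\<^esub> \<phi> h, x)) = action V (inv\<^bsub>H\<^esub> h) (\<lambda>x. f (g, x)))},
      action = (\<lambda>k f (g, x). if g \<in> carrier G then f (inv\<^bsub>G\<^esub> k \<otimes>\<^bsub>G\<^esub> g, x) else 0) \<rparr>"


section \<open>Partitions\<close>

text \<open>
  A partition is a weakly decreasing sequence with finitely many nonzero entries, so rows are
  indexed from 0. The partition usually called lambda is written \<open>\<kappa>\<close>, since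
  \<open>\<lambda>\<close> is reserved for abstraction.
\<close>

definition is_partition :: "(nat \<Rightarrow> nat) \<Rightarrow> bool"
  where "is_partition \<kappa> \<longleftrightarrow> antimono \<kappa> \<and> finite {i. \<kappa> i \<noteq> 0}"

definition psize :: "(nat \<Rightarrow> nat) \<Rightarrow> nat"
  where "psize \<kappa> = (\<Sum>i | \<kappa> i \<noteq> 0. \<kappa> i)"


section \<open>The irreducible representation attached to a partition\<close>

text \<open>
  The group algebra of \<open>G\<close> consists of the functions on \<open>'g\<close> vanishing outside
  \<open>carrier G\<close>, with convolution as product.
\<close>

definition group_algebra :: "'g monoid \<Rightarrow> ('g \<Rightarrow> complex) set"
  where "group_algebra G = {a. \<forall>g. g \<notin> carrier G \<longrightarrow> a g = 0}"

definition convolution ::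
    "'g monoid \<Rightarrow> ('g \<Rightarrow> complex) \<Rightarrow> ('g \<Rightarrow> complex) \<Rightarrow> 'g \<Rightarrow> complex"
  where "convolution G a b =
    (\<lambda>g. if g \<in> carrier G then \<Sum>h\<in>carrier G. a h * b (inv\<^bsub>G\<^esub> h \<otimes>\<^bsub>G\<^esub> g) else 0)"

text \<open>
  The entry of the box \<open>(i, j)\<close> (where \<open>j < \<kappa> i\<close>) in the tableau filled row by row with
  \<open>1, \<dots>, |\<kappa>|\<close>.
\<close>

definition row_tableau :: "(nat \<Rightarrow> nat) \<Rightarrow> nat \<Rightarrow> nat \<Rightarrow> nat"
  where "row_tableau \<kappa> i j = (\<Sum>i'<i. \<kappa> i') + Suc j"

definition row_stabilizer :: "(nat \<Rightarrow> nat) \<Rightarrow> (nat \<Rightarrow> nat) set"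
  where "row_stabilizer \<kappa> =
    {p \<in> carrier (sym_group (psize \<kappa>)).
       \<forall>i j. j < \<kappa> i \<longrightarrow> (\<exists>j'<\<kappa> i. p (row_tableau \<kappa> i j) = row_tableau \<kappa> i j')}"

definition column_stabilizer :: "(nat \<Rightarrow> nat) \<Rightarrow> (nat \<Rightarrow> nat) set"
  where "column_stabilizer \<kappa> =
    {q \<in> carrier (sym_group (psize \<kappa>)).
       \<forall>i j. j < \<kappa> i \<longrightarrow> (\<exists>i'. j < \<kappa> i' \<and> q (row_tableau \<kappa> i j) = row_tableau \<kappa> i' j)}"

definition young_symmetrizer :: "(nat \<Rightarrow> nat) \<Rightarrow> (nat \<Rightarrow> nat) \<Rightarrow> complex"
  where "young_symmetrizer \<kappa> =
    convolution (sym_group (psize \<kappa>))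
      (\<lambda>p. if p \<in> row_stabilizer \<kappa> then 1 else 0)
      (\<lambda>q. if q \<in> column_stabilizer \<kappa> then of_int (sign q) else 0)"

text \<open>
  The left ideal of the group algebra generated by the Young symmetrizer, with left
  multiplication. The is_partition \<open>(n)\<close> gives the trivial representation.
\<close>

definition specht :: "(nat \<Rightarrow> nat) \<Rightarrow> (nat \<Rightarrow> nat, nat \<Rightarrow> nat) rep"
  where "specht \<kappa> =
    (let G = sym_group (psize \<kappa>) in
    \<lparr> rspace = (\<lambda>a. convolution G a (young_symmetrizer \<kappa>)) ` group_algebra G,
      action = (\<lambda>k a g. if g \<in> carrier G then a (inv\<^bsub>G\<^esub> k \<otimes>\<^bsub>G\<^esub> g) else 0) \<rparr>)"


section \<open>Littlewood--Richardson and Heisenberg coefficients\<close>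

text \<open>
  The Young subgroup embedding of \<open>S\<^sub>n \<times> S\<^sub>m\<close> in \<open>S\<^sub>n\<^sub>+\<^sub>m\<close>: \<open>\<sigma>\<close> acts on \<open>{1..n}\<close> and \<open>\<tau>\<close>, shifted
  by \<open>n\<close>, on \<open>{n+1..n+m}\<close>.
\<close>

definition young_embed :: "nat \<Rightarrow> (nat \<Rightarrow> nat) \<Rightarrow> (nat \<Rightarrow> nat) \<Rightarrow> nat \<Rightarrow> nat"
  where "young_embed n \<sigma> \<tau> = (\<lambda>i. if i \<le> n then \<sigma> i else n + \<tau> (i - n))"

text \<open>Only meaningful for \<open>psize \<kappa> = psize \<mu> + psize \<nu>\<close>.\<close>

definition lr_coeff :: "(nat \<Rightarrow> nat) \<Rightarrow> (nat \<Rightarrow> nat) \<Rightarrow> (nat \<Rightarrow> nat) \<Rightarrow> nat"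
  where "lr_coeff \<mu> \<nu> \<kappa> =
    (let n = psize \<mu>; m = psize \<nu> in
     multiplicity_rep (sym_group (n + m)) (specht \<kappa>)
       (ind_rep (sym_group n \<times>\<times> sym_group m) (sym_group (n + m)) (\<lambda>(\<sigma>, \<tau>). young_embed n \<sigma> \<tau>)
         (tensor_rep (specht \<mu>) (specht \<nu>))))"

text \<open>
  The degree \<open>l\<close> component of the Heisenberg product of representations \<open>V\<close> of \<open>S\<^sub>n\<close> and \<open>W\<close> of
  \<open>S\<^sub>m\<close>, for \<open>max n m \<le> l \<le> n + m\<close>.
\<close>

definition heisenberg_component ::
    "nat \<Rightarrow> nat \<Rightarrow> nat \<Rightarrow> (nat \<Rightarrow> nat, 'x) rep \<Rightarrow> (nat \<Rightarrow> nat, 'y) rep \<Rightarrow>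
      (nat \<Rightarrow> nat, (nat \<Rightarrow> nat) \<times> ('x \<times> 'y)) rep"
  where "heisenberg_component n m l V W =
    (let p = l - m; q = n + m - l; r = l - n in
     ind_rep (sym_group p \<times>\<times> sym_group q \<times>\<times> sym_group r) (sym_group l)
       (\<lambda>(a, b, c). young_embed p a (young_embed q b c))
       (res_rep (\<lambda>(a, b, c). (young_embed p a b, young_embed q b c)) (tensor_rep V W)))"

text \<open>
  Since the Heisenberg product is graded by the symmetric groups \<open>S\<^sub>l\<close>, the representation attached
  to \<open>\<kappa>\<close> can only occur in the component of degree \<open>psize \<kappa>\<close>.
\<close>

definition heisenberg_coeff :: "(nat \<Rightarrow> nat) \<Rightarrow> (nat \<Rightarrow> nat) \<Rightarrow> (nat \<Rightarrow> nat) \<Rightarrow> nat"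
  where "heisenberg_coeff \<mu> \<nu> \<kappa> =
    (let n = psize \<mu>; m = psize \<nu>; l = psize \<kappa> in
     if max n m \<le> l \<and> l \<le> n + m
     then multiplicity_rep (sym_group l) (specht \<kappa>)
            (heisenberg_component n m l (specht \<mu>) (specht \<nu>))
     else 0)"


section \<open>Stable triples\<close>

definition eventually_constant :: "(nat \<Rightarrow> 'a) \<Rightarrow> bool"
  where "eventually_constant f \<longleftrightarrow> (\<exists>c. \<forall>\<^sub>F n in sequentially. f n = c)"

definition LR_triple :: "(nat \<Rightarrow> nat) \<Rightarrow> (nat \<Rightarrow> nat) \<Rightarrow> (nat \<Rightarrow> nat) \<Rightarrow> bool"
  where "LR_triple \<alpha> \<beta> \<gamma> \<longleftrightarrow>
    is_partition \<alpha> \<and> is_partition \<beta> \<and> is_partition \<gamma> \<and>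
    psize \<alpha> = psize \<beta> + psize \<gamma> \<and> lr_coeff \<beta> \<gamma> \<alpha> > 0"

definition LR_stable :: "(nat \<Rightarrow> nat) \<Rightarrow> (nat \<Rightarrow> nat) \<Rightarrow> (nat \<Rightarrow> nat) \<Rightarrow> bool"
  where "LR_stable \<alpha> \<beta> \<gamma> \<longleftrightarrow> LR_triple \<alpha> \<beta> \<gamma> \<and>
    (\<forall>\<kappa> \<mu> \<nu>. is_partition \<kappa> \<and> is_partition \<mu> \<and> is_partition \<nu> \<and> psize \<kappa> = psize \<mu> + psize \<nu> \<longrightarrow>
      eventually_constant
        (\<lambda>n. lr_coeff (\<lambda>i. \<mu> i + n * \<beta> i) (\<lambda>i. \<nu> i + n * \<gamma> i) (\<lambda>i. \<kappa> i + n * \<alpha> i)))"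

definition H_triple :: "(nat \<Rightarrow> nat) \<Rightarrow> (nat \<Rightarrow> nat) \<Rightarrow> (nat \<Rightarrow> nat) \<Rightarrow> bool"
  where "H_triple \<alpha> \<beta> \<gamma> \<longleftrightarrow>
    is_partition \<alpha> \<and> is_partition \<beta> \<and> is_partition \<gamma> \<and>
    max (psize \<beta>) (psize \<gamma>) \<le> psize \<alpha> \<and> psize \<alpha> \<le> psize \<beta> + psize \<gamma> \<and>
    heisenberg_coeff \<beta> \<gamma> \<alpha> > 0"

definition H_stable :: "(nat \<Rightarrow> nat) \<Rightarrow> (nat \<Rightarrow> nat) \<Rightarrow> (nat \<Rightarrow> nat) \<Rightarrow> bool"
  where "H_stable \<alpha> \<beta> \<gamma> \<longleftrightarrow> H_triple \<alpha> \<beta> \<gamma> \<and>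
    (\<forall>\<kappa> \<mu> \<nu>. is_partition \<kappa> \<and> is_partition \<mu> \<and> is_partition \<nu> \<and>
        max (psize \<mu>) (psize \<nu>) \<le> psize \<kappa> \<and> psize \<kappa> \<le> psize \<mu> + psize \<nu> \<longrightarrow>
      eventually_constant
        (\<lambda>n. heisenberg_coeff (\<lambda>i. \<mu> i + n * \<beta> i) (\<lambda>i. \<nu> i + n * \<gamma> i) (\<lambda>i. \<kappa> i + n * \<alpha> i)))"

end

theory Submission
  imports Defs
begin

text \<open>
  Both coefficients are inner products of characters, and the character of a Specht module is given
  by Frobenius' formula: \<open>\<chi>\<^sub>\<kappa>(\<sigma>)\<close> is a signed count of the colourings of the points by rows that are
  constant on the cycles of \<open>\<sigma>\<close>. The formula makes sense for every integer vector in place of \<open>\<kappa>\<close> and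
  shows that restricting \<open>\<chi>\<^sub>\<kappa>\<close> to \<open>a \<cdot> b \<cdot> c\<close> with \<open>b\<close> of degree \<open>q\<close> fixed gives a sum of the functions of
  \<open>\<kappa>\<close> minus the content of a colouring fixed by \<open>b\<close>. Hence a Heisenberg coefficient is the average over
  \<open>b \<in> S\<^sub>q\<close> of finitely many Littlewood--Richardson pairings of integer vectors. In the sequence of the
  theorem \<open>q\<close> does not depend on \<open>n\<close>, and for large \<open>n\<close> sorting the three vectors turns every pairing,
  up to a constant sign, into a sequence covered by LR-stability, unless it vanishes.

  Frobenius' formula itself holds because the character and the signed count both have norm 1
  (for the latter by a sign-reversing involution as in Pieri's rule) and inner product 1.
\<close>

section \<open>Representations of finite groups\<close>

text \<open>Expanded over \<open>w\<close>, the signed count is the Jacobi-Trudi sum: an alternating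
  sum of the permutation characters on colourings with content \<open>A i + w i\<close>. It keeps
  its meaning when subtracting a content has destroyed the partition, and this is the obstacle it
  removes: a restricted Specht character need not be decomposed again into irreducible ones. The
  degree \<open>q\<close> stays fixed because
  \<open>psize \<alpha> = psize \<beta> + psize \<gamma>\<close>. For large \<open>n\<close> one
  permutation sorts all later vectors of a sequence and preserves \<open>\<alpha>\<close>, so the
  sorted vectors again move in the direction \<open>(\<alpha>, \<beta>, \<gamma>)\<close>.
  Positivity of the Heisenberg coefficient is the case \<open>q = 0\<close>, where it equals the
  Littlewood-Richardson coefficient.

  Multiplicities become character sums through primitive idempotents: the copies of the left ideal
  of \<open>e\<close> in \<open>W\<close> are counted by the dimension of \<open>e W\<close>, the
  trace of a projection. Since a trace mentions no decomposition, this also shows that the count in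
  \<open>multiplicity_rep\<close> is well defined.\<close>

lemma sum_fun_eval: "(\<Sum>i\<in>A. f i) x = (\<Sum>i\<in>A. f i x)"
  for f :: "'i \<Rightarrow> 'x \<Rightarrow> 'a::comm_monoid_add"
  by (induction A rule: infinite_finite_induct) auto

lemma cscale_apply [simp]: "cscale c v x = c * v x"
  by (simp add: cscale_def)

locale fin_group = group G for G :: "'g monoid" (structure) +
  assumes finite_G: "finite (carrier G)"
begin

lemma sum_left_translate:
  assumes "k \<in> carrier G"
  shows "(\<Sum>g\<in>carrier G. f (k \<otimes> g)) = (\<Sum>g\<in>carrier G. f g)"
  by (rule sum.reindex_bij_witness[of _ "\<lambda>g. inv k \<otimes> g" "\<lambda>g. k \<otimes> g"])
     (use assms in \<open>auto simp: m_assoc[symmetric]\<close>)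

lemma sum_right_translate:
  assumes "k \<in> carrier G"
  shows "(\<Sum>g\<in>carrier G. f (g \<otimes> k)) = (\<Sum>g\<in>carrier G. f g)"
  by (rule sum.reindex_bij_witness[of _ "\<lambda>g. g \<otimes> inv k" "\<lambda>g. g \<otimes> k"])
     (use assms in \<open>auto simp: m_assoc\<close>)

lemma sum_inverse: "(\<Sum>g\<in>carrier G. f (inv g)) = (\<Sum>g\<in>carrier G. f g)"
  by (rule sum.reindex_bij_witness[of _ "\<lambda>g. inv g" "\<lambda>g. inv g"]) auto

lemma card_G_pos: "card (carrier G) > 0"
  using finite_G one_closed card_gt_0_iff by blast

end

definition alg_act :: "'g monoid \<Rightarrow> ('g, 'x) rep \<Rightarrow> ('g \<Rightarrow> complex) \<Rightarrow> ('x \<Rightarrow> complex) \<Rightarrow> 'x \<Rightarrow> complex"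
  where "alg_act G W a w = (\<Sum>g\<in>carrier G. cscale (a g) (action W g w))"

text \<open>Coordinates are the point evaluations at \<open>X\<close>, and the vectors
  \<open>d x\<close> may be dependent. As the identity of \<open>W\<close> is the sum of the rank
  one maps \<open>w \<mapsto> w x \<cdot> d x\<close>, the trace of an operator \<open>T\<close> on
  \<open>W\<close> is the sum of the values \<open>T (d x) x\<close>. So characters can be taken
  without choosing bases, and all translates of one vector may serve as a frame.\<close>

definition frame :: "('g, 'x) rep \<Rightarrow> 'x set \<Rightarrow> ('x \<Rightarrow> 'x \<Rightarrow> complex) \<Rightarrow> bool"
  where "frame W X d \<longleftrightarrow> finite X \<and> (\<forall>x\<in>X. d x \<in> rspace W) \<and>
    (\<forall>w\<in>rspace W. w = (\<Sum>x\<in>X. cscale (w x) (d x)))"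

definition frame_character ::
    "('g, 'x) rep \<Rightarrow> 'x set \<Rightarrow> ('x \<Rightarrow> 'x \<Rightarrow> complex) \<Rightarrow> 'g \<Rightarrow> complex"
  where "frame_character W X d g = (\<Sum>x\<in>X. action W g (d x) x)"

locale fin_rep = fin_group G for G :: "'g monoid" (structure) and W :: "('g, 'x) rep" +
  assumes rep: "representation G W"
begin

lemma subspace_W: "cfun.subspace (rspace W)"
  and act_mem: "g \<in> carrier G \<Longrightarrow> w \<in> rspace W \<Longrightarrow> action W g w \<in> rspace W"
  and act_add: "g \<in> carrier G \<Longrightarrow> v \<in> rspace W \<Longrightarrow> w \<in> rspace W \<Longrightarrow>
      action W g (v + w) = action W g v + action W g w"
  and act_scale: "g \<in> carrier G \<Longrightarrow> w \<in> rspace W \<Longrightarrow>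
      action W g (cscale c w) = cscale c (action W g w)"
  and act_one: "w \<in> rspace W \<Longrightarrow> action W \<one> w = w"
  and act_mult: "g \<in> carrier G \<Longrightarrow> h \<in> carrier G \<Longrightarrow> w \<in> rspace W \<Longrightarrow>
      action W (g \<otimes> h) w = action W g (action W h w)"
  using rep unfolding representation_def by blast+

lemma act_zero: "g \<in> carrier G \<Longrightarrow> action W g 0 = 0"
  using act_scale[of g 0 0] cfun.subspace_0[OF subspace_W] by simp

lemma act_sum:
  assumes "g \<in> carrier G" "\<And>i. i \<in> A \<Longrightarrow> f i \<in> rspace W"
  shows "action W g (\<Sum>i\<in>A. f i) = (\<Sum>i\<in>A. action W g (f i))"
  using assms(2)
proof (induction A rule: infinite_finite_induct)
  case (insert a A)
  have "sum f A \<in> rspace W" "f a \<in> rspace W"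
    using insert.prems by (auto intro!: cfun.subspace_sum[OF subspace_W])
  from act_add[OF assms(1) this(2,1)]
  have "action W g (f a + sum f A) = action W g (f a) + (\<Sum>i\<in>A. action W g (f i))"
    using insert.IH insert.prems by auto
  then show ?case by (simp only: sum.insert[OF insert.hyps])
qed (use assms(1) act_zero in auto)

lemma act_lincomb:
  assumes "g \<in> carrier G" "\<And>i. i \<in> A \<Longrightarrow> f i \<in> rspace W"
  shows "action W g (\<Sum>i\<in>A. cscale (c i) (f i)) = (\<Sum>i\<in>A. cscale (c i) (action W g (f i)))"
  using assms
  by (subst act_sum) (auto simp: act_scale cfun.subspace_scale[OF subspace_W] intro!: sum.cong)

lemma act_inv_cancel:
  assumes "g \<in> carrier G" "w \<in> rspace W"
  shows "action W (inv g) (action W g w) = w" "action W g (action W (inv g) w) = w"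
  using assms act_mult[of "inv g" g w] act_mult[of g "inv g" w] act_one by auto

lemma subrep_iff:
  "subrep G U W \<longleftrightarrow> U \<subseteq> rspace W \<and> cfun.subspace U \<and>
     (\<forall>g\<in>carrier G. \<forall>u\<in>U. action W g u \<in> U)"
  using rep unfolding subrep_def representation_def by (auto simp: subset_iff)

lemma alg_act_in:
  assumes "cfun.subspace U" "\<And>g. g \<in> carrier G \<Longrightarrow> action W g w \<in> U"
  shows "alg_act G W a w \<in> U"
  unfolding alg_act_def using assms
  by (intro cfun.subspace_sum cfun.subspace_scale) auto

lemma alg_act_mem: "w \<in> rspace W \<Longrightarrow> alg_act G W a w \<in> rspace W"
  by (rule alg_act_in[OF subspace_W]) (rule act_mem)

lemma alg_act_lincomb:
  assumes "\<And>i. i \<in> A \<Longrightarrow> f i \<in> rspace W"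
  shows "alg_act G W a (\<Sum>i\<in>A. cscale (c i) (f i)) = (\<Sum>i\<in>A. cscale (c i) (alg_act G W a (f i)))"
proof -
  have "alg_act G W a (\<Sum>i\<in>A. cscale (c i) (f i)) =
      (\<Sum>g\<in>carrier G. \<Sum>i\<in>A. cscale (a g) (cscale (c i) (action W g (f i))))"
    unfolding alg_act_def using assms
    by (intro sum.cong refl) (simp add: act_lincomb cfun.scale_sum_right)
  also have "\<dots> = (\<Sum>i\<in>A. \<Sum>g\<in>carrier G. cscale (c i) (cscale (a g) (action W g (f i))))"
    by (subst sum.swap) (simp add: mult.commute)
  finally show ?thesis by (simp add: alg_act_def cfun.scale_sum_right)
qed




lemma alg_act_plus: "alg_act G W (a + b) w = alg_act G W a w + alg_act G W b w"
  by (simp add: alg_act_def sum.distrib cfun.scale_left_distrib)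

lemma alg_act_cscale: "alg_act G W (cscale c a) w = cscale c (alg_act G W a w)"
  by (simp add: alg_act_def cfun.scale_sum_right)

lemma alg_act_convolution:
  assumes w: "w \<in> rspace W"
  shows "alg_act G W (convolution G a b) w = alg_act G W a (alg_act G W b w)"
proof -
  have "alg_act G W a (alg_act G W b w) =
      (\<Sum>h\<in>carrier G. cscale (a h) (\<Sum>k\<in>carrier G. cscale (b k) (action W (h \<otimes> k) w)))"
    unfolding alg_act_def using w
    by (intro sum.cong refl arg_cong[of _ _ "cscale _"]) (simp add: act_lincomb act_mem act_mult)
  also have "\<dots> = (\<Sum>h\<in>carrier G. cscale (a h)
      (\<Sum>k\<in>carrier G. cscale (b (inv h \<otimes> k)) (action W k w)))"
  proof (rule sum.cong[OF refl])
    fix h assume h: "h \<in> carrier G"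
    have "(\<Sum>k\<in>carrier G. cscale (b k) (action W (h \<otimes> k) w)) =
        (\<Sum>k\<in>carrier G. cscale (b (inv h \<otimes> (h \<otimes> k))) (action W (h \<otimes> k) w))"
      using h by (intro sum.cong refl) (simp add: m_assoc[symmetric])
    also have "\<dots> = (\<Sum>k\<in>carrier G. cscale (b (inv h \<otimes> k)) (action W k w))"
      by (rule sum_left_translate[OF h])
    finally show "cscale (a h) (\<Sum>k\<in>carrier G. cscale (b k) (action W (h \<otimes> k) w)) =
        cscale (a h) (\<Sum>k\<in>carrier G. cscale (b (inv h \<otimes> k)) (action W k w))" by (rule arg_cong)
  qed
  also have "\<dots> = (\<Sum>g\<in>carrier G. \<Sum>h\<in>carrier G. cscale (a h * b (inv h \<otimes> g)) (action W g w))"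
    by (simp add: cfun.scale_sum_right) (rule sum.swap)
  also have "\<dots> = alg_act G W (convolution G a b) w"
    unfolding alg_act_def convolution_def
    by (intro sum.cong refl) (simp add: cfun.scale_sum_left)
  finally show ?thesis ..
qed

text \<open>Translating \<open>a\<close> is the action on the regular representation, so
  \<open>a \<mapsto> a w\<close> is equivariant. Homomorphisms out of left ideals are obtained in
  this way.\<close>

lemma act_alg_act:
  assumes "g \<in> carrier G" "w \<in> rspace W"
  shows "action W g (alg_act G W a w) =
    alg_act G W (\<lambda>h. if h \<in> carrier G then a (inv g \<otimes> h) else 0) w"
proof -
  have "action W g (alg_act G W a w) = (\<Sum>h\<in>carrier G. cscale (a h) (action W (g \<otimes> h) w))"
    unfolding alg_act_def using assms by (simp add: act_lincomb act_mem act_mult)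
  also have "\<dots> = (\<Sum>h\<in>carrier G. cscale (a (inv g \<otimes> (g \<otimes> h))) (action W (g \<otimes> h) w))"
    using assms by (intro sum.cong refl) (simp add: m_assoc[symmetric])
  also have "\<dots> = (\<Sum>h\<in>carrier G. cscale (a (inv g \<otimes> h)) (action W h w))"
    using assms(1) by (rule sum_left_translate)
  finally show ?thesis by (simp add: alg_act_def)
qed

end

subsection \<open>Complete reducibility\<close>

text \<open>Maschke's argument: a linear projection onto \<open>U\<close>, which exists for every
  subspace, is averaged over its conjugates by the group.\<close>

lemma (in fin_rep) invariant_projection:
  assumes U: "subrep G U W"
  obtains p where
    "\<And>w. w \<in> rspace W \<Longrightarrow> p w \<in> U" "\<And>u. u \<in> U \<Longrightarrow> p u = u"
    "\<And>v w. v \<in> rspace W \<Longrightarrow> w \<in> rspace W \<Longrightarrow> p (v + w) = p v + p w"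
    "\<And>c w. w \<in> rspace W \<Longrightarrow> p (cscale c w) = cscale c (p w)"
    "\<And>g w. g \<in> carrier G \<Longrightarrow> w \<in> rspace W \<Longrightarrow> p (action W g w) = action W g (p w)"
proof -
  have UW: "U \<subseteq> rspace W" and sU: "cfun.subspace U"
    and invU: "\<And>g u. g \<in> carrier G \<Longrightarrow> u \<in> U \<Longrightarrow> action W g u \<in> U"
    using U unfolding subrep_iff by auto
  interpret vector_space_pair "cscale :: complex \<Rightarrow> ('x \<Rightarrow> complex) \<Rightarrow> _"
    "cscale :: complex \<Rightarrow> ('x \<Rightarrow> complex) \<Rightarrow> _" ..
  have "\<exists>p. p ` UNIV \<subseteq> U \<and> Vector_Spaces.linear cscale cscale p \<and> (\<forall>u\<in>U. p (id u) = u)"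
    by (rule linear_exists_left_inverse_on[OF cfun.linear_id sU]) auto
  then obtain p0 where p0: "\<And>w. p0 w \<in> U" "Vector_Spaces.linear cscale cscale p0"
      "\<And>u. u \<in> U \<Longrightarrow> p0 u = u"
    by auto
  define n where "n = of_nat (card (carrier G)) * (1::complex)"
  have n: "n \<noteq> 0" using card_G_pos by (simp add: n_def)
  define p where
    "p w = cscale (1 / n) (\<Sum>g\<in>carrier G. action W g (p0 (action W (inv g) w)))" for w
  show ?thesis
  proof
    show "p w \<in> U" for w
      unfolding p_def using sU p0(1) invU by (intro cfun.subspace_scale cfun.subspace_sum) auto
    show "p u = u" if "u \<in> U" for u
    proof -
      have "(\<Sum>g\<in>carrier G. action W g (p0 (action W (inv g) u))) = (\<Sum>g\<in>carrier G. u)"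
        using that UW by (intro sum.cong refl) (auto simp: p0(3) invU act_inv_cancel)
      also have "\<dots> = cscale n u"
        by (simp add: n_def fun_eq_iff sum_fun_eval)
      finally show ?thesis using n by (simp add: p_def)
    qed
    show "p (v + w) = p v + p w" if "v \<in> rspace W" "w \<in> rspace W" for v w
    proof -
      have "action W g (p0 (action W (inv g) (v + w))) =
          action W g (p0 (action W (inv g) v)) + action W g (p0 (action W (inv g) w))"
        if "g \<in> carrier G" for g
        using that \<open>v \<in> _\<close> \<open>w \<in> _\<close> p0(1) UW
        by (simp add: act_add linear_add[OF p0(2)] subset_iff)
      then show ?thesis
        by (simp add: p_def sum.distrib cfun.scale_right_distrib)
    qed
    show "p (cscale c w) = cscale c (p w)" if "w \<in> rspace W" for c w
    proof -
      have "action W g (p0 (action W (inv g) (cscale c w))) =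
          cscale c (action W g (p0 (action W (inv g) w)))"
        if "g \<in> carrier G" for g
        using that \<open>w \<in> _\<close> p0(1) UW
        by (simp add: act_scale linear_scale[OF p0(2)] subset_iff)
      then show ?thesis
        by (simp add: p_def cfun.scale_sum_right mult.commute)
    qed
    show "p (action W g w) = action W g (p w)" if g: "g \<in> carrier G" and w: "w \<in> rspace W" for g w
    proof -
      have in_W: "action W h (p0 w) \<in> rspace W" if "h \<in> carrier G" for h w
        using that p0(1) UW act_mem by auto
      have "action W g (p w) = cscale (1/n)
          (action W g (\<Sum>h\<in>carrier G. action W h (p0 (action W (inv h) w))))"
        unfolding p_def using g in_W by (intro act_scale cfun.subspace_sum[OF subspace_W])
      also have "action W g (\<Sum>h\<in>carrier G. action W h (p0 (action W (inv h) w))) =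
          (\<Sum>h\<in>carrier G. action W (g \<otimes> h) (p0 (action W (inv h) w)))"
        using g in_W p0(1) UW by (subst act_sum) (auto simp: act_mult subset_iff)
      also have "(\<Sum>h\<in>carrier G. action W (g \<otimes> h) (p0 (action W (inv h) w))) =
          (\<Sum>h\<in>carrier G. action W (g \<otimes> h) (p0 (action W (inv (g \<otimes> h)) (action W g w))))"
        using g w by (intro sum.cong refl)
          (simp add: inv_mult_group act_mult[symmetric] m_assoc)
      also have "\<dots> = (\<Sum>h\<in>carrier G. action W h (p0 (action W (inv h) (action W g w))))"
        by (rule sum_left_translate[OF g])
      finally show ?thesis unfolding p_def by (rule sym)
    qed
  qed
qed

text \<open>The decreasing measure for the inductions over subrepresentations. The finite spanning
  set matters, because an infinite basis has cardinality 0.\<close>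

lemma dim_less_of_psubset:
  assumes "cfun.subspace U" "U \<subset> W" "W \<subseteq> cfun.span X" "finite X"
  shows "cfun.dim U < cfun.dim W"
proof -
  obtain w where w: "w \<in> W" "w \<notin> U" using assms(2) by auto
  obtain B where B: "B \<subseteq> U" "cfun.independent B" "U \<subseteq> cfun.span B" "card B = cfun.dim U"
    using cfun.basis_exists by blast
  have span: "cfun.span B = U"
    using B assms(1) by (simp add: cfun.span_subspace)
  have ind: "cfun.independent (insert w B)"
    using B w span by (intro cfun.independent_insertI) auto
  obtain B' where B': "insert w B \<subseteq> B'" "B' \<subseteq> W" "cfun.independent B'" "W \<subseteq> cfun.span B'"
    using cfun.maximal_independent_subset_extend[of "insert w B" W] ind w assms(2) B(1) by blast
  have "finite B'"
    using cfun.independent_span_bound[of X B'] assms B' by auto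
  moreover have "w \<notin> B" using B w by auto
  ultimately have "card B < card B'"
    using B'(1) by (intro psubset_card_mono) auto
  then show ?thesis
    using B(4) cfun.basis_card_eq_dim[OF B'(2,4,3)] by simp
qed

context fin_rep
begin


lemma irreducible_iff:
  assumes "subrep G U W"
  shows "irreducible_rep G (W\<lparr>rspace := U\<rparr>) \<longleftrightarrow>
    U \<noteq> {0} \<and> (\<forall>U'. U' \<subseteq> U \<longrightarrow> subrep G U' W \<longrightarrow> U' = {0} \<or> U' = U)"
  using assms unfolding irreducible_rep_def by (auto simp: subrep_def)

text \<open>The complement is the part of \<open>W'\<close> killed by the invariant projection
  \<open>p\<close> onto \<open>U\<close>, and \<open>w\<close> splits as
  \<open>p w + (w - p w)\<close>.\<close>

lemma subrep_complement:
  assumes U: "subrep G U W" and W': "subrep G W' W" and "U \<subseteq> W'"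
  obtains C where "subrep G C W" "C \<subseteq> W'" "U \<inter> C = {0}"
    "\<And>w. w \<in> W' \<Longrightarrow> \<exists>u\<in>U. \<exists>c\<in>C. w = u + c"
proof -
  from invariant_projection[OF U] obtain p where p:
    "\<And>w. w \<in> rspace W \<Longrightarrow> p w \<in> U" "\<And>u. u \<in> U \<Longrightarrow> p u = u"
    "\<And>v w. v \<in> rspace W \<Longrightarrow> w \<in> rspace W \<Longrightarrow> p (v + w) = p v + p w"
    "\<And>c w. w \<in> rspace W \<Longrightarrow> p (cscale c w) = cscale c (p w)"
    "\<And>g w. g \<in> carrier G \<Longrightarrow> w \<in> rspace W \<Longrightarrow> p (action W g w) = action W g (p w)"
    by blast
  have W'W: "W' \<subseteq> rspace W" and sW': "cfun.subspace W'" and sU: "cfun.subspace U"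
    and invW': "\<And>g u. g \<in> carrier G \<Longrightarrow> u \<in> W' \<Longrightarrow> action W g u \<in> W'"
    using U W' unfolding subrep_iff by auto
  define C where "C = {w \<in> W'. p w = 0}"
  have p0: "p 0 = 0" using p(2) cfun.subspace_0[OF sU] by simp
  show ?thesis
  proof
    show "subrep G C W"
      unfolding subrep_iff
    proof (intro conjI ballI)
      show "cfun.subspace C"
        unfolding C_def using sW' p W'W p0
        by (auto simp: cfun.subspace_def subset_iff)
      fix g w assume "g \<in> carrier G" "w \<in> C"
      then show "action W g w \<in> C"
        using W'W invW' p(5) act_zero by (auto simp: C_def subset_iff)
    qed (use W'W in \<open>auto simp: C_def\<close>)
    show "C \<subseteq> W'" by (auto simp: C_def)
    show "U \<inter> C = {0}"
      using p(2) cfun.subspace_0[OF sU] cfun.subspace_0[OF sW'] p0 by (auto simp: C_def)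
    fix w assume w: "w \<in> W'"
    have pw: "p w \<in> U" "p w \<in> W'" using w W'W p(1) assms(3) by auto
    have "p w + p (w - p w) = p w"
      using p(3)[of "p w" "w - p w"] w pw W'W p(2)[of "p w"] cfun.subspace_diff[OF sW'] by (auto simp: subset_iff)
    then have "p (w - p w) = 0" by simp
    then have "w - p w \<in> C"
      using w pw cfun.subspace_diff[OF sW'] by (simp add: C_def)
    then show "\<exists>u\<in>U. \<exists>c\<in>C. w = u + c"
      using pw by (intro bexI[of _ "p w"] bexI[of _ "w - p w"]) auto
  qed
qed

lemma exists_irreducible_subrep:
  assumes "rspace W \<subseteq> cfun.span X" "finite X"
  shows "subrep G W' W \<Longrightarrow> W' \<noteq> {0} \<Longrightarrow>
    \<exists>U\<subseteq>W'. subrep G U W \<and> irreducible_rep G (W\<lparr>rspace := U\<rparr>)"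
proof (induction "cfun.dim W'" arbitrary: W' rule: less_induct)
  case less
  show ?case
  proof (cases "irreducible_rep G (W\<lparr>rspace := W'\<rparr>)")
    case True
    then show ?thesis using less.prems(1) by blast
  next
    case False
    then obtain U where U: "U \<subseteq> W'" "subrep G U W" "U \<noteq> {0}" "U \<noteq> W'"
      using irreducible_iff[OF less.prems(1)] less.prems(2) by auto
    have "cfun.dim U < cfun.dim W'"
    proof (rule dim_less_of_psubset[OF _ _ _ assms(2)])
      show "cfun.subspace U" using U(2) by (simp only: subrep_iff)
      show "U \<subset> W'" using U(1,4) by blast
      show "W' \<subseteq> cfun.span X" using less.prems(1) assms(1) unfolding subrep_iff by blast
    qed
    from less.hyps[OF this U(2,3)] show ?thesis using U(1) by (meson order_trans)
  qed
qed

text \<open>An irreducible summand is split off, and its complement, of smaller dimension, is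
  decomposed by induction. The new summand receives the index \<open>N\<close>.\<close>

lemma exists_irreducible_decomposition_of_subrep:
  assumes "rspace W \<subseteq> cfun.span X" "finite X"
  shows "subrep G W' W \<Longrightarrow> \<exists>N U. irreducible_decomposition G (W\<lparr>rspace := W'\<rparr>) N U"
proof (induction "cfun.dim W'" arbitrary: W' rule: less_induct)
  case less
  show ?case
  proof (cases "W' = {0}")
    case True
    have "irreducible_decomposition G (W\<lparr>rspace := W'\<rparr>) 0 (\<lambda>_. {})"
      using True by (auto simp: irreducible_decomposition_def bij_betw_def)
    then show ?thesis by blast
  next
    case False
    obtain U where U: "U \<subseteq> W'" "subrep G U W" "irreducible_rep G (W\<lparr>rspace := U\<rparr>)"
      using exists_irreducible_subrep[OF assms less.prems False] by blast
    obtain C where C: "subrep G C W" "C \<subseteq> W'" "U \<inter> C = {0}"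
        "\<And>w. w \<in> W' \<Longrightarrow> \<exists>u\<in>U. \<exists>c\<in>C. w = u + c"
      using subrep_complement[OF U(2) less.prems U(1)] by blast
    have sU: "cfun.subspace U" and sC: "cfun.subspace C" and sW': "cfun.subspace W'"
      using U C less.prems by (auto simp: subrep_iff)
    have "U \<noteq> {0}" using U(3) by (simp add: irreducible_rep_def)
    then have "C \<noteq> W'" using C(3) U(1) cfun.subspace_0[OF sU] by auto
    then have "C \<subset> W'" using C(2) by blast
    moreover have "W' \<subseteq> cfun.span X" using less.prems assms(1) unfolding subrep_iff by blast
    ultimately have "cfun.dim C < cfun.dim W'" by (rule dim_less_of_psubset[OF sC _ _ assms(2)])
    from less.hyps[OF this C(1)] obtain N Us where
      "irreducible_decomposition G (W\<lparr>rspace := C\<rparr>) N Us" by blast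
    then have D: "\<And>i. i < N \<Longrightarrow> subrep G (Us i) (W\<lparr>rspace := C\<rparr>)"
        "\<And>i. i < N \<Longrightarrow> irreducible_rep G (W\<lparr>rspace := Us i\<rparr>)"
        "bij_betw (\<lambda>u. \<Sum>i<N. u i) (Pi\<^sub>E {..<N} Us) C"
      by (auto simp: irreducible_decomposition_def)
    define U' where "U' i = (if i < N then Us i else U)" for i
    have PiE_split: "restrict u {..<N} \<in> Pi\<^sub>E {..<N} Us" "u N \<in> U" if "u \<in> Pi\<^sub>E {..<Suc N} U'" for u
    proof -
      have u: "u i \<in> U' i" if "i < Suc N" for i
        using PiE_mem[OF \<open>u \<in> _\<close>, of i] that by simp
      show "restrict u {..<N} \<in> Pi\<^sub>E {..<N} Us"
      proof (rule restrict_PiE_iff[THEN iffD2], rule ballI)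
        fix i assume "i \<in> {..<N}"
        then show "u i \<in> Us i" using u[of i] by (simp add: U'_def)
      qed
      show "u N \<in> U" using u[of N] by (simp add: U'_def)
    qed
    have sum_in: "(\<Sum>i<N. u i) \<in> C" if "u \<in> Pi\<^sub>E {..<Suc N} U'" for u
    proof -
      have "(\<Sum>i<N. restrict u {..<N} i) \<in> C"
        using bij_betwE[OF D(3)] PiE_split(1)[OF that] by blast
      then show ?thesis by simp
    qed
    have "bij_betw (\<lambda>u. \<Sum>i<Suc N. u i) (Pi\<^sub>E {..<Suc N} U') W'"
      unfolding bij_betw_def
    proof
      show "inj_on (\<lambda>u. \<Sum>i<Suc N. u i) (Pi\<^sub>E {..<Suc N} U')"
      proof (rule inj_onI)
        fix u v assume u: "u \<in> Pi\<^sub>E {..<Suc N} U'" and v: "v \<in> Pi\<^sub>E {..<Suc N} U'"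
          and eq: "(\<Sum>i<Suc N. u i) = (\<Sum>i<Suc N. v i)"
        have eq1: "u N - v N = (\<Sum>i<N. v i) - (\<Sum>i<N. u i)"
          using eq by (simp add: algebra_simps)
        \<comment> \<open>The difference lies in \<open>U\<close> and, by \<open>eq1\<close>, also
          in the complement \<open>C\<close>; hence it is zero.\<close>
        have "u N - v N \<in> U" using PiE_split u v sU by (auto intro: cfun.subspace_diff)
        moreover have "u N - v N \<in> C"
          unfolding eq1 using sum_in u v sC by (auto intro: cfun.subspace_diff)
        ultimately have z: "u N - v N = 0" using C(3) by blast
        then have "(\<Sum>i<N. restrict u {..<N} i) = (\<Sum>i<N. restrict v {..<N} i)"
          using eq1 by simp
        then have r: "restrict u {..<N} = restrict v {..<N}"
          using D(3) PiE_split(1) u v unfolding bij_betw_def inj_on_def by blast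
        show "u = v"
        proof (rule PiE_ext[OF u v])
          fix i assume "i \<in> {..<Suc N}"
          then show "u i = v i"
            using fun_cong[OF r, of i] z by (cases "i = N") auto
        qed
      qed
      show "(\<lambda>u. \<Sum>i<Suc N. u i) ` Pi\<^sub>E {..<Suc N} U' = W'"
      proof (intro equalityI subsetI)
        fix w assume "w \<in> (\<lambda>u. \<Sum>i<Suc N. u i) ` Pi\<^sub>E {..<Suc N} U'"
        then obtain u where u: "u \<in> Pi\<^sub>E {..<Suc N} U'" "w = (\<Sum>i<N. u i) + u N" by auto
        then show "w \<in> W'"
          using sum_in PiE_split(2) C(2) U(1) sW' by (auto intro!: cfun.subspace_add)
      next
        fix w assume "w \<in> W'"
        then obtain x c where xc: "x \<in> U" "c \<in> C" "w = x + c" using C(4) by blast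
        obtain u where u: "u \<in> Pi\<^sub>E {..<N} Us" "c = (\<Sum>i<N. u i)"
          using D(3) xc(2) by (auto simp: bij_betw_def)
        have "u(N := x) \<in> Pi\<^sub>E {..<Suc N} U'"
          using u xc by (auto simp: U'_def PiE_iff extensional_def)
        moreover have "w = (\<Sum>i<Suc N. (u(N := x)) i)"
          using u xc by (simp add: add.commute)
        ultimately show "w \<in> (\<lambda>u. \<Sum>i<Suc N. u i) ` Pi\<^sub>E {..<Suc N} U'" by blast
      qed
    qed
    moreover have "subrep G (U' i) (W\<lparr>rspace := W'\<rparr>) \<and> irreducible_rep G (W\<lparr>rspace := U' i\<rparr>)" for i
      using D(1)[of i] D(2)[of i] U C(2) by (auto simp: U'_def subrep_def)
    ultimately have "irreducible_decomposition G (W\<lparr>rspace := W'\<rparr>) (Suc N) U'"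
      by (simp add: irreducible_decomposition_def)
    then show ?thesis by blast
  qed
qed

lemma exists_irreducible_decomposition:
  assumes "frame W X d"
  shows "\<exists>N U. irreducible_decomposition G W N U"
proof -
  have "rspace W \<subseteq> cfun.span (d ` X)"
  proof
    fix w assume "w \<in> rspace W"
    then have "w = (\<Sum>x\<in>X. cscale (w x) (d x))"
      using assms unfolding frame_def by blast
    also have "\<dots> \<in> cfun.span (d ` X)"
      by (intro cfun.span_sum cfun.span_scale cfun.span_base) auto
    finally show "w \<in> cfun.span (d ` X)" .
  qed
  moreover have "subrep G (rspace W) W" using rep by (simp add: subrep_def)
  moreover have "finite (d ` X)" using assms by (simp add: frame_def)
  ultimately show ?thesis
    using exists_irreducible_decomposition_of_subrep[of "d ` X" "rspace W"] by simp
qed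

end

subsection \<open>Left ideals generated by primitive idempotents\<close>

text \<open>The right-hand side repeats that of \<open>specht\<close> with an arbitrary generator,
  so that a Specht module is literally a left ideal of this kind.\<close>

definition left_ideal_rep :: "'g monoid \<Rightarrow> ('g \<Rightarrow> complex) \<Rightarrow> ('g, 'g) rep"
  where "left_ideal_rep G e =
    \<lparr> rspace = (\<lambda>a. convolution G a e) ` group_algebra G,
      action = (\<lambda>k a g. if g \<in> carrier G then a (inv\<^bsub>G\<^esub> k \<otimes>\<^bsub>G\<^esub> g) else 0) \<rparr>"

context fin_group
begin

lemma convolution_mem: "convolution G a b \<in> group_algebra G"
  by (simp add: convolution_def group_algebra_def)

lemma convolution_outside: "g \<notin> carrier G \<Longrightarrow> convolution G a b g = 0"
  by (simp add: convolution_def)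

lemma convolution_assoc:
  "convolution G (convolution G a b) c = convolution G a (convolution G b c)"
proof
  fix g
  show "convolution G (convolution G a b) c g = convolution G a (convolution G b c) g"
  proof (cases "g \<in> carrier G")
    case True
    have "convolution G (convolution G a b) c g =
        (\<Sum>h\<in>carrier G. \<Sum>k\<in>carrier G. a k * b (inv k \<otimes> h) * c (inv h \<otimes> g))"
      using True by (simp add: convolution_def sum_distrib_right)
    also have "\<dots> = (\<Sum>k\<in>carrier G. \<Sum>h\<in>carrier G. a k * b (inv k \<otimes> h) * c (inv h \<otimes> g))"
      by (rule sum.swap)
    also have "\<dots> = (\<Sum>k\<in>carrier G. \<Sum>m\<in>carrier G. a k * (b m * c (inv m \<otimes> (inv k \<otimes> g))))"
    proof (rule sum.cong[OF refl])
      fix k assume k: "k \<in> carrier G"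
      have "(\<Sum>h\<in>carrier G. a k * b (inv k \<otimes> h) * c (inv h \<otimes> g)) =
          (\<Sum>m\<in>carrier G. a k * b (inv k \<otimes> (k \<otimes> m)) * c (inv (k \<otimes> m) \<otimes> g))"
        by (rule sum_left_translate[OF k, symmetric])
      also have "\<dots> = (\<Sum>m\<in>carrier G. a k * (b m * c (inv m \<otimes> (inv k \<otimes> g))))"
        using k True by (intro sum.cong refl) (simp add: m_assoc[symmetric] inv_mult_group)
      finally show "(\<Sum>h\<in>carrier G. a k * b (inv k \<otimes> h) * c (inv h \<otimes> g)) =
          (\<Sum>m\<in>carrier G. a k * (b m * c (inv m \<otimes> (inv k \<otimes> g))))" .
    qed
    also have "\<dots> = convolution G a (convolution G b c) g"
      using True by (simp add: convolution_def sum_distrib_left)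
    finally show ?thesis .
  qed (simp add: convolution_outside)
qed

lemma convolution_add_left: "convolution G (a + b) c = convolution G a c + convolution G b c"
  by (rule ext) (simp add: convolution_def ring_distribs sum.distrib)


lemma convolution_scale_left: "convolution G (cscale r a) b = cscale r (convolution G a b)"
  by (rule ext) (simp add: convolution_def sum_distrib_left mult.assoc)

lemma convolution_scale_right: "convolution G a (cscale r b) = cscale r (convolution G a b)"
  by (rule ext) (simp add: convolution_def sum_distrib_left mult.left_commute)

lemma convolution_0: "convolution G a 0 = 0" "convolution G 0 a = 0"
  by (rule ext; simp add: convolution_def)+

lemma subspace_group_algebra: "cfun.subspace (group_algebra G)"
  by (auto simp: cfun.subspace_def group_algebra_def)

lemma convolution_expand:
  "(\<Sum>h\<in>carrier G. a h * b (inv h \<otimes> g)) = (\<Sum>h\<in>carrier G. a (g \<otimes> inv h) * b h)"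
  if "g \<in> carrier G"
  using that by (intro sum.reindex_bij_witness[of _ "\<lambda>h. g \<otimes> inv h" "\<lambda>h. inv h \<otimes> g"])
    (auto simp: m_assoc inv_mult_group m_assoc[symmetric])

lemma translate_convolution:
  assumes "k \<in> carrier G"
  shows "(\<lambda>g. if g \<in> carrier G then convolution G a b (inv k \<otimes> g) else 0) =
    convolution G (\<lambda>g. if g \<in> carrier G then a (inv k \<otimes> g) else 0) b"
proof
  fix g
  show "(if g \<in> carrier G then convolution G a b (inv k \<otimes> g) else 0) =
    convolution G (\<lambda>g. if g \<in> carrier G then a (inv k \<otimes> g) else 0) b g"
  proof (cases "g \<in> carrier G")
    case True
    then have "convolution G a b (inv k \<otimes> g) =
        (\<Sum>h\<in>carrier G. a (inv k \<otimes> g \<otimes> inv h) * b h)"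
      using assms by (simp add: convolution_def convolution_expand)
    also have "\<dots> = (\<Sum>h\<in>carrier G. (if g \<otimes> inv h \<in> carrier G then a (inv k \<otimes> (g \<otimes> inv h)) else 0) * b h)"
      using True assms by (intro sum.cong refl) (simp add: m_assoc)
    also have "\<dots> = convolution G (\<lambda>g. if g \<in> carrier G then a (inv k \<otimes> g) else 0) b g"
      using True convolution_expand[of g "\<lambda>g. if g \<in> carrier G then a (inv k \<otimes> g) else 0" b]
      by (simp add: convolution_def)
    finally show ?thesis using True by simp
  qed (simp add: convolution_outside)
qed

lemma left_ideal_rep_representation:
  "representation G (left_ideal_rep G e)"
  unfolding representation_def left_ideal_rep_def rep.simps
proof (intro conjI ballI allI)
  let ?L = "\<lambda>k a g. if g \<in> carrier G then a (inv k \<otimes> g) else (0::complex)"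
  let ?V = "(\<lambda>a. convolution G a e) ` group_algebra G"
  show "cfun.subspace ?V"
    unfolding cfun.subspace_def
  proof (intro conjI ballI allI)
    show "0 \<in> ?V"
      by (rule image_eqI[of _ _ 0]) (auto simp: convolution_0 group_algebra_def)
    fix v w assume "v \<in> ?V" "w \<in> ?V"
    then show "v + w \<in> ?V"
      using cfun.subspace_add[OF subspace_group_algebra]
      by (auto simp: convolution_add_left[symmetric] simp del: plus_fun_apply)
  next
    fix c v assume "v \<in> ?V"
    then show "cscale c v \<in> ?V"
      using cfun.subspace_scale[OF subspace_group_algebra]
      by (auto simp: convolution_scale_left[symmetric])
  qed
  fix k assume k: "k \<in> carrier G"
  show "?L k v \<in> ?V" if "v \<in> ?V" for v
  proof -
    obtain a where "a \<in> group_algebra G" "v = convolution G a e"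
      using \<open>v \<in> ?V\<close> by auto
    then show ?thesis
      unfolding \<open>v = _\<close> translate_convolution[OF k]
      by (intro imageI) (simp add: group_algebra_def)
  qed
  show "?L k (v + w) = ?L k v + ?L k w" for v w :: "'g \<Rightarrow> complex"
    by (rule ext) simp
  show "?L k (cscale c v) = cscale c (?L k v)" for c and v :: "'g \<Rightarrow> complex"
    by (rule ext) simp
  show "?L (k \<otimes> h) v = ?L k (?L h v)" if "h \<in> carrier G" for h v
    using k that by (auto simp: fun_eq_iff inv_mult_group m_assoc)
next
  let ?L = "\<lambda>k a g. if g \<in> carrier G then a (inv k \<otimes> g) else (0::complex)"
  fix v assume "v \<in> (\<lambda>a. convolution G a e) ` group_algebra G"
  then show "?L \<one> v = v"
    by (auto simp: fun_eq_iff convolution_outside)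
qed

lemma alg_act_left_ideal_rep: "alg_act G (left_ideal_rep G e) a v = convolution G a v"
  by (rule ext) (simp add: alg_act_def left_ideal_rep_def convolution_def sum_fun_eval)

end

text \<open>\<open>prim\<close> says that \<open>e A e\<close> is the line spanned by
  \<open>e\<close>, where \<open>A\<close> is the group algebra. Over the complex numbers this is
  primitivity; it makes the left ideal irreducible and lets \<open>e\<close> cut out of an
  irreducible representation either nothing or a line.\<close>

locale primitive_idempotent = fin_group +
  fixes e :: "'g \<Rightarrow> complex"
  assumes e_alg: "e \<in> group_algebra G"
    and idem: "convolution G e e = e"
    and e_nonzero: "e \<noteq> 0"
    and prim: "a \<in> group_algebra G \<Longrightarrow> \<exists>c. convolution G e (convolution G a e) = cscale c e"

sublocale primitive_idempotent \<subseteq> ideal: fin_rep G "left_ideal_rep G e"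
  by standard (rule left_ideal_rep_representation)

context primitive_idempotent
begin

abbreviation "ideal_rep \<equiv> left_ideal_rep G e"

lemma rspace_ideal: "rspace ideal_rep = {v \<in> group_algebra G. convolution G v e = v}"
proof (intro equalityI subsetI)
  fix v assume "v \<in> rspace ideal_rep"
  then show "v \<in> {v \<in> group_algebra G. convolution G v e = v}"
    by (auto simp: left_ideal_rep_def convolution_mem convolution_assoc idem)
next
  fix v assume "v \<in> {v \<in> group_algebra G. convolution G v e = v}"
  then show "v \<in> rspace ideal_rep"
    unfolding left_ideal_rep_def rep.simps by (intro image_eqI[of _ _ v]) auto
qed

lemma e_in_ideal: "e \<in> rspace ideal_rep"
  by (simp add: rspace_ideal e_alg idem)

lemma alg_act_ideal: "alg_act G ideal_rep a v = convolution G a v"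
  by (rule alg_act_left_ideal_rep)

end

context fin_group
begin

text \<open>The value at the identity is the sum of the squared moduli of \<open>x\<close>. This
  positivity takes the place of semisimplicity: a nonzero self-adjoint element cannot have square
  zero.\<close>

lemma convolution_star_nonzero:
  assumes "x \<in> group_algebra G" "x \<noteq> 0"
  shows "convolution G (\<lambda>g. if g \<in> carrier G then cnj (x (inv g)) else 0) x \<one> \<noteq> 0"
proof -
  have "convolution G (\<lambda>g. if g \<in> carrier G then cnj (x (inv g)) else 0) x \<one> =
      of_real (\<Sum>g\<in>carrier G. (cmod (x (inv g)))\<^sup>2)"
    unfolding of_real_sum complex_norm_square by (simp add: convolution_def mult.commute)
  moreover have "(\<Sum>g\<in>carrier G. (cmod (x (inv g)))\<^sup>2) = (\<Sum>g\<in>carrier G. (cmod (x g))\<^sup>2)"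
    by (rule sum_inverse)
  moreover have "(\<Sum>g\<in>carrier G. (cmod (x g))\<^sup>2) \<noteq> 0"
  proof
    assume "(\<Sum>g\<in>carrier G. (cmod (x g))\<^sup>2) = 0"
    then have "\<forall>g\<in>carrier G. x g = 0"
      using finite_G by (simp add: sum_nonneg_eq_0_iff)
    then have "x = 0" using assms(1) by (auto simp: group_algebra_def fun_eq_iff)
    with assms(2) show False ..
  qed
  ultimately show ?thesis by (simp only: of_real_eq_0_iff not_False_eq_True)
qed

text \<open>The product \<open>y\<close> of the adjoint of \<open>x\<close> with \<open>x\<close> is
  self-adjoint, so the positivity can be applied a second time, to \<open>y y\<close>.\<close>

lemma convolution_star_star:
  fixes x :: "'g \<Rightarrow> complex"
  defines "y \<equiv> convolution G (\<lambda>g. if g \<in> carrier G then cnj (x (inv g)) else 0) x"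
  shows "(\<lambda>g. if g \<in> carrier G then cnj (y (inv g)) else 0) = y"
proof
  fix g
  show "(if g \<in> carrier G then cnj (y (inv g)) else 0) = y g"
  proof (cases "g \<in> carrier G")
    case True
    have "cnj (y (inv g)) = (\<Sum>h\<in>carrier G. x (inv h) * cnj (x (inv h \<otimes> inv g)))"
      using True by (simp add: y_def convolution_def)
    also have "\<dots> = (\<Sum>h\<in>carrier G. x (inv (inv g \<otimes> h)) * cnj (x (inv (inv g \<otimes> h) \<otimes> inv g)))"
      using True by (intro sum_left_translate[symmetric]) auto
    also have "\<dots> = (\<Sum>h\<in>carrier G. cnj (x (inv h)) * x (inv h \<otimes> g))"
      using True by (intro sum.cong refl) (simp add: inv_mult_group m_assoc)
    also have "\<dots> = y g"
      using True by (simp add: y_def convolution_def)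
    finally show ?thesis using True by simp
  qed (simp add: y_def convolution_def)
qed

end

context primitive_idempotent
begin

text \<open>Otherwise \<open>e U = 0\<close>. For a nonzero \<open>u \<in> U\<close> the product of
  its adjoint with \<open>u\<close> is a nonzero self-adjoint \<open>x \<in> U\<close>. As
  \<open>x e = x\<close>, it satisfies \<open>x x = x e x = 0\<close>, against positivity.\<close>

lemma exists_nonzero_e_multiple:
  assumes U: "subrep G U ideal_rep" and "U \<noteq> {0}"
  shows "\<exists>u\<in>U. convolution G e u \<noteq> 0"
proof (rule ccontr)
  assume "\<not> ?thesis"
  then have z: "convolution G e u = 0" if "u \<in> U" for u using that by blast
  have sub: "U \<subseteq> rspace ideal_rep" and sU: "cfun.subspace U"
    and invU: "\<And>g u. g \<in> carrier G \<Longrightarrow> u \<in> U \<Longrightarrow> action ideal_rep g u \<in> U"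
    using U unfolding ideal.subrep_iff by auto
  obtain u where u: "u \<in> U" "u \<noteq> 0"
    using assms(2) cfun.subspace_0[OF sU] by blast
  define x where "x = convolution G (\<lambda>g. if g \<in> carrier G then cnj (u (inv g)) else 0) u"
  have ua: "u \<in> group_algebra G" using sub u(1) rspace_ideal by auto
  have "x \<in> U"
    unfolding x_def alg_act_ideal[symmetric] by (rule ideal.alg_act_in[OF sU invU[OF _ u(1)]])
  then have xx: "convolution G x x = 0"
    using z[of x] sub convolution_assoc[of x e x] by (auto simp: rspace_ideal convolution_0)
  have "x \<one> \<noteq> 0" unfolding x_def by (rule convolution_star_nonzero[OF ua u(2)])
  then have "x \<noteq> 0" by auto
  have "(\<lambda>g. if g \<in> carrier G then cnj (x (inv g)) else 0) = x"
    unfolding x_def by (rule convolution_star_star)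
  then have "convolution G x x \<one> \<noteq> 0"
    using convolution_star_nonzero[of x] \<open>x \<noteq> 0\<close> convolution_mem unfolding x_def by metis
  with xx show False by simp
qed

text \<open>For \<open>u = u e\<close> the product \<open>e u = e u e\<close> is a multiple of
  \<open>e\<close>, and it can be chosen nonzero. So \<open>U\<close> contains \<open>e\<close> and
  with it the whole ideal.\<close>

lemma subrep_ideal_full:
  assumes U: "subrep G U ideal_rep" and "U \<noteq> {0}"
  shows "U = rspace ideal_rep"
proof -
  have sub: "U \<subseteq> rspace ideal_rep" and sU: "cfun.subspace U"
    and invU: "\<And>g u. g \<in> carrier G \<Longrightarrow> u \<in> U \<Longrightarrow> action ideal_rep g u \<in> U"
    using U unfolding ideal.subrep_iff by auto
  obtain u where u: "u \<in> U" "convolution G e u \<noteq> 0"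
    using exists_nonzero_e_multiple[OF assms] by blast
  have ua: "u \<in> group_algebra G" "convolution G u e = u" using sub u(1) rspace_ideal by auto
  obtain c where c: "convolution G e u = cscale c e"
    using prim[OF ua(1)] ua(2) by auto
  have "c \<noteq> 0" using c u(2) by auto
  have "cscale c e \<in> U"
    unfolding c[symmetric] alg_act_ideal[symmetric] by (rule ideal.alg_act_in[OF sU invU[OF _ u(1)]])
  then have "cscale (1/c) (cscale c e) \<in> U" by (rule cfun.subspace_scale[OF sU])
  then have eU: "e \<in> U" using \<open>c \<noteq> 0\<close> by simp
  have "rspace ideal_rep \<subseteq> U"
  proof
    fix v assume "v \<in> rspace ideal_rep"
    then have "v = convolution G v e" by (simp add: rspace_ideal)
    also have "\<dots> \<in> U"
      unfolding alg_act_ideal[symmetric] by (rule ideal.alg_act_in[OF sU invU[OF _ eU]])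
    finally show "v \<in> U" .
  qed
  with sub show ?thesis by blast
qed

text \<open>A homomorphism from the ideal is determined by the image of \<open>e\<close>, a vector
  fixed by \<open>e\<close>. Conversely a vector \<open>u\<close> with \<open>e u \<noteq> 0\<close>
  gives the homomorphism \<open>a \<mapsto> a u\<close>; since both sides are irreducible, its
  kernel is zero and its image is everything.\<close>

lemma iso_rep_iff:
  assumes W: "fin_rep G W" and U: "subrep G U W" and irr: "irreducible_rep G (W\<lparr>rspace := U\<rparr>)"
  shows "iso_rep G ideal_rep (W\<lparr>rspace := U\<rparr>) \<longleftrightarrow> (\<exists>u\<in>U. alg_act G W e u \<noteq> 0)"
proof
  interpret W: fin_rep G W by (rule W)
  have sub: "U \<subseteq> rspace W" and sU: "cfun.subspace U"
    and invU: "\<And>g u. g \<in> carrier G \<Longrightarrow> u \<in> U \<Longrightarrow> action W g u \<in> U"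
    using U unfolding W.subrep_iff by auto
  have zero_ideal: "0 \<in> rspace ideal_rep" by (rule cfun.subspace_0[OF ideal.subspace_W])
  {
    assume "iso_rep G ideal_rep (W\<lparr>rspace := U\<rparr>)"
    then obtain \<phi> where bij: "bij_betw \<phi> (rspace ideal_rep) U"
      and add: "\<And>v w. v \<in> rspace ideal_rep \<Longrightarrow> w \<in> rspace ideal_rep \<Longrightarrow> \<phi> (v + w) = \<phi> v + \<phi> w"
      and scale: "\<And>c v. v \<in> rspace ideal_rep \<Longrightarrow> \<phi> (cscale c v) = cscale c (\<phi> v)"
      and equiv: "\<And>g v. g \<in> carrier G \<Longrightarrow> v \<in> rspace ideal_rep \<Longrightarrow>
        \<phi> (action ideal_rep g v) = action W g (\<phi> v)"
      by (auto simp: iso_rep_def)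
    have \<phi>0: "\<phi> 0 = 0" using scale[OF zero_ideal, of 0] by simp
    have \<phi>_sum: "\<phi> (\<Sum>i\<in>A. f i) = (\<Sum>i\<in>A. \<phi> (f i))"
      if "\<And>i. i \<in> A \<Longrightarrow> f i \<in> rspace ideal_rep" for A and f :: "'g \<Rightarrow> 'g \<Rightarrow> complex"
      using that
    proof (induction A rule: infinite_finite_induct)
      case (insert a A)
      then have "\<phi> (f a + sum f A) = \<phi> (f a) + \<phi> (sum f A)"
        by (intro add cfun.subspace_sum[OF ideal.subspace_W]) auto
      moreover have "\<phi> (sum f A) = (\<Sum>i\<in>A. \<phi> (f i))"
        using insert.prems by (intro insert.IH) blast
      ultimately show ?case by (simp only: sum.insert[OF insert.hyps])
    qed (simp_all add: \<phi>0)
    \<comment> \<open>Since \<open>e = e e\<close>, equivariance gives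
      \<open>\<phi> e = e (\<phi> e)\<close>, so \<open>\<phi> e\<close> is the required
      vector.\<close>
    have "\<phi> e = \<phi> (alg_act G ideal_rep e e)" by (simp add: alg_act_ideal idem)
    also have "\<dots> = (\<Sum>g\<in>carrier G. \<phi> (cscale (e g) (action ideal_rep g e)))"
      unfolding alg_act_def
      by (intro \<phi>_sum cfun.subspace_scale[OF ideal.subspace_W] ideal.act_mem e_in_ideal)
    also have "\<dots> = alg_act G W e (\<phi> e)"
      unfolding alg_act_def
      by (intro sum.cong refl) (simp add: scale equiv ideal.act_mem e_in_ideal)
    finally have "alg_act G W e (\<phi> e) = \<phi> e" ..
    moreover have "\<phi> e \<noteq> 0"
      using bij e_in_ideal zero_ideal e_nonzero \<phi>0 unfolding bij_betw_def inj_on_def by metis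
    moreover have "\<phi> e \<in> U" using bij e_in_ideal by (auto simp: bij_betw_def)
    ultimately show "\<exists>u\<in>U. alg_act G W e u \<noteq> 0" by metis
  }
  assume "\<exists>u\<in>U. alg_act G W e u \<noteq> 0"
  then obtain u where u: "u \<in> U" "alg_act G W e u \<noteq> 0" by blast
  have uW: "u \<in> rspace W" using u sub by blast
  define \<phi> where "\<phi> a = alg_act G W a u" for a
  have add: "\<phi> (a + b) = \<phi> a + \<phi> b" for a b by (simp only: \<phi>_def W.alg_act_plus)
  have scale: "\<phi> (cscale c a) = cscale c (\<phi> a)" for a c by (simp only: \<phi>_def W.alg_act_cscale)
  have equiv: "\<phi> (action ideal_rep g a) = action W g (\<phi> a)" if "g \<in> carrier G" for g a
    using W.act_alg_act[OF that uW] by (simp add: \<phi>_def left_ideal_rep_def)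
  have mem: "\<phi> a \<in> U" for a
    unfolding \<phi>_def by (rule W.alg_act_in[OF sU invU[OF _ u(1)]])
  have irr': "U' = {0} \<or> U' = U" if "U' \<subseteq> U" "subrep G U' W" for U'
    using irr that W.irreducible_iff[OF U] by blast
  let ?I = "\<phi> ` rspace ideal_rep"
  have "subrep G ?I W"
    unfolding W.subrep_iff
  proof (intro conjI ballI)
    show "cfun.subspace ?I"
      unfolding cfun.subspace_def
    proof (intro conjI ballI allI)
      show "0 \<in> ?I" using scale[of 0 0] zero_ideal by (intro image_eqI[of _ _ 0]) auto
      show "x + y \<in> ?I" if "x \<in> ?I" "y \<in> ?I" for x y
        using that cfun.subspace_add[OF ideal.subspace_W] unfolding image_iff by (metis add)
      show "cscale c x \<in> ?I" if "x \<in> ?I" for c x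
        using that cfun.subspace_scale[OF ideal.subspace_W] unfolding image_iff by (metis scale)
    qed
    show "action W g x \<in> ?I" if "g \<in> carrier G" "x \<in> ?I" for g x
      using that ideal.act_mem unfolding image_iff by (metis equiv)
  qed (use mem sub in auto)
  moreover have "?I \<noteq> {0}" using u(2) e_in_ideal by (auto simp: \<phi>_def)
  ultimately have surj: "?I = U" using irr'[of ?I] mem by blast
  let ?K = "{a \<in> rspace ideal_rep. \<phi> a = 0}"
  have "subrep G ?K ideal_rep"
    unfolding ideal.subrep_iff
  proof (intro conjI ballI)
    show "cfun.subspace ?K"
      using ideal.subspace_W scale[of 0 0] unfolding cfun.subspace_def by (auto simp: add scale)
    show "action ideal_rep g a \<in> ?K" if "g \<in> carrier G" "a \<in> ?K" for g a
      using that ideal.act_mem W.act_zero by (simp add: equiv)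
  qed auto
  moreover have "?K \<noteq> rspace ideal_rep" using u(2) e_in_ideal by (auto simp: \<phi>_def)
  ultimately have ker: "?K = {0}" using subrep_ideal_full by blast
  have inj: "inj_on \<phi> (rspace ideal_rep)"
  proof (rule inj_onI)
    fix a b assume ab: "a \<in> rspace ideal_rep" "b \<in> rspace ideal_rep" "\<phi> a = \<phi> b"
    have "\<phi> (a - b) + \<phi> b = \<phi> b" using add[of "a - b" b] ab(3) by simp
    then have "\<phi> (a - b) = 0" by simp
    then have "a - b \<in> ?K" using ab cfun.subspace_diff[OF ideal.subspace_W] by simp
    then have "a - b = 0" using ker by blast
    then show "a = b" by simp
  qed
  show "iso_rep G ideal_rep (W\<lparr>rspace := U\<rparr>)"
    unfolding iso_rep_def
  proof (intro exI[of _ \<phi>] conjI allI ballI)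
    show "bij_betw \<phi> (rspace ideal_rep) (rspace (W\<lparr>rspace := U\<rparr>))"
      using inj surj by (simp add: bij_betw_def)
  qed (simp_all add: add scale equiv del: plus_fun_apply)
qed

text \<open>An irreducible \<open>U\<close> isomorphic to the ideal is generated by any nonzero \<open>u\<^sub>0 \<in> e U\<close>, so
  \<open>e U = e A u\<^sub>0 = e A e u\<^sub>0\<close> is a line.\<close>

lemma e_image_is_line:
  assumes W: "fin_rep G W" and U: "subrep G U W" and irr: "irreducible_rep G (W\<lparr>rspace := U\<rparr>)"
    and ex: "\<exists>u\<in>U. alg_act G W e u \<noteq> 0"
  obtains u0 where "u0 \<in> U" "u0 \<noteq> 0" "alg_act G W e u0 = u0"
    "\<And>u. u \<in> U \<Longrightarrow> \<exists>s. alg_act G W e u = cscale s u0"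
proof -
  interpret W: fin_rep G W by (rule W)
  have sub: "U \<subseteq> rspace W" and sU: "cfun.subspace U"
    and invU: "\<And>g u. g \<in> carrier G \<Longrightarrow> u \<in> U \<Longrightarrow> action W g u \<in> U"
    using U unfolding W.subrep_iff by auto
  obtain u where u: "u \<in> U" "alg_act G W e u \<noteq> 0" using ex by blast
  have uW: "u \<in> rspace W" using u sub by blast
  define u0 where "u0 = alg_act G W e u"
  have u0U: "u0 \<in> U" unfolding u0_def by (rule W.alg_act_in[OF sU invU[OF _ u(1)]])
  then have u0W: "u0 \<in> rspace W" using sub by blast
  let ?A = "(\<lambda>a. alg_act G W a u0) ` group_algebra G"
  have eu0: "alg_act G W e u0 = u0"
    unfolding u0_def by (simp add: W.alg_act_convolution[OF uW, symmetric] idem)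
  have "subrep G ?A W"
    unfolding W.subrep_iff
  proof (intro conjI ballI)
    show "cfun.subspace ?A"
      unfolding cfun.subspace_def
    proof (intro conjI ballI allI)
      show "0 \<in> ?A" using cfun.subspace_0[OF subspace_group_algebra]
        by (intro image_eqI[of _ _ 0]) (auto simp: alg_act_def)
      show "x + y \<in> ?A" if "x \<in> ?A" "y \<in> ?A" for x y
        using that cfun.subspace_add[OF subspace_group_algebra]
        unfolding image_iff by (metis W.alg_act_plus)
      show "cscale c x \<in> ?A" if "x \<in> ?A" for c x
        using that cfun.subspace_scale[OF subspace_group_algebra]
        unfolding image_iff by (metis W.alg_act_cscale)
    qed
    show "action W g x \<in> ?A" if "g \<in> carrier G" "x \<in> ?A" for g x
    proof -
      obtain a where "x = alg_act G W a u0" using \<open>x \<in> ?A\<close> by auto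
      then show ?thesis
        using W.act_alg_act[OF that(1) u0W]
        by (intro image_eqI[of _ _ "\<lambda>h. if h \<in> carrier G then a (inv g \<otimes> h) else 0"])
           (auto simp: group_algebra_def)
    qed
    show "?A \<subseteq> rspace W" using W.alg_act_mem[OF u0W] by auto
  qed
  moreover have "u0 \<in> ?A" using eu0 e_alg by (intro image_eqI[of _ _ e]) auto
  moreover have "?A \<subseteq> U" using W.alg_act_in[OF sU invU[OF _ u0U]] by auto
  ultimately have A: "?A = U"
    using irr W.irreducible_iff[OF U] u(2) unfolding u0_def by blast
  have "\<exists>s. alg_act G W e v = cscale s u0" if "v \<in> U" for v
  proof -
    obtain a where a: "a \<in> group_algebra G" "v = alg_act G W a u0" using \<open>v \<in> U\<close> A by auto
    obtain c where c: "convolution G e (convolution G a e) = cscale c e" using prim[OF a(1)] by blast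
    have "alg_act G W e v = alg_act G W e (alg_act G W a (alg_act G W e u0))"
      by (simp add: a eu0)
    also have "\<dots> = alg_act G W (cscale c e) u0"
      by (simp only: W.alg_act_convolution[OF u0W, symmetric] W.alg_act_mem[OF u0W] c)
    finally show ?thesis by (auto simp: W.alg_act_cscale eu0)
  qed
  then show ?thesis using that u0U u(2) eu0 by (simp add: u0_def)
qed

text \<open>The idempotent \<open>e\<close> acts on \<open>W\<close> as a projection whose trace is
  read off the frame. On an irreducible summand it has rank 1 or 0, according to whether the summand
  is isomorphic to the ideal, so the trace counts these summands in any decomposition. In particular
  the \<open>THE\<close> in \<open>multiplicity_rep\<close> is well defined.\<close>

theorem multiplicity_eq_character_sum:
  assumes W: "representation G W" and fr: "frame W X d"
  shows "of_nat (multiplicity_rep G ideal_rep W) =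
    (\<Sum>g\<in>carrier G. e g * frame_character W X d g)"
proof -
  interpret W: fin_rep G W by standard (rule W)
  have finX: "finite X" and dW: "\<And>x. x \<in> X \<Longrightarrow> d x \<in> rspace W"
    and expand: "\<And>w. w \<in> rspace W \<Longrightarrow> w = (\<Sum>x\<in>X. cscale (w x) (d x))"
    using fr unfolding frame_def by blast+
  have chi: "(\<Sum>g\<in>carrier G. e g * frame_character W X d g) = (\<Sum>x\<in>X. alg_act G W e (d x) x)"
    unfolding frame_character_def alg_act_def sum_fun_eval cscale_apply sum_distrib_left
    by (rule sum.swap)
  have count: "of_nat (card {i \<in> {..<N}. iso_rep G ideal_rep (W\<lparr>rspace := U i\<rparr>)}) =
      (\<Sum>x\<in>X. alg_act G W e (d x) x)"
    if dec: "irreducible_decomposition G W N U" for N U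
  proof -
    have Ui: "subrep G (U i) W" "irreducible_rep G (W\<lparr>rspace := U i\<rparr>)" if "i < N" for i
      using dec that by (auto simp: irreducible_decomposition_def)
    have sU: "cfun.subspace (U i)" and subU: "U i \<subseteq> rspace W" if "i < N" for i
      using Ui[OF that] by (auto simp: W.subrep_iff)
    have bij: "bij_betw (\<lambda>u. \<Sum>i<N. u i) (Pi\<^sub>E {..<N} U) (rspace W)"
      using dec by (simp add: irreducible_decomposition_def)
    \<comment> \<open>\<open>cs w i\<close> is the component of \<open>w\<close> in the summand
      \<open>U i\<close>.\<close>
    define cs where "cs w = the_inv_into (Pi\<^sub>E {..<N} U) (\<lambda>u. \<Sum>i<N. u i) w" for w
    have cs: "cs w \<in> Pi\<^sub>E {..<N} U" "(\<Sum>i<N. cs w i) = w" if "w \<in> rspace W" for w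
      using that bij f_the_inv_into_f_bij_betw[OF bij, of w]
        bij_betwE[OF bij_betw_the_inv_into[OF bij]]
      by (auto simp: cs_def)
    have cs_unique: "cs w i = u i" if "i < N" "\<And>i. i < N \<Longrightarrow> u i \<in> U i" "(\<Sum>i<N. u i) = w" for w u i
    proof -
      have "restrict u {..<N} \<in> Pi\<^sub>E {..<N} U" using that(2) by auto
      moreover have "(\<Sum>i<N. restrict u {..<N} i) = w" using that(3) by simp
      ultimately have "cs w = restrict u {..<N}"
        unfolding cs_def using bij by (intro the_inv_into_f_eq) (auto simp: bij_betw_def)
      then show ?thesis using that(1) by simp
    qed
    have cs_in: "cs w i \<in> U i" if "w \<in> rspace W" "i < N" for w i
      using PiE_mem[OF cs(1)[OF that(1)], of i] that(2) by simp
    \<comment> \<open>The components of a frame of \<open>W\<close> form a frame of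
      \<open>U i\<close>, so that \<open>t i\<close> below is the trace of \<open>e\<close> on
      \<open>U i\<close>.\<close>
    have cs_lin: "w = (\<Sum>x\<in>X. cscale (w x) (cs (d x) i))" if w: "w \<in> U i" "i < N" for w i
    proof -
      have wW: "w \<in> rspace W" using w subU by blast
      have "cs w i = (\<Sum>x\<in>X. cscale (w x) (cs (d x) i))"
      proof (rule cs_unique[OF w(2)])
        show "(\<Sum>x\<in>X. cscale (w x) (cs (d x) j)) \<in> U j" if "j < N" for j
          using that sU cs_in dW by (intro cfun.subspace_sum cfun.subspace_scale) auto
        have "(\<Sum>j<N. \<Sum>x\<in>X. cscale (w x) (cs (d x) j)) =
            (\<Sum>x\<in>X. cscale (w x) (\<Sum>j<N. cs (d x) j))"
          by (subst sum.swap) (simp only: cfun.scale_sum_right)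
        also have "\<dots> = (\<Sum>x\<in>X. cscale (w x) (d x))"
          using cs(2) dW by (intro sum.cong refl) simp
        also have "\<dots> = w" using expand[OF wW] ..
        finally show "(\<Sum>j<N. \<Sum>x\<in>X. cscale (w x) (cs (d x) j)) = w" .
      qed
      moreover have "cs w i = (if i = i then w else 0)"
        using w sU by (intro cs_unique[where u = "\<lambda>j. if j = i then w else 0"])
          (auto simp: cfun.subspace_0)
      ultimately show ?thesis by simp
    qed
    define t where "t i = (\<Sum>x\<in>X. alg_act G W e (cs (d x) i) x)" for i
    have t: "t i = (if iso_rep G ideal_rep (W\<lparr>rspace := U i\<rparr>) then 1 else 0)" if i: "i < N" for i
    proof (cases "\<exists>u\<in>U i. alg_act G W e u \<noteq> 0")
      case True
      obtain u0 where u0: "u0 \<in> U i" "u0 \<noteq> 0" "alg_act G W e u0 = u0"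
        "\<And>u. u \<in> U i \<Longrightarrow> \<exists>s. alg_act G W e u = cscale s u0"
        using e_image_is_line[OF W.fin_rep_axioms Ui[OF i] True] by blast
      then have "\<forall>x\<in>X. \<exists>s. alg_act G W e (cs (d x) i) = cscale s u0"
        using cs_in dW i by blast
      then obtain s where s: "\<And>x. x \<in> X \<Longrightarrow> alg_act G W e (cs (d x) i) = cscale (s x) u0"
        by metis
      \<comment> \<open>The image of \<open>e\<close> in \<open>U i\<close> is spanned by
        \<open>u0\<close>, so the trace is the sum of \<open>u0 x * s x\<close>. Applying
        \<open>e\<close> to the expansion of \<open>u0\<close>, which it fixes, shows that this sum
        is 1.\<close>
      have "u0 = alg_act G W e (\<Sum>x\<in>X. cscale (u0 x) (cs (d x) i))"
        using cs_lin[OF u0(1) i] u0(3) by simp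
      also have "\<dots> = (\<Sum>x\<in>X. cscale (u0 x) (alg_act G W e (cs (d x) i)))"
        using cs_in dW i subU by (intro W.alg_act_lincomb) blast
      also have "\<dots> = (\<Sum>x\<in>X. cscale (u0 x * s x) u0)"
        by (intro sum.cong refl) (simp add: s)
      also have "\<dots> = cscale (\<Sum>x\<in>X. u0 x * s x) u0"
        by (simp only: cfun.scale_sum_left)
      finally have eq: "u0 = cscale (\<Sum>x\<in>X. u0 x * s x) u0" .
      obtain y where y: "u0 y \<noteq> 0" using u0(2) by (auto simp: fun_eq_iff)
      have "u0 y = (\<Sum>x\<in>X. u0 x * s x) * u0 y" using fun_cong[OF eq, of y] by simp
      then have "(\<Sum>x\<in>X. u0 x * s x) = 1" using y by simp
      then have "t i = 1" unfolding t_def using s by (simp add: mult.commute)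
      then show ?thesis using True iso_rep_iff[OF W.fin_rep_axioms Ui[OF i]] by simp
    next
      case False
      then have "t i = 0" unfolding t_def using cs_in dW i by (intro sum.neutral) auto
      then show ?thesis using False iso_rep_iff[OF W.fin_rep_axioms Ui[OF i]] by simp
    qed
    have "(\<Sum>x\<in>X. alg_act G W e (d x) x) = (\<Sum>x\<in>X. \<Sum>i<N. alg_act G W e (cs (d x) i) x)"
    proof (rule sum.cong[OF refl])
      fix x assume x: "x \<in> X"
      have "alg_act G W e (\<Sum>i<N. cscale 1 (cs (d x) i)) = (\<Sum>i<N. cscale 1 (alg_act G W e (cs (d x) i)))"
        using cs_in dW x subU by (intro W.alg_act_lincomb) blast
      then have "alg_act G W e (d x) = (\<Sum>i<N. alg_act G W e (cs (d x) i))"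
        using cs(2)[OF dW[OF x]] by simp
      then show "alg_act G W e (d x) x = (\<Sum>i<N. alg_act G W e (cs (d x) i) x)"
        by (simp only: sum_fun_eval)
    qed
    also have "\<dots> = (\<Sum>i<N. t i)" unfolding t_def by (rule sum.swap)
    also have "\<dots> = (\<Sum>i<N. if iso_rep G ideal_rep (W\<lparr>rspace := U i\<rparr>) then 1 else 0)"
      using t by (intro sum.cong refl) simp
    also have "\<dots> = of_nat (card {i \<in> {..<N}. iso_rep G ideal_rep (W\<lparr>rspace := U i\<rparr>)})"
      by (simp add: sum.If_cases Int_def)
    finally show ?thesis ..
  qed
  obtain N U where dec: "irreducible_decomposition G W N U"
    using W.exists_irreducible_decomposition[OF fr] by blast
  let ?k = "card {i \<in> {..<N}. iso_rep G ideal_rep (W\<lparr>rspace := U i\<rparr>)}"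
  have "multiplicity_rep G ideal_rep W = ?k"
    unfolding multiplicity_rep_def
  proof (rule the_equality)
    fix k assume "\<exists>N U. irreducible_decomposition G W N U \<and>
        k = card {i \<in> {..<N}. iso_rep G ideal_rep (W\<lparr>rspace := U i\<rparr>)}"
    then have "(of_nat k :: complex) = (\<Sum>x\<in>X. alg_act G W e (d x) x)" using count by auto
    also have "\<dots> = of_nat ?k" using count[OF dec] ..
    finally show "k = ?k" by (simp only: of_nat_eq_iff)
  qed (use dec in blast)
  then show ?thesis using count[OF dec] chi by simp
qed

end

subsection \<open>Characters of ideals, tensor products and induced representations\<close>

text \<open>For a primitive idempotent this is the character of its left ideal at the inverse of
  \<open>x\<close>; see \<open>frame_character_ideal\<close>.\<close>

definition conj_sum :: "'g monoid \<Rightarrow> ('g \<Rightarrow> complex) \<Rightarrow> 'g \<Rightarrow> complex"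
  where "conj_sum G a x = (\<Sum>g\<in>carrier G. a (g \<otimes>\<^bsub>G\<^esub> x \<otimes>\<^bsub>G\<^esub> inv\<^bsub>G\<^esub> g))"

lemma frame_finite: "frame V X d \<Longrightarrow> finite X"
  and frame_mem: "frame V X d \<Longrightarrow> x \<in> X \<Longrightarrow> d x \<in> rspace V"
  and frame_expand: "frame V X d \<Longrightarrow> v \<in> rspace V \<Longrightarrow> v = (\<Sum>x\<in>X. cscale (v x) (d x))"
  unfolding frame_def by blast+

context primitive_idempotent
begin

text \<open>The translates of \<open>e\<close>. As \<open>w = w e\<close> on the ideal, they expand
  \<open>w\<close> with its own values as coefficients.\<close>

definition ideal_frame :: "'g \<Rightarrow> 'g \<Rightarrow> complex"
  where "ideal_frame g = (\<lambda>h. if h \<in> carrier G then e (inv g \<otimes> h) else 0)"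

lemma frame_ideal: "frame ideal_rep (carrier G) ideal_frame"
  unfolding frame_def
proof (intro conjI ballI)
  fix g assume g: "g \<in> carrier G"
  then show "ideal_frame g \<in> rspace ideal_rep"
    using ideal.act_mem[OF g e_in_ideal] by (simp add: ideal_frame_def left_ideal_rep_def)
next
  fix w assume "w \<in> rspace ideal_rep"
  then have "w = convolution G w e" by (simp add: rspace_ideal)
  also have "\<dots> = (\<Sum>g\<in>carrier G. cscale (w g) (ideal_frame g))"
    by (rule ext) (simp add: convolution_def sum_fun_eval ideal_frame_def)
  finally show "w = (\<Sum>g\<in>carrier G. cscale (w g) (ideal_frame g))" .
qed (rule finite_G)

lemma frame_character_ideal:
  assumes "k \<in> carrier G"
  shows "frame_character ideal_rep (carrier G) ideal_frame k = conj_sum G e (inv k)"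
proof -
  have "frame_character ideal_rep (carrier G) ideal_frame k = (\<Sum>g\<in>carrier G. e (inv g \<otimes> inv k \<otimes> inv (inv g)))"
    unfolding frame_character_def
    using assms by (intro sum.cong refl) (simp add: left_ideal_rep_def ideal_frame_def m_assoc)
  also have "\<dots> = conj_sum G e (inv k)"
    unfolding conj_sum_def by (rule sum_inverse)
  finally show ?thesis .
qed

end

lemma pure_tensor_apply: "pure_tensor v w (x, y) = v x * w y"
  by (simp add: pure_tensor_def)

text \<open>The scalars of a linear combination are absorbed into the left factors, so that later
  arguments meet only sums of pure tensors. The tensors themselves serve as indices.\<close>

lemma tensor_rep_elem:
  fixes V :: "('g, 'x) rep" and W :: "('h, 'y) rep"
  assumes "t \<in> rspace (tensor_rep V W)" "representation G V"
  obtains I :: "('x \<times> 'y \<Rightarrow> complex) set" and v w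
  where "finite I" "\<And>i. i \<in> I \<Longrightarrow> v i \<in> rspace V" "\<And>i. i \<in> I \<Longrightarrow> w i \<in> rspace W"
    "t = (\<Sum>i\<in>I. pure_tensor (v i) (w i))"
proof -
  have "t \<in> cfun.span {pure_tensor v w | v w. v \<in> rspace V \<and> w \<in> rspace W}"
    using assms(1) by (simp add: tensor_rep_def)
  then obtain I r where I: "finite I" "I \<subseteq> {pure_tensor v w | v w. v \<in> rspace V \<and> w \<in> rspace W}"
      "t = (\<Sum>i\<in>I. cscale (r i) i)"
    by (auto simp: cfun.span_explicit)
  have "\<forall>i\<in>I. \<exists>v w. v \<in> rspace V \<and> w \<in> rspace W \<and> i = pure_tensor v w" using I(2) by blast
  then obtain v w where vw: "\<And>i. i \<in> I \<Longrightarrow> v i \<in> rspace V \<and> w i \<in> rspace W \<and> i = pure_tensor (v i) (w i)"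
    by metis
  have "t = (\<Sum>i\<in>I. pure_tensor (cscale (r i) (v i)) (w i))"
    unfolding I(3)
  proof (rule sum.cong[OF refl])
    fix i assume "i \<in> I"
    then have "cscale (r i) i = cscale (r i) (pure_tensor (v i) (w i))" using vw by simp
    also have "\<dots> = pure_tensor (cscale (r i) (v i)) (w i)"
      by (rule ext) (simp add: pure_tensor_def split_beta)
    finally show "cscale (r i) i = pure_tensor (cscale (r i) (v i)) (w i)" .
  qed
  moreover have "cscale (r i) (v i) \<in> rspace V" if "i \<in> I" for i
    using vw that assms(2) by (simp add: representation_def cfun.subspace_scale)
  ultimately show ?thesis using that[of I "\<lambda>i. cscale (r i) (v i)" w] I(1) vw by blast
qed

section \<open>Tensor products of representations and their characters\<close>

locale tensor_pair = V: fin_rep G V + W: fin_rep H W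
  for G :: "'g monoid" and V :: "('g, 'x) rep" and H :: "'h monoid" and W :: "('h, 'y) rep"
begin

lemma action_tensor:
  "action (tensor_rep V W) (g, h) t (x, y) =
     action W h (\<lambda>y'. action V g (\<lambda>x'. t (x', y')) x) y"
  by (simp add: tensor_rep_def)

lemma slice_lincomb:
  "(\<lambda>x. (\<Sum>i\<in>I. pure_tensor (v i) (w i)) (x, y)) = (\<Sum>i\<in>I. cscale (w i y) (v i))"
  by (rule ext) (simp add: sum_fun_eval pure_tensor_apply mult.commute)

lemma acted_slice_lincomb:
  assumes "g \<in> carrier G" "\<And>i. i \<in> I \<Longrightarrow> v i \<in> rspace V"
  shows "(\<lambda>y. action V g (\<lambda>x'. (\<Sum>i\<in>I. pure_tensor (v i) (w i)) (x', y)) x) =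
    (\<Sum>i\<in>I. cscale (action V g (v i) x) (w i))"
  unfolding slice_lincomb using assms
  by (intro ext) (simp add: V.act_lincomb sum_fun_eval mult.commute)

lemma action_tensor_sum:
  assumes "g \<in> carrier G" "h \<in> carrier H"
    "\<And>i. i \<in> I \<Longrightarrow> v i \<in> rspace V" "\<And>i. i \<in> I \<Longrightarrow> w i \<in> rspace W"
  shows "action (tensor_rep V W) (g, h) (\<Sum>i\<in>I. pure_tensor (v i) (w i)) =
    (\<Sum>i\<in>I. pure_tensor (action V g (v i)) (action W h (w i)))"
proof
  fix p :: "'x \<times> 'y"
  obtain x y where p: "p = (x, y)" by force
  have "action (tensor_rep V W) (g, h) (\<Sum>i\<in>I. pure_tensor (v i) (w i)) p =
      action W h (\<Sum>i\<in>I. cscale (action V g (v i) x) (w i)) y"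
    by (simp only: p action_tensor acted_slice_lincomb[OF assms(1,3)])
  also have "\<dots> = (\<Sum>i\<in>I. cscale (action V g (v i) x) (action W h (w i))) y"
    using assms by (simp only: W.act_lincomb)
  also have "\<dots> = (\<Sum>i\<in>I. pure_tensor (action V g (v i)) (action W h (w i))) p"
    by (simp add: p sum_fun_eval pure_tensor_apply)
  finally show "action (tensor_rep V W) (g, h) (\<Sum>i\<in>I. pure_tensor (v i) (w i)) p =
    (\<Sum>i\<in>I. pure_tensor (action V g (v i)) (action W h (w i))) p" .
qed

lemma action_tensor_pure:
  assumes "g \<in> carrier G" "h \<in> carrier H" "v \<in> rspace V" "w \<in> rspace W"
  shows "action (tensor_rep V W) (g, h) (pure_tensor v w) =
    pure_tensor (action V g v) (action W h w)"
  using action_tensor_sum[OF assms(1,2), of "{()}" "\<lambda>_. v" "\<lambda>_. w"] assms(3,4) by simp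

lemma pure_tensor_in: "v \<in> rspace V \<Longrightarrow> w \<in> rspace W \<Longrightarrow> pure_tensor v w \<in> rspace (tensor_rep V W)"
  unfolding tensor_rep_def rep.simps by (rule cfun.span_base) blast

lemma subspace_tensor: "cfun.subspace (rspace (tensor_rep V W))"
  unfolding tensor_rep_def rep.simps by (rule cfun.subspace_span)

text \<open>The laws of an action hold only on \<open>rspace\<close>. Hence the slices that occur in
  the definition of \<open>tensor_rep\<close> have to be located in \<open>V\<close> and, after the
  action of \<open>g\<close>, in \<open>W\<close>.\<close>

lemma slice_in:
  assumes "t \<in> rspace (tensor_rep V W)"
  shows "(\<lambda>x. t (x, y)) \<in> rspace V"
    and "g \<in> carrier G \<Longrightarrow> (\<lambda>y. action V g (\<lambda>x'. t (x', y)) x) \<in> rspace W"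
proof -
  obtain I v w where t: "finite (I :: ('x \<times> 'y \<Rightarrow> complex) set)"
      "\<And>i. i \<in> I \<Longrightarrow> v i \<in> rspace V" "\<And>i. i \<in> I \<Longrightarrow> w i \<in> rspace W"
      "t = (\<Sum>i\<in>I. pure_tensor (v i) (w i))"
    using tensor_rep_elem[OF assms V.rep] by metis
  show "(\<lambda>x. t (x, y)) \<in> rspace V"
    unfolding t(4) slice_lincomb
    by (intro cfun.subspace_sum cfun.subspace_scale V.subspace_W t)
  show "(\<lambda>y. action V g (\<lambda>x'. t (x', y)) x) \<in> rspace W" if "g \<in> carrier G"
  proof -
    have "(\<lambda>y. action V g (\<lambda>x'. t (x', y)) x) = (\<Sum>i\<in>I. cscale (action V g (v i) x) (w i))"
      unfolding t(4) by (rule acted_slice_lincomb[OF that t(2)])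
    also have "\<dots> \<in> rspace W"
      by (intro cfun.subspace_sum cfun.subspace_scale W.subspace_W t)
    finally show ?thesis .
  qed
qed

lemma representation_tensor: "representation (G \<times>\<times> H) (tensor_rep V W)"
  unfolding representation_def
proof (intro conjI ballI allI)
  fix p assume "p \<in> carrier (G \<times>\<times> H)"
  then obtain g h where p: "p = (g, h)" "g \<in> carrier G" "h \<in> carrier H" by auto
  show "action (tensor_rep V W) p t \<in> rspace (tensor_rep V W)"
    if tT: "t \<in> rspace (tensor_rep V W)" for t
  proof -
    obtain I v w where t: "finite (I :: ('x \<times> 'y \<Rightarrow> complex) set)"
        "\<And>i. i \<in> I \<Longrightarrow> v i \<in> rspace V" "\<And>i. i \<in> I \<Longrightarrow> w i \<in> rspace W"
        "t = (\<Sum>i\<in>I. pure_tensor (v i) (w i))"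
      using tensor_rep_elem[OF tT V.rep] by metis
    have "action (tensor_rep V W) p t = (\<Sum>i\<in>I. pure_tensor (action V g (v i)) (action W h (w i)))"
      unfolding p t(4) by (rule action_tensor_sum[OF p(2,3) t(2,3)])
    also have "\<dots> \<in> rspace (tensor_rep V W)"
      by (intro cfun.subspace_sum subspace_tensor pure_tensor_in V.act_mem W.act_mem p t)
    finally show ?thesis .
  qed
  show "action (tensor_rep V W) p (s + t) =
      action (tensor_rep V W) p s + action (tensor_rep V W) p t"
    if "s \<in> rspace (tensor_rep V W)" "t \<in> rspace (tensor_rep V W)" for s t
  proof
    fix q :: "'x \<times> 'y"
    obtain x y where q: "q = (x, y)" by force
    have "(\<lambda>y'. action V g (\<lambda>x'. (s + t) (x', y')) x) =
        (\<lambda>y'. action V g (\<lambda>x'. s (x', y')) x) + (\<lambda>y'. action V g (\<lambda>x'. t (x', y')) x)"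
    proof
      fix y'
      have "(\<lambda>x'. (s + t) (x', y')) = (\<lambda>x'. s (x', y')) + (\<lambda>x'. t (x', y'))"
        by (rule ext) simp
      then show "action V g (\<lambda>x'. (s + t) (x', y')) x =
          ((\<lambda>y'. action V g (\<lambda>x'. s (x', y')) x) + (\<lambda>y'. action V g (\<lambda>x'. t (x', y')) x)) y'"
        using V.act_add[OF p(2) slice_in(1)[OF that(1)] slice_in(1)[OF that(2)], of y' y'] by simp
    qed
    then show "action (tensor_rep V W) p (s + t) q =
        (action (tensor_rep V W) p s + action (tensor_rep V W) p t) q"
      using W.act_add[OF p(3) slice_in(2)[OF that(1) p(2)] slice_in(2)[OF that(2) p(2)], of x x]
      by (simp add: p(1) q action_tensor)
  qed
  show "action (tensor_rep V W) p (cscale c t) = cscale c (action (tensor_rep V W) p t)"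
    if "t \<in> rspace (tensor_rep V W)" for c t
  proof
    fix q :: "'x \<times> 'y"
    obtain x y where q: "q = (x, y)" by force
    have "(\<lambda>y'. action V g (\<lambda>x'. cscale c t (x', y')) x) =
        cscale c (\<lambda>y'. action V g (\<lambda>x'. t (x', y')) x)"
    proof
      fix y'
      have "(\<lambda>x'. cscale c t (x', y')) = cscale c (\<lambda>x'. t (x', y'))"
        by (rule ext) simp
      then show "action V g (\<lambda>x'. cscale c t (x', y')) x =
          cscale c (\<lambda>y'. action V g (\<lambda>x'. t (x', y')) x) y'"
        using V.act_scale[OF p(2) slice_in(1)[OF that], of c y'] by simp
    qed
    then show "action (tensor_rep V W) p (cscale c t) q = cscale c (action (tensor_rep V W) p t) q"
      using W.act_scale[OF p(3) slice_in(2)[OF that p(2)], of c x]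
      by (simp add: p(1) q action_tensor)
  qed
  show "action (tensor_rep V W) (p \<otimes>\<^bsub>G \<times>\<times> H\<^esub> p') t =
      action (tensor_rep V W) p (action (tensor_rep V W) p' t)"
    if p': "p' \<in> carrier (G \<times>\<times> H)" and tT: "t \<in> rspace (tensor_rep V W)" for p' t
  proof -
    obtain g' h' where p': "p' = (g', h')" "g' \<in> carrier G" "h' \<in> carrier H" using p' by auto
    obtain I v w where t: "finite (I :: ('x \<times> 'y \<Rightarrow> complex) set)"
        "\<And>i. i \<in> I \<Longrightarrow> v i \<in> rspace V" "\<And>i. i \<in> I \<Longrightarrow> w i \<in> rspace W"
        "t = (\<Sum>i\<in>I. pure_tensor (v i) (w i))"
      using tensor_rep_elem[OF tT V.rep] by metis
    have "action (tensor_rep V W) p' t = (\<Sum>i\<in>I. pure_tensor (action V g' (v i)) (action W h' (w i)))"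
      unfolding p'(1) t(4) by (rule action_tensor_sum[OF p'(2,3) t(2,3)])
    then have "action (tensor_rep V W) p (action (tensor_rep V W) p' t) =
        (\<Sum>i\<in>I. pure_tensor (action V g (action V g' (v i))) (action W h (action W h' (w i))))"
      unfolding p(1) by (simp only:) (intro action_tensor_sum p p' V.act_mem W.act_mem t)
    moreover have "p \<otimes>\<^bsub>G \<times>\<times> H\<^esub> p' = (g \<otimes>\<^bsub>G\<^esub> g', h \<otimes>\<^bsub>H\<^esub> h')" by (simp add: p(1) p'(1))
    then have "action (tensor_rep V W) (p \<otimes>\<^bsub>G \<times>\<times> H\<^esub> p') t =
        (\<Sum>i\<in>I. pure_tensor (action V (g \<otimes>\<^bsub>G\<^esub> g') (v i)) (action W (h \<otimes>\<^bsub>H\<^esub> h') (w i)))"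
      unfolding t(4) using p(2,3) p'(2,3) by (simp only:) (intro action_tensor_sum V.m_closed W.m_closed t)
    moreover have "\<dots> = (\<Sum>i\<in>I. pure_tensor (action V g (action V g' (v i))) (action W h (action W h' (w i))))"
      using p p' t(2,3) by (intro sum.cong refl) (simp only: V.act_mult W.act_mult)
    ultimately show ?thesis by (simp only:)
  qed
next
  show "action (tensor_rep V W) \<one>\<^bsub>G \<times>\<times> H\<^esub> t = t" if tT: "t \<in> rspace (tensor_rep V W)" for t
  proof -
    obtain I v w where t: "finite (I :: ('x \<times> 'y \<Rightarrow> complex) set)"
        "\<And>i. i \<in> I \<Longrightarrow> v i \<in> rspace V" "\<And>i. i \<in> I \<Longrightarrow> w i \<in> rspace W"
        "t = (\<Sum>i\<in>I. pure_tensor (v i) (w i))"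
      using tensor_rep_elem[OF tT V.rep] by metis
    have "action (tensor_rep V W) (\<one>\<^bsub>G\<^esub>, \<one>\<^bsub>H\<^esub>) t =
        (\<Sum>i\<in>I. pure_tensor (action V \<one>\<^bsub>G\<^esub> (v i)) (action W \<one>\<^bsub>H\<^esub> (w i)))"
      unfolding t(4) by (rule action_tensor_sum[OF V.one_closed W.one_closed t(2,3)])
    also have "\<dots> = t"
      unfolding t(4) using t(2,3) by (intro sum.cong refl) (simp only: V.act_one W.act_one)
    finally show ?thesis by simp
  qed
qed (rule subspace_tensor)

lemma frame_tensor:
  assumes "frame V X d" "frame W Y d'"
  shows "frame (tensor_rep V W) (X \<times> Y) (\<lambda>(x, y). pure_tensor (d x) (d' y))"
  unfolding frame_def
proof (intro conjI ballI)
  show "finite (X \<times> Y)" using assms by (simp add: frame_finite)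
  show "(case p of (x, y) \<Rightarrow> pure_tensor (d x) (d' y)) \<in> rspace (tensor_rep V W)"
    if "p \<in> X \<times> Y" for p
    using that by (cases p) (simp add: pure_tensor_in frame_mem[OF assms(1)] frame_mem[OF assms(2)])
  fix t assume tT: "t \<in> rspace (tensor_rep V W)"
  obtain I v w where t: "finite (I :: ('x \<times> 'y \<Rightarrow> complex) set)"
      "\<And>i. i \<in> I \<Longrightarrow> v i \<in> rspace V" "\<And>i. i \<in> I \<Longrightarrow> w i \<in> rspace W"
      "t = (\<Sum>i\<in>I. pure_tensor (v i) (w i))"
    using tensor_rep_elem[OF tT V.rep] by metis
  have exp: "v' a = (\<Sum>x\<in>X. v' x * d x a)"
    if "v' \<in> rspace V" for v' a
  proof -
    have "v' = (\<Sum>x\<in>X. cscale (v' x) (d x))" by (rule frame_expand[OF assms(1) that])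
    from fun_cong[OF this, of a] show ?thesis by (simp only: sum_fun_eval cscale_apply)
  qed
  have exp': "v' a = (\<Sum>x\<in>Y. v' x * d' x a)"
    if "v' \<in> rspace W" for v' a
  proof -
    have "v' = (\<Sum>x\<in>Y. cscale (v' x) (d' x))" by (rule frame_expand[OF assms(2) that])
    from fun_cong[OF this, of a] show ?thesis by (simp only: sum_fun_eval cscale_apply)
  qed
  show "t = (\<Sum>p\<in>X \<times> Y. cscale (t p) (case p of (x, y) \<Rightarrow> pure_tensor (d x) (d' y)))"
  proof
    fix q :: "'x \<times> 'y"
    obtain a b where q: "q = (a, b)" by force
    have "t q = (\<Sum>i\<in>I. v i a * w i b)" by (simp add: t(4) q sum_fun_eval pure_tensor_apply)
    also have "\<dots> = (\<Sum>i\<in>I. (\<Sum>x\<in>X. v i x * d x a) * (\<Sum>y\<in>Y. w i y * d' y b))"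
      by (intro sum.cong refl arg_cong2[of _ _ _ _ "(*)"] exp exp' t(2) t(3))
    also have "\<dots> = (\<Sum>i\<in>I. \<Sum>x\<in>X. \<Sum>y\<in>Y. v i x * w i y * (d x a * d' y b))"
      by (simp add: sum_product mult_ac)
    also have "\<dots> = (\<Sum>x\<in>X. \<Sum>y\<in>Y. \<Sum>i\<in>I. v i x * w i y * (d x a * d' y b))"
      by (subst sum.swap) (rule sum.cong[OF refl], rule sum.swap)
    also have "\<dots> = (\<Sum>x\<in>X. \<Sum>y\<in>Y. t (x, y) * (d x a * d' y b))"
      by (simp add: t(4) sum_fun_eval pure_tensor_apply sum_distrib_right)
    also have "\<dots> = (\<Sum>p\<in>X \<times> Y. cscale (t p) (case p of (x, y) \<Rightarrow> pure_tensor (d x) (d' y))) q"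
      by (simp add: sum_fun_eval sum.cartesian_product split_beta pure_tensor_apply q)
    finally show "t q = (\<Sum>p\<in>X \<times> Y. cscale (t p) (case p of (x, y) \<Rightarrow> pure_tensor (d x) (d' y))) q" .
  qed
qed

lemma frame_character_tensor:
  assumes "frame V X d" "frame W Y d'" "g \<in> carrier G" "h \<in> carrier H"
  shows "frame_character (tensor_rep V W) (X \<times> Y) (\<lambda>(x, y). pure_tensor (d x) (d' y)) (g, h) =
    frame_character V X d g * frame_character W Y d' h"
proof -
  have "frame_character (tensor_rep V W) (X \<times> Y) (\<lambda>(x, y). pure_tensor (d x) (d' y)) (g, h) =
      (\<Sum>(x, y)\<in>X \<times> Y. action V g (d x) x * action W h (d' y) y)"
    unfolding frame_character_def using assms
    by (intro sum.cong refl) (auto simp: action_tensor_pure pure_tensor_apply frame_mem)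
  then show ?thesis
    by (simp add: frame_character_def sum_product sum.cartesian_product)
qed

end

section \<open>Restriction, induction and Frobenius reciprocity\<close>

lemma representation_res:
  assumes "representation G V" "group_hom H G \<phi>"
  shows "representation H (res_rep \<phi> V)"
proof -
  interpret group_hom H G \<phi> by (rule assms(2))
  show ?thesis using assms(1) by (auto simp: representation_def res_rep_def)
qed

lemma frame_res: "frame V X d \<Longrightarrow> frame (res_rep \<phi> V) X d"
  by (simp add: frame_def res_rep_def)

lemma frame_character_res: "frame_character (res_rep \<phi> V) X d h = frame_character V X d (\<phi> h)"
  by (simp add: frame_character_def res_rep_def)

locale induction = V: fin_rep H V + G: fin_group G + hom: group_hom H G \<phi>
  for H :: "'h monoid" and V :: "('h, 'x) rep" and G :: "'g monoid" and \<phi>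
begin

abbreviation "Ind \<equiv> ind_rep H G \<phi> V"

lemma ind_mem_iff: "f \<in> rspace Ind \<longleftrightarrow>
    (\<forall>g x. g \<notin> carrier G \<longrightarrow> f (g, x) = 0) \<and>
    (\<forall>g\<in>carrier G. (\<lambda>x. f (g, x)) \<in> rspace V) \<and>
    (\<forall>g\<in>carrier G. \<forall>h\<in>carrier H.
       (\<lambda>x. f (g \<otimes>\<^bsub>G\<^esub> \<phi> h, x)) = action V (inv\<^bsub>H\<^esub> h) (\<lambda>x. f (g, x)))"
  by (simp add: ind_rep_def)

lemma action_ind: "action Ind k f (g, x) = (if g \<in> carrier G then f (inv\<^bsub>G\<^esub> k \<otimes>\<^bsub>G\<^esub> g, x) else 0)"
  by (simp add: ind_rep_def)

lemma representation_ind: "representation G Ind"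
  unfolding representation_def
proof (intro conjI ballI allI)
  show "cfun.subspace (rspace Ind)"
    unfolding cfun.subspace_def
  proof (intro conjI ballI allI)
    show "0 \<in> rspace Ind"
      using cfun.subspace_0[OF V.subspace_W] V.act_zero
      by (auto simp: ind_mem_iff zero_fun_def)
    fix f f' assume f: "f \<in> rspace Ind" "f' \<in> rspace Ind"
    have eq: "(\<lambda>x. (f + f') (g, x)) = (\<lambda>x. f (g, x)) + (\<lambda>x. f' (g, x))" for g
      by (rule ext) simp
    show "f + f' \<in> rspace Ind"
      unfolding ind_mem_iff eq
      using f cfun.subspace_add[OF V.subspace_W] V.act_add
      by (auto simp: ind_mem_iff simp del: plus_fun_apply) simp
  next
    fix f c assume f: "f \<in> rspace Ind"
    have eq: "(\<lambda>x. cscale c f (g, x)) = cscale c (\<lambda>x. f (g, x))" for g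
      by (rule ext) simp
    show "cscale c f \<in> rspace Ind"
      unfolding ind_mem_iff eq
      using f cfun.subspace_scale[OF V.subspace_W] V.act_scale
      by (auto simp: ind_mem_iff)
  qed
  fix k assume k: "k \<in> carrier G"
  show "action Ind k f \<in> rspace Ind" if f: "f \<in> rspace Ind" for f
    unfolding ind_mem_iff
  proof (intro conjI ballI allI impI)
    show "(\<lambda>x. action Ind k f (g, x)) \<in> rspace V" if "g \<in> carrier G" for g
      using f that k by (simp add: action_ind ind_mem_iff)
    fix g h assume g: "g \<in> carrier G" and h: "h \<in> carrier H"
    have "inv\<^bsub>G\<^esub> k \<otimes>\<^bsub>G\<^esub> (g \<otimes>\<^bsub>G\<^esub> \<phi> h) = inv\<^bsub>G\<^esub> k \<otimes>\<^bsub>G\<^esub> g \<otimes>\<^bsub>G\<^esub> \<phi> h"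
      using g h k by (simp add: G.m_assoc)
    then show "(\<lambda>x. action Ind k f (g \<otimes>\<^bsub>G\<^esub> \<phi> h, x)) =
        action V (inv\<^bsub>H\<^esub> h) (\<lambda>x. action Ind k f (g, x))"
      using f g k h by (simp add: action_ind ind_mem_iff)
  qed (use f in \<open>auto simp: action_ind ind_mem_iff\<close>)
  show "action Ind k (f + f') = action Ind k f + action Ind k f'" for f f'
    by (rule ext) (auto simp: action_ind split: prod.splits)
  show "action Ind k (cscale c f) = cscale c (action Ind k f)" for c f
    by (rule ext) (auto simp: action_ind)
  show "action Ind (k \<otimes>\<^bsub>G\<^esub> k') f = action Ind k (action Ind k' f)" if "k' \<in> carrier G" for k' f
    using k that by (auto simp: action_ind fun_eq_iff G.inv_mult_group G.m_assoc)
next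
  show "action Ind \<one>\<^bsub>G\<^esub> f = f" if "f \<in> rspace Ind" for f
    using that by (auto simp: action_ind fun_eq_iff ind_mem_iff)
qed

text \<open>The function on \<open>G\<close> concentrated at \<open>g\<close> with value
  \<open>d x\<close>, projected to the equivariant functions by averaging over \<open>H\<close>. All
  of \<open>G\<close> serves as index set instead of coset representatives, and the factor
  \<open>1 / |H|\<close> accounts for the repetition.\<close>

definition ind_frame :: "('x \<Rightarrow> 'x \<Rightarrow> complex) \<Rightarrow> 'g \<times> 'x \<Rightarrow> 'g \<times> 'x \<Rightarrow> complex" where
  "ind_frame d p q = (if fst q \<in> carrier G then
     (\<Sum>h\<in>carrier H. if fst q \<otimes>\<^bsub>G\<^esub> \<phi> h = fst p then action V h (d (snd p)) (snd q) else 0) /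
       of_nat (card (carrier H)) else 0)"

lemma ind_frame_slice:
  assumes "g' \<in> carrier G"
  shows "(\<lambda>y. ind_frame d (g, x) (g', y)) = cscale (1 / of_nat (card (carrier H)))
    (\<Sum>h\<in>carrier H. if g' \<otimes>\<^bsub>G\<^esub> \<phi> h = g then action V h (d x) else 0)"
  using assms by (intro ext) (simp add: ind_frame_def sum_fun_eval if_distrib[of "\<lambda>f. f _"] cong: if_cong)

lemma ind_frame_mem:
  assumes "d x \<in> rspace V"
  shows "ind_frame d (g, x) \<in> rspace Ind"
  unfolding ind_mem_iff
proof (intro conjI ballI allI impI)
  have mem: "(if P then action V h (d x) else 0) \<in> rspace V" if "h \<in> carrier H" for h P
    using assms that V.act_mem cfun.subspace_0[OF V.subspace_W] by auto
  show "(\<lambda>y. ind_frame d (g, x) (g', y)) \<in> rspace V" if "g' \<in> carrier G" for g'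
    unfolding ind_frame_slice[OF that]
    by (intro cfun.subspace_scale cfun.subspace_sum V.subspace_W mem)
  fix g' h' assume g': "g' \<in> carrier G" and h': "h' \<in> carrier H"
  have "action V (inv\<^bsub>H\<^esub> h') (\<lambda>y. ind_frame d (g, x) (g', y)) =
      cscale (1 / of_nat (card (carrier H)))
        (action V (inv\<^bsub>H\<^esub> h') (\<Sum>h\<in>carrier H. if g' \<otimes>\<^bsub>G\<^esub> \<phi> h = g then action V h (d x) else 0))"
    unfolding ind_frame_slice[OF g'] using h'
    by (intro V.act_scale cfun.subspace_sum V.subspace_W mem) auto
  also have "action V (inv\<^bsub>H\<^esub> h') (\<Sum>h\<in>carrier H. if g' \<otimes>\<^bsub>G\<^esub> \<phi> h = g then action V h (d x) else 0) =
      (\<Sum>h\<in>carrier H. action V (inv\<^bsub>H\<^esub> h') (if g' \<otimes>\<^bsub>G\<^esub> \<phi> h = g then action V h (d x) else 0))"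
    using h' mem by (intro V.act_sum) auto
  also have "\<dots> = (\<Sum>h\<in>carrier H. action V (inv\<^bsub>H\<^esub> h')
      (if g' \<otimes>\<^bsub>G\<^esub> \<phi> (h' \<otimes>\<^bsub>H\<^esub> h) = g then action V (h' \<otimes>\<^bsub>H\<^esub> h) (d x) else 0))"
    by (rule V.sum_left_translate[OF h', symmetric])
  also have "\<dots> = (\<Sum>h\<in>carrier H. if g' \<otimes>\<^bsub>G\<^esub> \<phi> h' \<otimes>\<^bsub>G\<^esub> \<phi> h = g then action V h (d x) else 0)"
  proof (rule sum.cong[OF refl])
    fix h assume h: "h \<in> carrier H"
    have "g' \<otimes>\<^bsub>G\<^esub> \<phi> (h' \<otimes>\<^bsub>H\<^esub> h) = g' \<otimes>\<^bsub>G\<^esub> \<phi> h' \<otimes>\<^bsub>G\<^esub> \<phi> h"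
      using g' h h' by (simp add: G.m_assoc)
    moreover have "action V (inv\<^bsub>H\<^esub> h') (action V (h' \<otimes>\<^bsub>H\<^esub> h) (d x)) = action V h (d x)"
      using h h' assms by (simp add: V.act_mult V.act_mem V.act_inv_cancel)
    ultimately show "action V (inv\<^bsub>H\<^esub> h')
        (if g' \<otimes>\<^bsub>G\<^esub> \<phi> (h' \<otimes>\<^bsub>H\<^esub> h) = g then action V (h' \<otimes>\<^bsub>H\<^esub> h) (d x) else 0) =
        (if g' \<otimes>\<^bsub>G\<^esub> \<phi> h' \<otimes>\<^bsub>G\<^esub> \<phi> h = g then action V h (d x) else 0)"
      using h' V.act_zero[of "inv\<^bsub>H\<^esub> h'"] by auto
  qed
  finally have "action V (inv\<^bsub>H\<^esub> h') (\<lambda>y. ind_frame d (g, x) (g', y)) =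
      cscale (1 / of_nat (card (carrier H)))
        (\<Sum>h\<in>carrier H. if g' \<otimes>\<^bsub>G\<^esub> \<phi> h' \<otimes>\<^bsub>G\<^esub> \<phi> h = g then action V h (d x) else 0)" .
  then show "(\<lambda>y. ind_frame d (g, x) (g' \<otimes>\<^bsub>G\<^esub> \<phi> h', y)) =
      action V (inv\<^bsub>H\<^esub> h') (\<lambda>y. ind_frame d (g, x) (g', y))"
    using ind_frame_slice[of "g' \<otimes>\<^bsub>G\<^esub> \<phi> h'"] g' h' by simp
qed (simp add: ind_frame_def)

lemma frame_ind:
  assumes "frame V X d"
  shows "frame Ind (carrier G \<times> X) (ind_frame d)"
  unfolding frame_def
proof (intro conjI ballI)
  show "finite (carrier G \<times> X)" using assms G.finite_G by (simp add: frame_finite)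
  show "ind_frame d p \<in> rspace Ind" if "p \<in> carrier G \<times> X" for p
    using that frame_mem[OF assms] ind_frame_mem by auto
  fix f assume f: "f \<in> rspace Ind"
  let ?n = "of_nat (card (carrier H)) :: complex"
  show "f = (\<Sum>p\<in>carrier G \<times> X. cscale (f p) (ind_frame d p))"
  proof
    fix q :: "'g \<times> 'x"
    obtain g' y where q: "q = (g', y)" by force
    show "f q = (\<Sum>p\<in>carrier G \<times> X. cscale (f p) (ind_frame d p)) q"
    proof (cases "g' \<in> carrier G")
      case True
      have slice: "action V h (\<lambda>x. f (g' \<otimes>\<^bsub>G\<^esub> \<phi> h, x)) = (\<lambda>x. f (g', x))" if "h \<in> carrier H" for h
        using f True that V.act_inv_cancel(2)[OF that] by (simp add: ind_mem_iff)
      have expand: "f (g', y) = (\<Sum>x\<in>X. f (g' \<otimes>\<^bsub>G\<^esub> \<phi> h, x) * action V h (d x) y)"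
        if h: "h \<in> carrier H" for h
      proof -
        let ?v = "\<lambda>x. f (g' \<otimes>\<^bsub>G\<^esub> \<phi> h, x)"
        have "\<forall>g\<in>carrier G. (\<lambda>x. f (g, x)) \<in> rspace V"
          using f unfolding ind_mem_iff by (elim conjE)
        moreover have "g' \<otimes>\<^bsub>G\<^esub> \<phi> h \<in> carrier G" using True h by simp
        ultimately have "?v \<in> rspace V" by (rule bspec)
        then have "?v = (\<Sum>x\<in>X. cscale (?v x) (d x))" by (rule frame_expand[OF assms])
        then have "action V h ?v = action V h (\<Sum>x\<in>X. cscale (?v x) (d x))" by (rule arg_cong)
        also have "\<dots> = (\<Sum>x\<in>X. cscale (?v x) (action V h (d x)))"
          using h frame_mem[OF assms] by (intro V.act_lincomb) auto
        finally have "(\<lambda>x. f (g', x)) = (\<Sum>x\<in>X. cscale (?v x) (action V h (d x)))"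
          by (simp only: slice[OF h])
        from fun_cong[OF this, of y] show ?thesis by (simp only: sum_fun_eval cscale_apply)
      qed
      have pairs: "(\<Sum>p\<in>carrier G \<times> X. F p) = (\<Sum>g\<in>carrier G. \<Sum>x\<in>X. F (g, x))"
        for F :: "_ \<Rightarrow> complex"
        by (simp add: sum.cartesian_product split_beta)
      have "(\<Sum>p\<in>carrier G \<times> X. cscale (f p) (ind_frame d p)) q =
          (\<Sum>g\<in>carrier G. \<Sum>x\<in>X. \<Sum>h\<in>carrier H.
            if g' \<otimes>\<^bsub>G\<^esub> \<phi> h = g then f (g, x) * action V h (d x) y / ?n else 0)"
        using True
        by (simp add: q sum_fun_eval pairs ind_frame_def sum_distrib_left
          sum_divide_distrib if_distrib[of "\<lambda>z. _ * z"] if_distrib[of "\<lambda>z. z / _"] cong: if_cong)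
      also have "\<dots> = (\<Sum>h\<in>carrier H. \<Sum>x\<in>X. \<Sum>g\<in>carrier G.
            if g' \<otimes>\<^bsub>G\<^esub> \<phi> h = g then f (g, x) * action V h (d x) y / ?n else 0)"
      proof -
        have "(\<Sum>g\<in>carrier G. \<Sum>x\<in>X. \<Sum>h\<in>carrier H. F g x h) =
            (\<Sum>h\<in>carrier H. \<Sum>x\<in>X. \<Sum>g\<in>carrier G. F g x h)" for F :: "_ \<Rightarrow> _ \<Rightarrow> _ \<Rightarrow> complex"
        proof -
          have "(\<Sum>g\<in>carrier G. \<Sum>x\<in>X. \<Sum>h\<in>carrier H. F g x h) =
              (\<Sum>x\<in>X. \<Sum>g\<in>carrier G. \<Sum>h\<in>carrier H. F g x h)" by (rule sum.swap)
          also have "\<dots> = (\<Sum>x\<in>X. \<Sum>h\<in>carrier H. \<Sum>g\<in>carrier G. F g x h)"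
            by (intro sum.cong refl sum.swap)
          finally show ?thesis by (subst sum.swap)
        qed
        then show ?thesis .
      qed
      \<comment> \<open>Each \<open>h\<close> selects the single index \<open>g' \<phi>(h)\<close>.
        By equivariance of \<open>f\<close> every \<open>h\<close> then contributes the same value
        \<open>f (g', y)\<close>, divided by the order of \<open>H\<close>.\<close>
      also have "\<dots> = (\<Sum>h\<in>carrier H. \<Sum>x\<in>X. f (g' \<otimes>\<^bsub>G\<^esub> \<phi> h, x) * action V h (d x) y / ?n)"
        using True G.finite_G by (intro sum.cong refl) (subst sum.delta', auto)
      also have "\<dots> = (\<Sum>h\<in>carrier H. f (g', y) / ?n)"
        by (intro sum.cong refl) (simp only: expand sum_divide_distrib)
      also have "\<dots> = f q" using V.card_G_pos by (simp add: q)
      finally show ?thesis ..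
    next
      case False
      then show ?thesis using f by (simp add: q ind_mem_iff sum_fun_eval ind_frame_def)
    qed
  qed
qed

text \<open>A translated frame vector meets its own index \<open>(g, x)\<close> exactly through
  those \<open>h\<close> for which \<open>k\<close> is the conjugate of \<open>\<phi> h\<close> by
  \<open>g\<close>. This is the usual formula for induced characters, summed over \<open>G\<close>
  instead of over cosets.\<close>

lemma frame_character_ind:
  assumes k: "k \<in> carrier G"
  shows "frame_character Ind (carrier G \<times> X) (ind_frame d) k =
    (\<Sum>h\<in>carrier H. \<Sum>g\<in>carrier G. if k = g \<otimes>\<^bsub>G\<^esub> \<phi> h \<otimes>\<^bsub>G\<^esub> inv\<^bsub>G\<^esub> g
       then frame_character V X d h else 0) / of_nat (card (carrier H))"
proof -
  let ?n = "of_nat (card (carrier H)) :: complex"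
  have cond: "inv\<^bsub>G\<^esub> k \<otimes>\<^bsub>G\<^esub> g \<otimes>\<^bsub>G\<^esub> \<phi> h = g \<longleftrightarrow> k = g \<otimes>\<^bsub>G\<^esub> \<phi> h \<otimes>\<^bsub>G\<^esub> inv\<^bsub>G\<^esub> g"
    if "g \<in> carrier G" "h \<in> carrier H" for g h
  proof -
    have p: "\<phi> h \<in> carrier G" using that by auto
    have "inv\<^bsub>G\<^esub> k \<otimes>\<^bsub>G\<^esub> g \<otimes>\<^bsub>G\<^esub> \<phi> h = inv\<^bsub>G\<^esub> k \<otimes>\<^bsub>G\<^esub> (g \<otimes>\<^bsub>G\<^esub> \<phi> h)"
      using that p k by (simp add: G.m_assoc)
    moreover have "g = inv\<^bsub>G\<^esub> k \<otimes>\<^bsub>G\<^esub> (g \<otimes>\<^bsub>G\<^esub> \<phi> h) \<longleftrightarrow> g \<otimes>\<^bsub>G\<^esub> \<phi> h = k \<otimes>\<^bsub>G\<^esub> g"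
      using that p k by (intro G.inv_solve_left) auto
    moreover have "k = g \<otimes>\<^bsub>G\<^esub> \<phi> h \<otimes>\<^bsub>G\<^esub> inv\<^bsub>G\<^esub> g \<longleftrightarrow> g \<otimes>\<^bsub>G\<^esub> \<phi> h = k \<otimes>\<^bsub>G\<^esub> g"
      using that p k by (intro G.inv_solve_right) auto
    ultimately show ?thesis by metis
  qed
  have "frame_character Ind (carrier G \<times> X) (ind_frame d) k =
      (\<Sum>g\<in>carrier G. \<Sum>x\<in>X. (\<Sum>h\<in>carrier H. if k = g \<otimes>\<^bsub>G\<^esub> \<phi> h \<otimes>\<^bsub>G\<^esub> inv\<^bsub>G\<^esub> g
        then action V h (d x) x else 0) / ?n)"
  proof -
    have "frame_character Ind (carrier G \<times> X) (ind_frame d) k =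
        (\<Sum>g\<in>carrier G. \<Sum>x\<in>X. action Ind k (ind_frame d (g, x)) (g, x))"
      by (simp add: frame_character_def sum.cartesian_product split_beta)
    then show ?thesis
      using k by (simp add: action_ind ind_frame_def cond cong: sum.cong if_cong)
  qed
  also have "\<dots> = (\<Sum>g\<in>carrier G. \<Sum>x\<in>X. \<Sum>h\<in>carrier H. if k = g \<otimes>\<^bsub>G\<^esub> \<phi> h \<otimes>\<^bsub>G\<^esub> inv\<^bsub>G\<^esub> g
        then action V h (d x) x else 0) / ?n"
    by (simp only: sum_divide_distrib)
  also have "(\<Sum>g\<in>carrier G. \<Sum>x\<in>X. \<Sum>h\<in>carrier H. if k = g \<otimes>\<^bsub>G\<^esub> \<phi> h \<otimes>\<^bsub>G\<^esub> inv\<^bsub>G\<^esub> g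
        then action V h (d x) x else 0) =
      (\<Sum>g\<in>carrier G. \<Sum>h\<in>carrier H. \<Sum>x\<in>X. if k = g \<otimes>\<^bsub>G\<^esub> \<phi> h \<otimes>\<^bsub>G\<^esub> inv\<^bsub>G\<^esub> g
        then action V h (d x) x else 0)"
    by (intro sum.cong refl sum.swap)
  also have "\<dots> = (\<Sum>h\<in>carrier H. \<Sum>g\<in>carrier G. \<Sum>x\<in>X. if k = g \<otimes>\<^bsub>G\<^esub> \<phi> h \<otimes>\<^bsub>G\<^esub> inv\<^bsub>G\<^esub> g
        then action V h (d x) x else 0)"
    by (rule sum.swap)
  finally have eq: "frame_character Ind (carrier G \<times> X) (ind_frame d) k =
      (\<Sum>h\<in>carrier H. \<Sum>g\<in>carrier G. \<Sum>x\<in>X. if k = g \<otimes>\<^bsub>G\<^esub> \<phi> h \<otimes>\<^bsub>G\<^esub> inv\<^bsub>G\<^esub> g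
        then action V h (d x) x else 0) / ?n" .
  have "(\<Sum>x\<in>X. if P then action V h (d x) x else 0) =
      (if P then frame_character V X d h else 0)" for P h
    by (simp add: frame_character_def)
  then show ?thesis unfolding eq by (simp only:)
qed

text \<open>Frobenius reciprocity in character form: pairing \<open>e\<close> with the induced
  character collects the values of \<open>e\<close> on the conjugates of each
  \<open>\<phi> h\<close>, that is, \<open>conj_sum\<close>.\<close>

theorem multiplicity_ind:
  assumes e: "primitive_idempotent G e" and fr: "frame V X d"
  shows "of_nat (multiplicity_rep G (left_ideal_rep G e) Ind) =
    (\<Sum>h\<in>carrier H. conj_sum G e (\<phi> h) * frame_character V X d h) / of_nat (card (carrier H))"
proof -
  let ?n = "of_nat (card (carrier H)) :: complex"
  interpret e: primitive_idempotent G e by (rule e)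
  have "of_nat (multiplicity_rep G (left_ideal_rep G e) Ind) =
      (\<Sum>k\<in>carrier G. e k * frame_character Ind (carrier G \<times> X) (ind_frame d) k)"
    by (rule e.multiplicity_eq_character_sum[OF representation_ind frame_ind[OF fr]])
  also have "\<dots> = (\<Sum>k\<in>carrier G. \<Sum>h\<in>carrier H. \<Sum>g\<in>carrier G.
      if k = g \<otimes>\<^bsub>G\<^esub> \<phi> h \<otimes>\<^bsub>G\<^esub> inv\<^bsub>G\<^esub> g then e k * frame_character V X d h else 0) / ?n"
    by (simp add: frame_character_ind sum_distrib_left sum_divide_distrib[symmetric]
      if_distrib[of "\<lambda>z. _ * z"] cong: if_cong sum.cong)
  also have "(\<Sum>k\<in>carrier G. \<Sum>h\<in>carrier H. \<Sum>g\<in>carrier G.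
      if k = g \<otimes>\<^bsub>G\<^esub> \<phi> h \<otimes>\<^bsub>G\<^esub> inv\<^bsub>G\<^esub> g then e k * frame_character V X d h else 0) =
      (\<Sum>h\<in>carrier H. \<Sum>g\<in>carrier G. \<Sum>k\<in>carrier G.
      if k = g \<otimes>\<^bsub>G\<^esub> \<phi> h \<otimes>\<^bsub>G\<^esub> inv\<^bsub>G\<^esub> g then e k * frame_character V X d h else 0)"
    by (subst sum.swap) (intro sum.cong refl sum.swap)
  also have "\<dots> = (\<Sum>h\<in>carrier H. \<Sum>g\<in>carrier G.
      e (g \<otimes>\<^bsub>G\<^esub> \<phi> h \<otimes>\<^bsub>G\<^esub> inv\<^bsub>G\<^esub> g) * frame_character V X d h)"
    using G.finite_G by (intro sum.cong refl) (simp add: sum.delta)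
  also have "\<dots> = (\<Sum>h\<in>carrier H. conj_sum G e (\<phi> h) * frame_character V X d h)"
    by (simp add: conj_sum_def sum_distrib_right)
  finally show ?thesis .
qed

end

section \<open>Frobenius' formula for characters of symmetric groups\<close>

text \<open>The coefficient of the monomial with exponents \<open>B\<close> in the Vandermonde
  determinant \<open>det (x_i ^ j)\<close>. The exponents are integers, since differences of
  contents and shifted parts are inserted; a negative one gives 0.\<close>

definition alt_coeff :: "nat \<Rightarrow> (nat \<Rightarrow> int) \<Rightarrow> int"
  where "alt_coeff k B = (\<Sum>w | w permutes {..<k}. if \<forall>i<k. B i = int (w i) then sign w else 0)"

definition cnt :: "'s set \<Rightarrow> ('s \<Rightarrow> 'c) \<Rightarrow> 'c \<Rightarrow> nat"
  where "cnt S f i = card {s \<in> S. f s = i}"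

definition fixed_colorings :: "'c set \<Rightarrow> 's set \<Rightarrow> ('s \<Rightarrow> 's) \<Rightarrow> ('s \<Rightarrow> 'c) set"
  where "fixed_colorings X S \<sigma> = {f \<in> S \<rightarrow>\<^sub>E X. \<forall>s\<in>S. f (\<sigma> s) = f s}"

text \<open>Up to the shift \<open>A i = \<kappa> i - i\<close> this is the coefficient of \<open>x\<^bsup>\<kappa> + \<delta>\<^esup>\<close> in
  \<open>a\<^sub>\<delta> p\<^sub>\<sigma>\<close>, where \<open>p\<^sub>\<sigma>\<close> is the power sum product given by the cycle type of \<open>\<sigma>\<close>.\<close>

definition frob :: "nat \<Rightarrow> 's set \<Rightarrow> (nat \<Rightarrow> int) \<Rightarrow> ('s \<Rightarrow> 's) \<Rightarrow> int"
  where "frob k S A \<sigma> =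
    (\<Sum>f\<in>fixed_colorings {..<k} S \<sigma>. alt_coeff k (\<lambda>i. int (cnt S f i) - A i))"

definition contents :: "'c set \<Rightarrow> nat \<Rightarrow> ('c \<Rightarrow> nat) set"
  where "contents X n = {c. (\<forall>i. i \<notin> X \<longrightarrow> c i = 0) \<and> (\<Sum>i\<in>X. c i) = n}"


lemma finite_contents: "finite X \<Longrightarrow> finite (contents X n)"
proof (rule finite_subset)
  assume X: "finite X"
  show "contents X n \<subseteq> (\<lambda>g i. if i \<in> X then g i else 0) ` (X \<rightarrow>\<^sub>E {..n})"
  proof
    fix c assume c: "c \<in> contents X n"
    have "c i \<le> n" if "i \<in> X" for i
      using c member_le_sum[of i X c] that X by (auto simp: contents_def)
    then have "restrict c X \<in> X \<rightarrow>\<^sub>E {..n}" by auto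
    moreover have "c = (\<lambda>i. if i \<in> X then restrict c X i else 0)"
      using c by (auto simp: contents_def)
    ultimately show "c \<in> (\<lambda>g i. if i \<in> X then g i else 0) ` (X \<rightarrow>\<^sub>E {..n})" by blast
  qed
qed (auto intro: finite_PiE)

subsection \<open>Alternating coefficients\<close>

lemma alt_coeff_cong: "(\<And>i. i < k \<Longrightarrow> B i = B' i) \<Longrightarrow> alt_coeff k B = alt_coeff k B'"
  unfolding alt_coeff_def by (intro sum.cong refl) auto

lemma permutation_of_permutes: "w permutes {..<(k::nat)} \<Longrightarrow> permutation w"
  by (metis finite_lessThan permutation_permutes)

lemma alt_coeff_compose:
  assumes u: "u permutes {..<k}"
  shows "alt_coeff k (\<lambda>i. B (u i)) = sign u * alt_coeff k B"
proof -
  have "alt_coeff k (\<lambda>i. B (u i)) =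
      (\<Sum>w | w permutes {..<k}. if \<forall>i<k. B (u i) = int ((w \<circ> u) i) then sign (w \<circ> u) else 0)"
    unfolding alt_coeff_def
    by (rule sum_permutations_compose_right[OF u])
  also have "\<dots> = (\<Sum>w | w permutes {..<k}. sign u * (if \<forall>i<k. B i = int (w i) then sign w else 0))"
  proof (rule sum.cong[OF refl])
    fix w assume "w \<in> {w. w permutes {..<k}}"
    then have w: "w permutes {..<k}" by simp
    have "(\<forall>i<k. B (u i) = int ((w \<circ> u) i)) \<longleftrightarrow> (\<forall>j\<in>u ` {..<k}. B j = int (w j))"
      by auto
    also have "\<dots> \<longleftrightarrow> (\<forall>i<k. B i = int (w i))"
      using permutes_image[OF u] by auto
    finally show "(if \<forall>i<k. B (u i) = int ((w \<circ> u) i) then sign (w \<circ> u) else 0) =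
        sign u * (if \<forall>i<k. B i = int (w i) then sign w else 0)"
      using sign_compose[of w u] u w permutation_of_permutes by (auto simp: mult.commute)
  qed
  finally show ?thesis by (simp add: alt_coeff_def sum_distrib_left)
qed

lemma alt_coeff_nonzeroE:
  assumes "alt_coeff k B \<noteq> 0"
  obtains w where "w permutes {..<k}" "\<And>i. i < k \<Longrightarrow> B i = int (w i)"
proof -
  have "\<exists>w\<in>{w. w permutes {..<k}}. (if \<forall>i<k. B i = int (w i) then sign w else 0) \<noteq> 0"
    using assms sum.neutral[of "{w. w permutes {..<k}}" "\<lambda>w. if \<forall>i<k. B i = int (w i) then sign w else 0"]
    unfolding alt_coeff_def by blast
  then show ?thesis using that by (auto split: if_splits)
qed

lemma alt_coeff_perm:
  assumes w: "w permutes {..<k}" and B: "\<And>i. i < k \<Longrightarrow> B i = int (w i)"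
  shows "alt_coeff k B = sign w"
proof -
  have "(\<forall>i<k. B i = int (v i)) \<longleftrightarrow> v = w" if v: "v permutes {..<k}" for v
  proof
    assume "\<forall>i<k. B i = int (v i)"
    then have "v i = w i" for i
      using B v w by (cases "i < k") (auto simp: permutes_def)
    then show "v = w" by blast
  qed (use B in auto)
  then have "alt_coeff k B = (\<Sum>v | v permutes {..<k}. if v = w then sign w else 0)"
    unfolding alt_coeff_def by (intro sum.cong refl) auto
  then show ?thesis using w by (simp add: finite_permutations)
qed

lemma increasing_permutation_id:
  assumes w: "w permutes {..<(k::nat)}" and mono: "\<And>i j. i < j \<Longrightarrow> j < k \<Longrightarrow> w i < w j" and "i < k"
  shows "w i = i"
proof -
  have ge: "j \<le> w j" if "j < k" for j
    using that
  proof (induction j)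
    case (Suc j)
    then show ?case using mono[of j "Suc j"] by simp
  qed simp
  have "(\<Sum>j<k. j) = (\<Sum>j<k. w j)" using sum.permute[OF w, of id] by (simp add: comp_def)
  then have "i = w i"
    by (rule sum_mono_inv) (use ge \<open>i < k\<close> in auto)
  then show ?thesis ..
qed

text \<open>By induction the values below \<open>i\<close> are already taken, so
  \<open>w i \<ge> i\<close>, while the partial sum up to \<open>i\<close> leaves at most
  \<open>i\<close>. In this way dominance singles out the identity in the alternating sums.\<close>

lemma dominated_permutation_id:
  assumes w: "w permutes {..<(k::nat)}"
    and dom: "\<And>j. j \<le> k \<Longrightarrow> (\<Sum>i<j. w i) \<le> (\<Sum>i<j. i)" and "i < k"
  shows "w i = i"
  using \<open>i < k\<close>
proof (induction i rule: less_induct)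
  case (less i)
  have eq: "w j = j" if "j < i" for j using less that by simp
  have "(\<Sum>j<Suc i. w j) \<le> (\<Sum>j<Suc i. j)" using dom[of "Suc i"] less.prems by simp
  then have "w i \<le> i" using eq by simp
  moreover have "w i \<noteq> j" if "j < i" for j
    using eq[OF that] that permutes_inj[OF w] by (metis injD less_irrefl)
  ultimately show ?case by (metis le_neq_implies_less)
qed

text \<open>Permuting the colours permutes the entries of \<open>A\<close>, and the sign comes from
  \<open>alt_coeff\<close>. This antisymmetry in \<open>A\<close> is what allows integer vectors to
  be sorted later.\<close>

lemma frob_compose:
  assumes u: "u permutes {..<k}" and \<sigma>: "\<And>s. s \<in> S \<Longrightarrow> \<sigma> s \<in> S"
  shows "frob k S (\<lambda>i. A (u i)) \<sigma> = sign u * frob k S A \<sigma>"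
proof -
  have uv: "u (inv' u i) = i" "inv' u (u i) = i" for i
    using permutes_inverses[OF u] by auto
  have v: "inv' u permutes {..<k}" by (rule permutes_inv[OF u])
  have lt: "u i < k \<longleftrightarrow> i < k" "inv' u i < k \<longleftrightarrow> i < k" for i
    using permutes_in_image[OF u] permutes_in_image[OF v] by auto
  have "frob k S (\<lambda>i. A (u i)) \<sigma> =
      (\<Sum>f\<in>fixed_colorings {..<k} S \<sigma>. alt_coeff k (\<lambda>i. int (cnt S f (u i)) - A (u i)))"
    unfolding frob_def
  proof (rule sum.reindex_bij_witness[of _ "\<lambda>f. restrict (\<lambda>s. inv' u (f s)) S"
        "\<lambda>f. restrict (\<lambda>s. u (f s)) S"])
    fix f assume f: "f \<in> fixed_colorings {..<k} S \<sigma>"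
    then have ext: "f s = undefined" if "s \<notin> S" for s
      using that by (auto simp: fixed_colorings_def PiE_iff extensional_def)
    show "restrict (\<lambda>s. inv' u (restrict (\<lambda>s. u (f s)) S s)) S = f"
      and "restrict (\<lambda>s. u (restrict (\<lambda>s. inv' u (f s)) S s)) S = f"
      by (auto simp: fun_eq_iff uv ext)
    show "restrict (\<lambda>s. u (f s)) S \<in> fixed_colorings {..<k} S \<sigma>"
      and "restrict (\<lambda>s. inv' u (f s)) S \<in> fixed_colorings {..<k} S \<sigma>"
      using f lt \<sigma> by (auto simp: fixed_colorings_def PiE_iff)
    have "cnt S (restrict (\<lambda>s. u (f s)) S) (u i) = cnt S f i" for i
      unfolding cnt_def by (rule arg_cong[of _ _ card]) (auto, metis uv(2))
    then show "alt_coeff k (\<lambda>i. int (cnt S (restrict (\<lambda>s. u (f s)) S) (u i)) - A (u i)) =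
        alt_coeff k (\<lambda>i. int (cnt S f i) - A (u i))"
      by simp
  qed
  also have "\<dots> = (\<Sum>f\<in>fixed_colorings {..<k} S \<sigma>. sign u * alt_coeff k (\<lambda>i. int (cnt S f i) - A i))"
    by (intro sum.cong refl alt_coeff_compose[OF u])
  finally show ?thesis by (simp add: frob_def sum_distrib_left)
qed

lemma frob_cong: "(\<And>i. i < k \<Longrightarrow> A i = A' i) \<Longrightarrow> frob k S A \<sigma> = frob k S A' \<sigma>"
  unfolding frob_def by (intro sum.cong refl alt_coeff_cong) auto

lemma sum_cnt:
  assumes "finite X" "finite S" "\<And>s. s \<in> S \<Longrightarrow> f s \<in> X"
  shows "(\<Sum>i\<in>X. cnt S f i) = card S"
  using sum.group[of S X f "\<lambda>_. 1::nat"] assms by (auto simp: cnt_def image_subset_iff)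

lemma cnt_cong: "(\<And>s. s \<in> S \<Longrightarrow> f s = g s) \<Longrightarrow> cnt S f i = cnt S g i"
  unfolding cnt_def by (metis (mono_tags, lifting) Collect_cong)

lemma cnt_compose:
  assumes q: "q permutes S"
  shows "cnt S (\<lambda>s. f (q s)) i = cnt S f i"
proof -
  have "{s \<in> S. f s = i} = q ` {s \<in> S. f (q s) = i}"
  proof (intro equalityI subsetI)
    fix s assume "s \<in> {s \<in> S. f s = i}"
    then show "s \<in> q ` {s \<in> S. f (q s) = i}"
      using permutes_inverses(1)[OF q, of s] permutes_in_image[OF permutes_inv[OF q], of s]
      by (intro image_eqI[of _ _ "inv' q s"]) auto
  qed (use permutes_in_image[OF q] in auto)
  then show ?thesis
    unfolding cnt_def using permutes_inj[OF q] by (simp add: card_image inj_on_subset)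
qed

lemma cnt_split:
  assumes S: "S = \<pi> ` S1 \<union> \<rho> ` S2" "\<pi> ` S1 \<inter> \<rho> ` S2 = {}"
    and inj: "inj_on \<pi> S1" "inj_on \<rho> S2" and fin: "finite S1" "finite S2"
  shows "cnt S f i = cnt S1 (\<lambda>s. f (\<pi> s)) i + cnt S2 (\<lambda>s. f (\<rho> s)) i"
proof -
  have "{s \<in> S. f s = i} = \<pi> ` {s \<in> S1. f (\<pi> s) = i} \<union> \<rho> ` {s \<in> S2. f (\<rho> s) = i}"
    using S by auto
  moreover have "card (\<pi> ` {s \<in> S1. f (\<pi> s) = i}) = cnt S1 (\<lambda>s. f (\<pi> s)) i"
    unfolding cnt_def using inj by (intro card_image) (auto intro: inj_on_subset)
  moreover have "card (\<rho> ` {s \<in> S2. f (\<rho> s) = i}) = cnt S2 (\<lambda>s. f (\<rho> s)) i"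
    unfolding cnt_def using inj by (intro card_image) (auto intro: inj_on_subset)
  moreover have "\<pi> ` {s \<in> S1. f (\<pi> s) = i} \<inter> \<rho> ` {s \<in> S2. f (\<rho> s) = i} = {}"
    using S(2) by auto
  ultimately show ?thesis using fin by (simp add: cnt_def card_Un_disjoint)
qed

text \<open>The restriction rule for a product of two groups: once the colours on the second piece
  are chosen, their content is subtracted from \<open>A\<close>. The result is in general no longer
  a shifted partition, which is the reason to admit every integer vector.\<close>

lemma frob_split:
  fixes S1 :: "'s set" and S2 :: "'t set" and S :: "'r set"
  assumes S: "S = \<pi> ` S1 \<union> \<rho> ` S2" "\<pi> ` S1 \<inter> \<rho> ` S2 = {}"
    and inj: "inj_on \<pi> S1" "inj_on \<rho> S2" and fin: "finite S1" "finite S2"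
    and a: "\<And>s. s \<in> S1 \<Longrightarrow> a s \<in> S1" "\<And>s. s \<in> S1 \<Longrightarrow> \<sigma> (\<pi> s) = \<pi> (a s)"
    and b: "\<And>s. s \<in> S2 \<Longrightarrow> b s \<in> S2" "\<And>s. s \<in> S2 \<Longrightarrow> \<sigma> (\<rho> s) = \<rho> (b s)"
  shows "frob k S A \<sigma> =
    (\<Sum>g\<in>fixed_colorings {..<k} S2 b. frob k S1 (\<lambda>i. A i - int (cnt S2 g i)) a)"
proof -
  define join :: "('t \<Rightarrow> nat) \<Rightarrow> ('s \<Rightarrow> nat) \<Rightarrow> 'r \<Rightarrow> nat" where
    "join g f = (\<lambda>s. if s \<in> \<pi> ` S1 then f (the_inv_into S1 \<pi> s)
      else if s \<in> \<rho> ` S2 then g (the_inv_into S2 \<rho> s) else undefined)" for g f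
  have join1: "join g f (\<pi> s) = f s" if "s \<in> S1" for g f s
    using that inj by (simp add: join_def the_inv_into_f_f)
  have join2: "join g f (\<rho> s) = g s" if "s \<in> S2" for g f s
    using that inj S(2) by (auto simp: join_def the_inv_into_f_f)
  have join_out: "join g f s = undefined" if "s \<notin> S" for g f s
    using that S(1) by (simp add: join_def)
  have cases: "(\<exists>t\<in>S1. s = \<pi> t) \<or> (\<exists>t\<in>S2. s = \<rho> t)" if "s \<in> S" for s
    using that S(1) by auto
  have in_S: "\<pi> s \<in> S" if "s \<in> S1" for s using that S(1) by auto
  have in_S': "\<rho> s \<in> S" if "s \<in> S2" for s using that S(1) by auto
  let ?F = "fixed_colorings {..<k} S \<sigma>" and ?F1 = "fixed_colorings {..<k} S1 a"
    and ?F2 = "fixed_colorings {..<k} S2 b"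
  have "frob k S A \<sigma> = (\<Sum>(g, f)\<in>?F2 \<times> ?F1.
      alt_coeff k (\<lambda>i. int (cnt S1 f i) - (A i - int (cnt S2 g i))))"
    unfolding frob_def
  proof (rule sum.reindex_bij_witness[of _ "\<lambda>(g, f). join g f"
        "\<lambda>f. (restrict (\<lambda>s. f (\<rho> s)) S2, restrict (\<lambda>s. f (\<pi> s)) S1)"])
    fix f assume f: "f \<in> ?F"
    have f_in: "f s < k" "f (\<sigma> s) = f s" if "s \<in> S" for s
      using f that by (auto simp: fixed_colorings_def)
    have f_out: "f s = undefined" if "s \<notin> S" for s
      using f that by (auto simp: fixed_colorings_def PiE_iff extensional_def)
    show "(case (restrict (\<lambda>s. f (\<rho> s)) S2, restrict (\<lambda>s. f (\<pi> s)) S1) of (g, f) \<Rightarrow> join g f) = f"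
    proof
      fix s
      show "(case (restrict (\<lambda>s. f (\<rho> s)) S2, restrict (\<lambda>s. f (\<pi> s)) S1) of (g, f) \<Rightarrow> join g f) s = f s"
        using cases[of s] by (cases "s \<in> S") (auto simp: join1 join2 join_out f_out)
    qed
    show "(restrict (\<lambda>s. f (\<rho> s)) S2, restrict (\<lambda>s. f (\<pi> s)) S1) \<in> ?F2 \<times> ?F1"
      using f_in in_S in_S' a b by (fastforce simp: fixed_colorings_def)
    have "int (cnt S f i) = int (cnt S1 (restrict (\<lambda>s. f (\<pi> s)) S1) i) +
        int (cnt S2 (restrict (\<lambda>s. f (\<rho> s)) S2) i)" for i
      unfolding cnt_split[OF S inj fin] using cnt_cong[of S1 "restrict (\<lambda>s. f (\<pi> s)) S1" "\<lambda>s. f (\<pi> s)"]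
        cnt_cong[of S2 "restrict (\<lambda>s. f (\<rho> s)) S2" "\<lambda>s. f (\<rho> s)"] by simp
    then show "(case (restrict (\<lambda>s. f (\<rho> s)) S2, restrict (\<lambda>s. f (\<pi> s)) S1) of
        (g, f) \<Rightarrow> alt_coeff k (\<lambda>i. int (cnt S1 f i) - (A i - int (cnt S2 g i)))) =
        alt_coeff k (\<lambda>i. int (cnt S f i) - A i)"
      by (auto intro!: alt_coeff_cong)
  next
    fix p assume p: "p \<in> ?F2 \<times> ?F1"
    obtain g f where gf: "p = (g, f)" by force
    have fg_in: "f s < k" "f (a s) = f s" if "s \<in> S1" for s
      using p that by (auto simp: fixed_colorings_def gf)
    have g_in: "g s < k" "g (b s) = g s" if "s \<in> S2" for s
      using p that by (auto simp: fixed_colorings_def gf)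
    have f_out: "f s = undefined" if "s \<notin> S1" for s
      using p that by (auto simp: fixed_colorings_def PiE_iff extensional_def gf)
    have g_out: "g s = undefined" if "s \<notin> S2" for s
      using p that by (auto simp: fixed_colorings_def PiE_iff extensional_def gf)
    have "restrict (\<lambda>s. join g f (\<rho> s)) S2 = g" "restrict (\<lambda>s. join g f (\<pi> s)) S1 = f"
      by (auto simp: fun_eq_iff join1 join2 f_out g_out)
    then show "(restrict (\<lambda>s. (case p of (g, f) \<Rightarrow> join g f) (\<rho> s)) S2,
        restrict (\<lambda>s. (case p of (g, f) \<Rightarrow> join g f) (\<pi> s)) S1) = p"
      by (simp add: gf)
    have "join g f s < k \<and> join g f (\<sigma> s) = join g f s" if "s \<in> S" for s
      using cases[OF that] a b fg_in g_in by (auto simp: join1 join2)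
    then show "(case p of (g, f) \<Rightarrow> join g f) \<in> ?F"
      by (auto simp: gf fixed_colorings_def PiE_iff extensional_def join_out)
  qed
  also have "\<dots> = (\<Sum>g\<in>?F2. frob k S1 (\<lambda>i. A i - int (cnt S2 g i)) a)"
    unfolding frob_def by (rule sum.cartesian_product[symmetric])
  finally show ?thesis .
qed

text \<open>The case of an empty second piece; for a permutation \<open>\<pi>\<close> of
  \<open>S\<close> it gives invariance under conjugation.\<close>

lemma frob_relabel:
  assumes "inj_on \<pi> S" "finite S" "\<And>s. s \<in> S \<Longrightarrow> a s \<in> S" "\<And>s. s \<in> S \<Longrightarrow> \<sigma> (\<pi> s) = \<pi> (a s)"
  shows "frob k (\<pi> ` S) A \<sigma> = frob k S A a"
proof -
  have "frob k (\<pi> ` S) A \<sigma> =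
      (\<Sum>g\<in>fixed_colorings {..<k} {} id. frob k S (\<lambda>i. A i - int (cnt ({}::'a set) g i)) a)"
    by (rule frob_split[where \<rho> = \<pi>]) (use assms in auto)
  also have "fixed_colorings {..<k} ({}::'a set) id = {\<lambda>_. undefined}"
    by (auto simp: fixed_colorings_def)
  finally show ?thesis by (simp add: cnt_def)
qed

subsection \<open>Counting orbits of colourings\<close>

lemma cnt_eq_count: "finite S \<Longrightarrow> cnt S f i = count (image_mset f (mset_set S)) i"
  by (simp add: cnt_def count_image_mset_eq_card_vimage)

lemma exists_coloring_with_contents:
  assumes "finite S" "finite X" "c \<in> contents X (card S)"
  obtains f where "f \<in> S \<rightarrow>\<^sub>E X" "cnt S f = c"
proof -
  define M where "M = (\<Sum>i\<in>X. replicate_mset (c i) i)"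
  have count_M: "count M i = c i" for i
    using assms(2,3) by (auto simp: M_def count_sum contents_def if_distrib cong: if_cong)
  have set_M: "set_mset M \<subseteq> X"
    using count_M assms(3) by (auto simp: contents_def count_greater_zero_iff[symmetric] simp del: count_greater_zero_iff)
  have size_M: "size M = card S"
    using assms(3) by (simp add: M_def contents_def size_multiset_sum)
  obtain xs where xs: "mset xs = M" using ex_mset by blast
  have len: "length xs = card S" using xs size_M size_mset by metis
  obtain h where h: "bij_betw h S {0..<length xs}"
    using assms(1) len ex_bij_betw_finite_nat by metis
  define f where "f = restrict (\<lambda>s. xs ! h s) S"
  have hS: "h s < length xs" if "s \<in> S" for s using h that by (auto simp: bij_betw_def)
  have "image_mset f (mset_set S) = image_mset (\<lambda>s. xs ! h s) (mset_set S)"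
    using assms(1) by (intro image_mset_cong) (simp add: f_def)
  also have "\<dots> = image_mset ((!) xs) (image_mset h (mset_set S))"
    by (simp add: image_mset.compositionality comp_def)
  also have "image_mset h (mset_set S) = mset_set {0..<length xs}"
    using h by (simp add: bij_betw_def image_mset_mset_set)
  also have "image_mset ((!) xs) (mset_set {0..<length xs}) = mset xs"
    by (metis map_nth mset_map mset_upt)
  finally have "cnt S f i = c i" for i using assms(1) by (simp add: cnt_eq_count xs count_M)
  moreover have "f s \<in> X" if "s \<in> S" for s
    using hS[OF that] that set_M xs nth_mem_mset[of "h s" xs] by (auto simp: f_def)
  then have "f \<in> S \<rightarrow>\<^sub>E X" by (auto simp: f_def)
  ultimately show ?thesis using that by blast
qed

lemma exists_permutation_of_equal_contents:
  assumes "finite S" "cnt S f = cnt S g"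
  obtains \<tau> where "\<tau> permutes S" "\<And>s. s \<in> S \<Longrightarrow> f s = g (\<tau> s)"
proof -
  have "image_mset f (mset_set S) = image_mset g (mset_set S)"
    using assms by (intro multiset_eqI) (simp add: cnt_eq_count[symmetric])
  then show ?thesis using image_mset_eq_implies_permutes[OF assms(1)] that by metis
qed

text \<open>The permutations that carry \<open>g\<close> to \<open>f\<close> form a coset of the
  stabilizer of \<open>f\<close>. Counting them instead makes the double count over an orbit
  possible.\<close>

lemma card_stabilizer_eq:
  assumes S: "finite S" and eq: "cnt S f = cnt S g"
  shows "card {\<sigma>. \<sigma> permutes S \<and> (\<forall>s\<in>S. f (\<sigma> s) = f s)} =
    card {\<sigma>. \<sigma> permutes S \<and> (\<forall>s\<in>S. f s = g (\<sigma> s))}"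
proof -
  obtain \<tau> where \<tau>: "\<tau> permutes S" "\<And>s. s \<in> S \<Longrightarrow> f s = g (\<tau> s)"
    using exists_permutation_of_equal_contents[OF S eq] by blast
  have inv: "inv' \<tau> permutes S" "\<tau> (inv' \<tau> s) = s" "inv' \<tau> (\<tau> s) = s" for s
    using \<tau>(1) permutes_inv permutes_inverses[OF \<tau>(1)] by auto
  have mem: "\<sigma> s \<in> S" if "\<sigma> permutes S" "s \<in> S" for \<sigma> s
    using that permutes_in_image by metis
  have "bij_betw (\<lambda>\<sigma>. \<tau> \<circ> \<sigma>) {\<sigma>. \<sigma> permutes S \<and> (\<forall>s\<in>S. f (\<sigma> s) = f s)}
      {\<sigma>. \<sigma> permutes S \<and> (\<forall>s\<in>S. f s = g (\<sigma> s))}"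
  proof (rule bij_betw_byWitness[where f' = "\<lambda>\<sigma>. inv' \<tau> \<circ> \<sigma>"])
    show "(\<lambda>\<sigma>. \<tau> \<circ> \<sigma>) ` {\<sigma>. \<sigma> permutes S \<and> (\<forall>s\<in>S. f (\<sigma> s) = f s)}
        \<subseteq> {\<sigma>. \<sigma> permutes S \<and> (\<forall>s\<in>S. f s = g (\<sigma> s))}"
      using \<tau> mem by (auto intro: permutes_compose)
    show "(\<lambda>\<sigma>. inv' \<tau> \<circ> \<sigma>) ` {\<sigma>. \<sigma> permutes S \<and> (\<forall>s\<in>S. f s = g (\<sigma> s))}
        \<subseteq> {\<sigma>. \<sigma> permutes S \<and> (\<forall>s\<in>S. f (\<sigma> s) = f s)}"
      using \<tau> inv mem by (auto intro: permutes_compose)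
  qed (auto simp: inv comp_def)
  then show ?thesis by (rule bij_betw_same_card)
qed

text \<open>Orbit counting: the colourings of a given content form one orbit, and the stabilizers of
  its members add up to \<open>fact (card S)\<close>. The latter is a double count: for a fixed
  \<open>g\<close> in the orbit, every \<open>\<sigma>\<close> transports \<open>g\<close> to
  exactly one \<open>f\<close>.\<close>

lemma sum_fixed_colorings:
  fixes \<phi> :: "('c \<Rightarrow> nat) \<Rightarrow> int"
  assumes S: "finite S" and X: "finite X"
  shows "(\<Sum>\<sigma> | \<sigma> permutes S. \<Sum>f\<in>fixed_colorings X S \<sigma>. \<phi> (cnt S f)) =
    fact (card S) * (\<Sum>c\<in>contents X (card S). \<phi> c)"
proof -
  let ?P = "{\<sigma>. \<sigma> permutes S}"
  have finP: "finite ?P" using S by (rule finite_permutations)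
  have finF: "finite (S \<rightarrow>\<^sub>E X)" using S X by (simp add: finite_PiE)
  have "(\<Sum>\<sigma>\<in>?P. \<Sum>f\<in>fixed_colorings X S \<sigma>. \<phi> (cnt S f)) =
      (\<Sum>\<sigma>\<in>?P. \<Sum>f\<in>S \<rightarrow>\<^sub>E X. if \<forall>s\<in>S. f (\<sigma> s) = f s then \<phi> (cnt S f) else 0)"
    unfolding fixed_colorings_def
    by (rule sum.cong[OF refl], rule sum.inter_filter[OF finF])
  also have "\<dots> = (\<Sum>f\<in>S \<rightarrow>\<^sub>E X. \<Sum>\<sigma>\<in>?P. if \<forall>s\<in>S. f (\<sigma> s) = f s then \<phi> (cnt S f) else 0)"
    by (rule sum.swap)
  also have "\<dots> = (\<Sum>f\<in>S \<rightarrow>\<^sub>E X.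
      int (card {\<sigma>. \<sigma> permutes S \<and> (\<forall>s\<in>S. f (\<sigma> s) = f s)}) * \<phi> (cnt S f))"
    using finP by (intro sum.cong refl) (simp add: sum.inter_filter[symmetric])
  also have "\<dots> = (\<Sum>c\<in>contents X (card S). \<Sum>f\<in>{f \<in> S \<rightarrow>\<^sub>E X. cnt S f = c}.
      int (card {\<sigma>. \<sigma> permutes S \<and> (\<forall>s\<in>S. f (\<sigma> s) = f s)}) * \<phi> (cnt S f))"
  proof (rule sum.group[symmetric, OF finF finite_contents[OF X]])
    show "cnt S ` (S \<rightarrow>\<^sub>E X) \<subseteq> contents X (card S)"
    proof
      fix c assume "c \<in> cnt S ` (S \<rightarrow>\<^sub>E X)"
      then obtain f where f: "f \<in> S \<rightarrow>\<^sub>E X" "c = cnt S f" by blast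
      then have fX: "f s \<in> X" if "s \<in> S" for s using that by auto
      have "cnt S f i = 0" if "i \<notin> X" for i
      proof -
        have "{s \<in> S. f s = i} = {}" using fX that by blast
        then show ?thesis unfolding cnt_def by (simp only: card.empty)
      qed
      then show "c \<in> contents X (card S)"
        using f(2) sum_cnt[OF X S fX] by (simp add: contents_def)
    qed
  qed
  also have "\<dots> = (\<Sum>c\<in>contents X (card S). fact (card S) * \<phi> c)"
  proof (rule sum.cong[OF refl])
    fix c assume "c \<in> contents X (card S)"
    then obtain g where g: "g \<in> S \<rightarrow>\<^sub>E X" "cnt S g = c"
      using exists_coloring_with_contents[OF S X] by blast
    let ?C = "{f \<in> S \<rightarrow>\<^sub>E X. cnt S f = c}"
    have "(\<Sum>f\<in>?C. card {\<sigma>. \<sigma> permutes S \<and> (\<forall>s\<in>S. f (\<sigma> s) = f s)}) =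
        (\<Sum>f\<in>?C. card {\<sigma>. \<sigma> permutes S \<and> (\<forall>s\<in>S. f s = g (\<sigma> s))})"
      using g(2) by (intro sum.cong refl card_stabilizer_eq[OF S]) simp
    also have "\<dots> = (\<Sum>f\<in>?C. \<Sum>\<sigma>\<in>?P. if \<forall>s\<in>S. f s = g (\<sigma> s) then 1 else 0)"
      using finP by (intro sum.cong refl) (simp add: sum.inter_filter[symmetric])
    also have "\<dots> = (\<Sum>\<sigma>\<in>?P. \<Sum>f\<in>?C. if \<forall>s\<in>S. f s = g (\<sigma> s) then 1 else 0)"
      by (rule sum.swap)
    also have "\<dots> = (\<Sum>\<sigma>\<in>?P. 1)"
    proof (rule sum.cong[OF refl])
      fix \<sigma> assume "\<sigma> \<in> ?P"
      then have \<sigma>: "\<sigma> permutes S" by simp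
      let ?f = "restrict (\<lambda>s. g (\<sigma> s)) S"
      have "cnt S ?f i = cnt S g i" for i
        using cnt_cong[of S ?f "\<lambda>s. g (\<sigma> s)" i] cnt_compose[OF \<sigma>, of g i] by simp
      then have "?f \<in> ?C"
        using g permutes_in_image[OF \<sigma>] by (auto simp: fun_eq_iff)
      moreover have "(\<forall>s\<in>S. f s = g (\<sigma> s)) \<longleftrightarrow> f = ?f" if "f \<in> ?C" for f
        using that by (auto simp: fun_eq_iff PiE_iff extensional_def)
      then have "(\<Sum>f\<in>?C. if \<forall>s\<in>S. f s = g (\<sigma> s) then 1 else 0 :: nat) =
          (\<Sum>f\<in>?C. if f = ?f then 1 else 0)"
        by (intro sum.cong refl) simp
      ultimately show "(\<Sum>f\<in>?C. if \<forall>s\<in>S. f s = g (\<sigma> s) then 1 else 0 :: nat) = 1"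
        using finF by (simp add: sum.delta')
    qed
    also have "\<dots> = fact (card S)" using card_permutations[OF refl S] by simp
    finally have "int (\<Sum>f\<in>?C. card {\<sigma>. \<sigma> permutes S \<and> (\<forall>s\<in>S. f (\<sigma> s) = f s)}) = int (fact (card S))"
      by (rule arg_cong)
    then have "(\<Sum>f\<in>?C. int (card {\<sigma>. \<sigma> permutes S \<and> (\<forall>s\<in>S. f (\<sigma> s) = f s)})) = fact (card S)"
      by (simp only: of_nat_sum of_nat_fact)
    moreover have "(\<Sum>f\<in>?C. int (card {\<sigma>. \<sigma> permutes S \<and> (\<forall>s\<in>S. f (\<sigma> s) = f s)}) * \<phi> (cnt S f)) =
        (\<Sum>f\<in>?C. int (card {\<sigma>. \<sigma> permutes S \<and> (\<forall>s\<in>S. f (\<sigma> s) = f s)})) * \<phi> c"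
      by (simp add: sum_distrib_right)
    ultimately show "(\<Sum>f\<in>?C. int (card {\<sigma>. \<sigma> permutes S \<and> (\<forall>s\<in>S. f (\<sigma> s) = f s)}) * \<phi> (cnt S f)) =
        fact (card S) * \<phi> c"
      by simp
  qed
  finally show ?thesis by (simp add: sum_distrib_left)
qed

subsection \<open>Orthonormality\<close>

text \<open>For a partition \<open>\<kappa>\<close> with at most \<open>k\<close> rows and
  \<open>A i = \<kappa> i - i\<close> this is the Kostka number of shape \<open>\<kappa>\<close> and
  content \<open>\<nu> 0, ..., \<nu> (J - 1)\<close>: the coefficient of a Schur function in a
  product of complete symmetric functions. Each step of the recursion removes one factor.\<close>

primrec pieri :: "nat \<Rightarrow> (nat \<Rightarrow> nat) \<Rightarrow> nat \<Rightarrow> (nat \<Rightarrow> int) \<Rightarrow> int" where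
  "pieri k \<nu> 0 A = alt_coeff k (\<lambda>i. - A i)"
| "pieri k \<nu> (Suc J) A = (\<Sum>c\<in>contents {..<k} (\<nu> J). pieri k \<nu> J (\<lambda>i. A i - int (c i)))"

lemma sum_compose_permutes:
  "u permutes X \<Longrightarrow> (\<Sum>i\<in>X. f (u i)) = (\<Sum>i\<in>X. f i)" for f :: "_ \<Rightarrow> _::comm_monoid_add"
  using sum.permute[of u X f] by (simp add: comp_def)

lemma contents_compose:
  assumes "u permutes X" "c \<in> contents X n"
  shows "(\<lambda>i. c (u i)) \<in> contents X n"
  using assms permutes_in_image[OF assms(1)] by (auto simp: contents_def sum_compose_permutes)

lemma pieri_compose:
  assumes u: "u permutes {..<k}"
  shows "pieri k \<nu> J (\<lambda>i. A (u i)) = sign u * pieri k \<nu> J A"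
proof (induction J arbitrary: A)
  case 0
  show ?case using alt_coeff_compose[OF u, of "\<lambda>i. - A i"] by simp
next
  case (Suc J)
  have v: "inv' u permutes {..<k}" by (rule permutes_inv[OF u])
  have "pieri k \<nu> (Suc J) (\<lambda>i. A (u i)) =
      (\<Sum>c\<in>contents {..<k} (\<nu> J). pieri k \<nu> J (\<lambda>i. A (u i) - int (c (u i))))"
    unfolding pieri.simps
    by (rule sum.reindex_bij_witness[of _ "\<lambda>c i. c (u i)" "\<lambda>c i. c (inv' u i)"])
      (auto simp: permutes_inverses[OF u] contents_compose[OF u] contents_compose[OF v])
  also have "\<dots> = (\<Sum>c\<in>contents {..<k} (\<nu> J). sign u * pieri k \<nu> J (\<lambda>i. A i - int (c i)))"
    by (intro sum.cong refl Suc.IH)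
  finally show ?case by (simp add: sum_distrib_left)
qed

definition strictly_decreasing :: "nat \<Rightarrow> (nat \<Rightarrow> int) \<Rightarrow> bool"
  where "strictly_decreasing k A \<longleftrightarrow> (\<forall>i j. i < j \<longrightarrow> j < k \<longrightarrow> A j < A i)"

text \<open>With \<open>A i = \<kappa> i - i\<close> the inequality reads
  \<open>\<kappa> (i + 1) \<le> \<kappa> i - c i\<close>, the condition that the removed boxes form
  a horizontal strip.\<close>

definition interlacing :: "nat \<Rightarrow> (nat \<Rightarrow> int) \<Rightarrow> (nat \<Rightarrow> nat) \<Rightarrow> bool"
  where "interlacing k A c \<longleftrightarrow> (\<forall>i. Suc i < k \<longrightarrow> A (Suc i) < A i - int (c i))"

text \<open>The terms violating the interlacing condition cancel in pairs: at the first violation, the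
  entries \<open>i\<close> and \<open>i + 1\<close> of \<open>A - c\<close> are swapped.\<close>

lemma sum_noninterlacing:
  assumes A: "strictly_decreasing k A"
  shows "(\<Sum>c | c \<in> contents {..<k} r \<and> \<not> interlacing k A c. pieri k \<nu> J (\<lambda>i. A i - int (c i))) = 0"
    (is "sum ?f ?Bad = 0")
proof -
  define viol where "viol c i \<longleftrightarrow> Suc i < k \<and> A i - int (c i) \<le> A (Suc i)" for c :: "nat \<Rightarrow> nat" and i
  define I where "I c = (LEAST i. viol c i)" for c
  \<comment> \<open>The new entries are chosen so that \<open>A - \<iota> c\<close> is
    \<open>A - c\<close> with the entries at \<open>I c\<close> and the next index exchanged. The
    bound \<open>ge\<close> below keeps the subtraction of natural numbers from being
    truncated.\<close>
  define \<iota> where "\<iota> c = (\<lambda>j. if j = I c then c (Suc (I c)) + nat (A (I c) - A (Suc (I c)))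
      else if j = Suc (I c) then c (I c) - nat (A (I c) - A (Suc (I c))) else c j)" for c
  have bad_iff: "c \<in> ?Bad \<longleftrightarrow> c \<in> contents {..<k} r \<and> (\<exists>i. viol c i)" for c
    by (auto simp: interlacing_def viol_def not_less)
  have viol_I: "viol c (I c)" and least: "viol c i \<Longrightarrow> I c \<le> i" if "c \<in> ?Bad" for c i
    using that unfolding bad_iff I_def by (auto intro: LeastI Least_le)
  have pos: "A (Suc (I c)) < A (I c)" if "c \<in> ?Bad" for c
    using viol_I[OF that] A by (simp add: viol_def strictly_decreasing_def)
  have ge: "nat (A (I c) - A (Suc (I c))) \<le> c (I c)" if "c \<in> ?Bad" for c
    using viol_I[OF that] by (auto simp: viol_def nat_le_iff)
  have sub: "A j - int (\<iota> c j) = A (transpose (I c) (Suc (I c)) j) - int (c (transpose (I c) (Suc (I c)) j))"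
    if "c \<in> ?Bad" for c j
    using pos[OF that] ge[OF that] by (auto simp: \<iota>_def transpose_def of_nat_diff)
  have viol_\<iota>: "viol (\<iota> c) (I c)" if "c \<in> ?Bad" for c
    using viol_I[OF that] pos[OF that] by (auto simp: viol_def \<iota>_def)
  \<comment> \<open>A violation at \<open>i\<close> depends on \<open>c i\<close> alone, and
    \<open>\<iota>\<close> leaves the entries before \<open>I c\<close> unchanged, so the first
    violation stays in place. This makes \<open>\<iota>\<close> an involution.\<close>
  have I_\<iota>: "I (\<iota> c) = I c" if "c \<in> ?Bad" for c
    unfolding I_def[of "\<iota> c"]
  proof (rule Least_equality)
    show "viol (\<iota> c) (I c)" by (rule viol_\<iota>[OF that])
    fix i assume i: "viol (\<iota> c) i"
    show "I c \<le> i"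
    proof (rule ccontr)
      assume "\<not> I c \<le> i"
      then have "viol c i" using i by (auto simp: viol_def \<iota>_def)
      then show False using least[OF that] \<open>\<not> I c \<le> i\<close> by blast
    qed
  qed
  have \<iota>_bad: "\<iota> c \<in> ?Bad" if "c \<in> ?Bad" for c
  proof -
    have lt: "I c < k" "Suc (I c) < k" using viol_I[OF that] by (auto simp: viol_def)
    have c: "c \<in> contents {..<k} r" using that by simp
    have "(\<Sum>i<k. int (\<iota> c i)) = (\<Sum>i<k. A i) -
        (\<Sum>i<k. A (transpose (I c) (Suc (I c)) i) - int (c (transpose (I c) (Suc (I c)) i)))"
      unfolding sub[OF that, symmetric] by (simp add: sum_subtractf[symmetric])
    also have "\<dots> = (\<Sum>i<k. A i) - (\<Sum>i<k. A i - int (c i))"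
      using lt sum_compose_permutes[of "transpose (I c) (Suc (I c))" "{..<k}" "\<lambda>i. A i - int (c i)"]
      by (simp add: permutes_swap_id)
    also have "\<dots> = (\<Sum>i<k. int (c i))" by (simp add: sum_subtractf)
    finally have "int (\<Sum>i<k. \<iota> c i) = int (\<Sum>i<k. c i)" by (simp only: of_nat_sum)
    then have "(\<Sum>i<k. \<iota> c i) = (\<Sum>i<k. c i)" by (simp only: of_nat_eq_iff)
    then have "\<iota> c \<in> contents {..<k} r" using c lt by (auto simp: contents_def \<iota>_def)
    then show ?thesis using viol_\<iota>[OF that] bad_iff by blast
  qed
  have \<iota>\<iota>: "\<iota> (\<iota> c) = c" if "c \<in> ?Bad" for c
  proof
    fix j
    have "A j - int (\<iota> (\<iota> c) j) = A j - int (c j)"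
      by (simp only: sub[OF \<iota>_bad[OF that]] sub[OF that] I_\<iota>[OF that] transpose_involutory)
    then show "\<iota> (\<iota> c) j = c j" by simp
  qed
  have f_\<iota>: "?f (\<iota> c) = - ?f c" if "c \<in> ?Bad" for c
  proof -
    have "transpose (I c) (Suc (I c)) permutes {..<k}"
      using viol_I[OF that] by (intro permutes_swap_id) (auto simp: viol_def)
    then show ?thesis
      unfolding sub[OF that]
      using pieri_compose[of "transpose (I c) (Suc (I c))" k \<nu> J "\<lambda>j. A j - int (c j)"]
      by (simp add: sign_swap_id)
  qed
  have "sum ?f ?Bad = (\<Sum>c\<in>?Bad. - ?f c)"
    by (rule sum.reindex_bij_witness[of _ \<iota> \<iota>]) (use \<iota>\<iota> \<iota>_bad f_\<iota> in auto)
  then show ?thesis by (simp add: sum_negf)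
qed

lemma pieri_Suc_interlacing:
  assumes "strictly_decreasing k A"
  shows "pieri k \<nu> (Suc J) A =
    (\<Sum>c | c \<in> contents {..<k} (\<nu> J) \<and> interlacing k A c. pieri k \<nu> J (\<lambda>i. A i - int (c i)))"
proof -
  have fin: "finite (contents {..<k} (\<nu> J))" by (simp add: finite_contents)
  have "pieri k \<nu> (Suc J) A =
      (\<Sum>c | c \<in> contents {..<k} (\<nu> J) \<and> interlacing k A c. pieri k \<nu> J (\<lambda>i. A i - int (c i))) +
      (\<Sum>c | c \<in> contents {..<k} (\<nu> J) \<and> \<not> interlacing k A c. pieri k \<nu> J (\<lambda>i. A i - int (c i)))"
    unfolding pieri.simps using fin
    by (subst sum.union_disjoint[symmetric]) (auto intro!: sum.cong)
  then show ?thesis by (simp add: sum_noninterlacing[OF assms])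
qed

lemma strictly_decreasing_interlacing:
  assumes "strictly_decreasing k A" "interlacing k A c"
  shows "strictly_decreasing k (\<lambda>i. A i - int (c i))"
  unfolding strictly_decreasing_def
proof (intro allI impI)
  fix i j assume ij: "i < j" "j < k"
  have "A j - int (c j) \<le> A j" by simp
  also have "A j \<le> A (Suc i)"
    using assms(1) ij by (cases "j = Suc i") (auto simp: strictly_decreasing_def intro!: less_imp_le)
  also have "\<dots> < A i - int (c i)" using assms(2) ij by (auto simp: interlacing_def)
  finally show "A j - int (c j) < A i - int (c i)" .
qed

text \<open>A horizontal strip meets each column at most once, so every factor adds at most one row
  and the first \<open>j\<close> contents lie in the first \<open>j\<close> rows. This is the
  vanishing part of the theory of Kostka numbers: the shape has at most \<open>J\<close> rows and
  the right size, and it dominates \<open>\<nu>\<close>.\<close>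

lemma pieri_nonzero:
  assumes "strictly_decreasing k A" "pieri k \<nu> J A \<noteq> 0" "J \<le> k"
  shows "(\<forall>i<k. - int i \<le> A i) \<and> (\<forall>i<k. J \<le> i \<longrightarrow> A i = - int i) \<and>
    (\<Sum>i<k. A i + int i) = (\<Sum>j<J. int (\<nu> j)) \<and>
    (\<forall>j\<le>J. (\<Sum>j'<j. int (\<nu> j')) \<le> (\<Sum>i<j. A i + int i))"
  using assms
proof (induction J arbitrary: A)
  case 0
  then have "alt_coeff k (\<lambda>i. - A i) \<noteq> 0" by simp
  then obtain w where w: "w permutes {..<k}" "\<And>i. i < k \<Longrightarrow> - A i = int (w i)"
    using alt_coeff_nonzeroE by metis
  have "w i < w j" if "i < j" "j < k" for i j
    using 0(1) that w(2)[of i] w(2)[of j] unfolding strictly_decreasing_def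
    by (metis less_trans neg_less_iff_less of_nat_less_iff)
  then have "w i = i" if "i < k" for i using increasing_permutation_id[OF w(1)] that by blast
  then have "A i = - int i" if "i < k" for i using w(2)[OF that] that by simp
  then show ?case by simp
next
  case (Suc J)
  have "\<exists>c. c \<in> contents {..<k} (\<nu> J) \<and> interlacing k A c \<and> pieri k \<nu> J (\<lambda>i. A i - int (c i)) \<noteq> 0"
    using Suc.prems(2) sum.neutral[of "{c \<in> contents {..<k} (\<nu> J). interlacing k A c}"
        "\<lambda>c. pieri k \<nu> J (\<lambda>i. A i - int (c i))"]
    unfolding pieri_Suc_interlacing[OF Suc.prems(1)] by blast
  then obtain c where c: "c \<in> contents {..<k} (\<nu> J)" "interlacing k A c"
      "pieri k \<nu> J (\<lambda>i. A i - int (c i)) \<noteq> 0" by blast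
  have IH: "(\<forall>i<k. - int i \<le> A i - int (c i)) \<and> (\<forall>i<k. J \<le> i \<longrightarrow> A i - int (c i) = - int i) \<and>
      (\<Sum>i<k. A i - int (c i) + int i) = (\<Sum>j<J. int (\<nu> j)) \<and>
      (\<forall>j\<le>J. (\<Sum>j'<j. int (\<nu> j')) \<le> (\<Sum>i<j. A i - int (c i) + int i))"
    using Suc.IH[OF strictly_decreasing_interlacing[OF Suc.prems(1) c(2)] c(3)] Suc.prems(3) by simp
  have ge: "- int i \<le> A i" if "i < k" for i
    using IH that by (smt (verit) of_nat_0_le_iff)
  \<comment> \<open>Row \<open>i\<close> is squeezed: interlacing puts \<open>A i\<close> below
    \<open>- (i - 1)\<close>, the value of the row above after removal, and \<open>ge\<close> bounds
    it from below by \<open>- i\<close>.\<close>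
  have eq: "A i = - int i" if "i < k" "Suc J \<le> i" for i
  proof -
    obtain i' where i': "i = Suc i'" using \<open>Suc J \<le> i\<close> by (cases i) auto
    have "A i < A i' - int (c i')" using c(2) that i' by (simp add: interlacing_def)
    also have "\<dots> = - int i'" using IH that i' by auto
    finally show ?thesis using ge[OF that(1)] i' by simp
  qed
  have "(\<Sum>i<k. A i + int i) = (\<Sum>i<k. A i - int (c i) + int i) + int (\<Sum>i<k. c i)"
    by (simp add: sum.distrib[symmetric])
  also have "\<dots> = (\<Sum>j<Suc J. int (\<nu> j))" using IH c(1) by (simp add: contents_def)
  finally have total: "(\<Sum>i<k. A i + int i) = (\<Sum>j<Suc J. int (\<nu> j))" .
  have "(\<Sum>j'<j. int (\<nu> j')) \<le> (\<Sum>i<j. A i + int i)" if "j \<le> Suc J" for j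
  proof (cases "j \<le> J")
    case True
    then have "(\<Sum>j'<j. int (\<nu> j')) \<le> (\<Sum>i<j. A i - int (c i) + int i)" using IH by blast
    also have "\<dots> \<le> (\<Sum>i<j. A i + int i)" by (rule sum_mono) simp
    finally show ?thesis .
  next
    case False
    then have j: "j = Suc J" using that by simp
    have "(\<Sum>i<k. A i + int i) = (\<Sum>i<Suc J. A i + int i)"
      by (rule sum.mono_neutral_right) (use Suc.prems(3) eq in auto)
    then show ?thesis using total j by simp
  qed
  then show ?case using ge eq total by blast
qed

lemma partial_sums_eq:
  fixes f g :: "nat \<Rightarrow> int"
  assumes "\<And>j. j \<le> J \<Longrightarrow> (\<Sum>i<j. f i) = (\<Sum>i<j. g i)" "i < J"
  shows "f i = g i"
  using assms(1)[of i] assms(1)[of "Suc i"] assms(2) by simp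

text \<open>The Kostka number of equal shape and content is 1. The induction runs over the shape cut
  off after \<open>J\<close> rows; by dominance the only strip that can contribute is the whole last
  row.\<close>

lemma pieri_eq_1:
  assumes A: "strictly_decreasing k A" "\<And>i. i < k \<Longrightarrow> - int i \<le> A i" and "J \<le> k"
    and \<nu>: "\<And>i. i < k \<Longrightarrow> int (\<nu> i) = A i + int i"
  shows "pieri k \<nu> J (\<lambda>i. if i < J then A i else - int i) = 1"
  using \<open>J \<le> k\<close>
proof (induction J)
  case 0
  show ?case using alt_coeff_perm[of id k "\<lambda>i. int i"] permutes_id[of "{..<k}"] by simp
next
  case (Suc J)
  let ?A = "\<lambda>J i. if i < J then A i else - int i"
  have dec: "strictly_decreasing k (?A (Suc J))"
    unfolding strictly_decreasing_def
  proof (intro allI impI)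
    fix i j assume ij: "i < j" "j < k"
    then have "A j < A i" "- int i \<le> A i" using A by (auto simp: strictly_decreasing_def)
    then show "?A (Suc J) j < ?A (Suc J) i" using ij by auto
  qed
  define c0 where "c0 i = (if i = J then \<nu> J else 0)" for i
  have sub0: "(\<lambda>i. ?A (Suc J) i - int (c0 i)) = ?A J"
    using \<nu>[of J] Suc.prems by (auto simp: c0_def fun_eq_iff less_Suc_eq)
  have c0: "c0 \<in> contents {..<k} (\<nu> J)"
    using Suc.prems by (auto simp: contents_def c0_def)
  have inter: "interlacing k (?A (Suc J)) c0"
    unfolding interlacing_def
  proof (intro allI impI)
    fix i assume i: "Suc i < k"
    have "A (Suc i) < A i" using A(1) i by (simp add: strictly_decreasing_def)
    then show "?A (Suc J) (Suc i) < ?A (Suc J) i - int (c0 i)"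
      using \<nu>[of J] Suc.prems i by (auto simp: c0_def less_Suc_eq)
  qed
  have unique: "c = c0"
    if c: "c \<in> contents {..<k} (\<nu> J)" "interlacing k (?A (Suc J)) c"
      "pieri k \<nu> J (\<lambda>i. ?A (Suc J) i - int (c i)) \<noteq> 0" for c
  proof -
    let ?B = "\<lambda>i. ?A (Suc J) i - int (c i)"
    have B: "(\<forall>i<k. J \<le> i \<longrightarrow> ?B i = - int i)"
        "(\<forall>j\<le>J. (\<Sum>j'<j. int (\<nu> j')) \<le> (\<Sum>i<j. ?B i + int i))"
      using pieri_nonzero[OF strictly_decreasing_interlacing[OF dec c(2)] c(3)] Suc.prems by auto
    \<comment> \<open>Nothing is removed from the first \<open>J\<close> rows: after removal their
      partial sums are at most those of \<open>\<nu>\<close>, and dominance gives the opposite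
      inequality.\<close>
    have "(\<Sum>i<j. ?B i + int i) = (\<Sum>i<j. int (\<nu> i))" if "j \<le> J" for j
    proof (rule antisym)
      show "(\<Sum>i<j. ?B i + int i) \<le> (\<Sum>i<j. int (\<nu> i))"
        using that Suc.prems \<nu> by (intro sum_mono) auto
    qed (use B(2) that in auto)
    then have eq: "?B i + int i = int (\<nu> i)" if "i < J" for i
      using partial_sums_eq[of J "\<lambda>i. ?B i + int i" "\<lambda>i. int (\<nu> i)" i] that by blast
    show "c = c0"
    proof
      fix i
      show "c i = c0 i"
      proof (cases "i < k")
        case True
        show ?thesis
        proof (cases "i < J")
          case True
          then have "A i - int (c i) + int i = A i + int i"
            using eq[OF True] \<nu>[OF \<open>i < k\<close>] by simp
          then show ?thesis using True by (simp add: c0_def)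
        next
          case False
          then have Bi: "?B i = - int i" using B(1) \<open>i < k\<close> by simp
          show ?thesis
          proof (cases "i = J")
            case True
            then have "A i - int (c i) = - int i" using Bi by simp
            then show ?thesis using \<nu>[OF \<open>i < k\<close>] True by (simp add: c0_def)
          next
            case neq: False
            then show ?thesis using Bi False by (simp add: c0_def)
          qed
        qed
      next
        case False
        then show ?thesis using c(1) Suc.prems by (auto simp: contents_def c0_def)
      qed
    qed
  qed
  have "pieri k \<nu> (Suc J) (?A (Suc J)) =
      (\<Sum>c\<in>{c0}. pieri k \<nu> J (\<lambda>i. ?A (Suc J) i - int (c i)))"
    unfolding pieri_Suc_interlacing[OF dec]
  proof (rule sum.mono_neutral_right)
    show "finite {c \<in> contents {..<k} (\<nu> J). interlacing k (?A (Suc J)) c}"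
      by (rule finite_subset[OF _ finite_contents[of "{..<k}" "\<nu> J"]]) auto
  qed (use unique c0 inter in blast)+
  then show ?case using Suc sub0 by simp
qed

text \<open>The \<open>J\<close> columns of the matrix \<open>N\<close> are peeled off by the recursion of \<^const>\<open>pieri\<close>.\<close>

lemma pieri_eq_matrix_sum:
  "pieri k \<nu> J A = (\<Sum>N\<in>(\<Pi>\<^sub>E j\<in>{..<J}. contents {..<k} (\<nu> j)).
     alt_coeff k (\<lambda>i. (\<Sum>j<J. int (N j i)) - A i))"
proof (induction J arbitrary: A)
  case (Suc J)
  let ?P = "\<lambda>J. \<Pi>\<^sub>E j\<in>{..<J}. contents {..<k} (\<nu> j)"
  have "pieri k \<nu> (Suc J) A = (\<Sum>(c, N)\<in>contents {..<k} (\<nu> J) \<times> ?P J.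
      alt_coeff k (\<lambda>i. (\<Sum>j<J. int (N j i)) - (A i - int (c i))))"
    by (simp add: Suc.IH sum.cartesian_product)
  also have "\<dots> = (\<Sum>N\<in>?P (Suc J). alt_coeff k (\<lambda>i. (\<Sum>j<Suc J. int (N j i)) - A i))"
  proof (rule sum.reindex_bij_witness[of _ "\<lambda>N. (N J, restrict N {..<J})" "\<lambda>(c, N). N(J := c)"])
    fix p assume p: "p \<in> contents {..<k} (\<nu> J) \<times> ?P J"
    obtain c N where cN: "p = (c, N)" by force
    have N: "N \<in> ?P J" "c \<in> contents {..<k} (\<nu> J)" using p cN by auto
    have "restrict (N(J := c)) {..<J} = N"
      using N(1) by (auto simp: fun_eq_iff PiE_iff extensional_def)
    then show "((case p of (c, N) \<Rightarrow> N(J := c)) J, restrict (case p of (c, N) \<Rightarrow> N(J := c)) {..<J}) = p"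
      by (simp add: cN)
    show "(case p of (c, N) \<Rightarrow> N(J := c)) \<in> ?P (Suc J)"
      using N by (auto simp: cN PiE_iff extensional_def less_Suc_eq)
    show "alt_coeff k (\<lambda>i. (\<Sum>j<Suc J. int ((case p of (c, N) \<Rightarrow> N(J := c)) j i)) - A i) =
        (case p of (c, N) \<Rightarrow> alt_coeff k (\<lambda>i. (\<Sum>j<J. int (N j i)) - (A i - int (c i))))"
      by (simp add: cN algebra_simps)
  next
    fix N assume N: "N \<in> ?P (Suc J)"
    show "(case (N J, restrict N {..<J}) of (c, N) \<Rightarrow> N(J := c)) = N"
      using N by (auto simp: fun_eq_iff PiE_iff extensional_def)
    show "(N J, restrict N {..<J}) \<in> contents {..<k} (\<nu> J) \<times> ?P J"
      using N by (auto simp: PiE_iff)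
  qed
  finally show ?case .
qed simp

text \<open>The link between two views of a matrix: as the content of a colouring by pairs, and as
  the list of its columns in the recursion of \<open>pieri\<close>.\<close>

lemma matrix_sum_by_columns:
  assumes "(\<Sum>j<k. \<nu> j) = n"
  shows "(\<Sum>N | N \<in> contents ({..<k} \<times> {..<k}) n \<and> (\<forall>j<k. (\<Sum>i<k. N (i, j)) = \<nu> j).
      alt_coeff k (\<lambda>i. int (\<Sum>j<k. N (i, j)) - A i)) = pieri k \<nu> k A"
  unfolding pieri_eq_matrix_sum
proof (rule sum.reindex_bij_witness[of _
      "\<lambda>M (i, j). if j < k then M j i else 0" "\<lambda>N. restrict (\<lambda>j i. N (i, j)) {..<k}"])
  fix N assume N: "N \<in> {N \<in> contents ({..<k} \<times> {..<k}) n. \<forall>j<k. (\<Sum>i<k. N (i, j)) = \<nu> j}"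
  then have out: "N (i, j) = 0" if "\<not> (i < k \<and> j < k)" for i j
    using that by (auto simp: contents_def)
  show "(\<lambda>(i, j). if j < k then restrict (\<lambda>j i. N (i, j)) {..<k} j i else 0) = N"
    using out by (auto simp: fun_eq_iff)
  show "restrict (\<lambda>j i. N (i, j)) {..<k} \<in> (\<Pi>\<^sub>E j\<in>{..<k}. contents {..<k} (\<nu> j))"
    using N out by (auto simp: contents_def)
  show "alt_coeff k (\<lambda>i. (\<Sum>j<k. int (restrict (\<lambda>j i. N (i, j)) {..<k} j i)) - A i) =
      alt_coeff k (\<lambda>i. int (\<Sum>j<k. N (i, j)) - A i)"
    by simp
next
  fix M assume M: "M \<in> (\<Pi>\<^sub>E j\<in>{..<k}. contents {..<k} (\<nu> j))"
  have Mj: "M j i = 0" if "j < k" "\<not> i < k" for i j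
    using PiE_mem[OF M, of j] that by (auto simp: contents_def)
  have col: "(\<Sum>i<k. M j i) = \<nu> j" if "j < k" for j
    using PiE_mem[OF M, of j] that by (auto simp: contents_def)
  show "restrict (\<lambda>j i. (\<lambda>(i, j). if j < k then M j i else 0) (i, j)) {..<k} = M"
    using M by (auto simp: fun_eq_iff PiE_iff extensional_def)
  have "(\<Sum>p\<in>{..<k} \<times> {..<k}. (\<lambda>(i, j). if j < k then M j i else 0) p) = (\<Sum>j<k. \<Sum>i<k. M j i)"
    by (subst sum.swap) (simp add: sum.cartesian_product[symmetric])
  then show "(\<lambda>(i, j). if j < k then M j i else 0)
      \<in> {N \<in> contents ({..<k} \<times> {..<k}) n. \<forall>j<k. (\<Sum>i<k. N (i, j)) = \<nu> j}"
    using Mj col assms by (auto simp: contents_def)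
qed

text \<open>On the indices below \<open>k\<close> these are the vectors
  \<open>\<kappa> i - i\<close> of the partitions \<open>\<kappa>\<close> of \<open>n\<close> with
  at most \<open>k\<close> rows.\<close>

definition strict_shape :: "nat \<Rightarrow> nat \<Rightarrow> (nat \<Rightarrow> int) \<Rightarrow> bool"
  where "strict_shape k n A \<longleftrightarrow> strictly_decreasing k A \<and> (\<forall>i<k. - int i \<le> A i) \<and>
    (\<Sum>i<k. A i + int i) = int n"

text \<open>Pairs of fixed colourings are fixed colourings by pairs, so orbit counting leaves a
  signed sum over \<open>k\<close> by \<open>k\<close> matrices. Expanding the sign that belongs to
  the column sums yields Kostka numbers with contents \<open>A j + u j\<close>; dominance kills all
  of them except the one for \<open>u = id\<close>, which is 1.\<close>

lemma sum_frob_frob: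
  assumes A: "strict_shape k (card S) A" and S: "finite S"
  shows "(\<Sum>\<sigma> | \<sigma> permutes S. frob k S A \<sigma> * frob k S A \<sigma>) = fact (card S)"
proof -
  let ?X = "{..<k} \<times> {..<k}" and ?n = "card S"
  define row where "row N i = (\<Sum>j<k. N (i, j))" for N :: "nat \<times> nat \<Rightarrow> nat" and i
  define col where "col N j = (\<Sum>i<k. N (i, j))" for N :: "nat \<times> nat \<Rightarrow> nat" and j
  define \<phi> where "\<phi> N = alt_coeff k (\<lambda>i. int (row N i) - A i) * alt_coeff k (\<lambda>j. int (col N j) - A j)" for N
  have row: "row (cnt S F) i = cnt S (fst \<circ> F) i" if "F \<in> fixed_colorings ?X S \<sigma>" "i < k" for F i \<sigma>
  proof -
    have "{s \<in> S. fst (F s) = i} = (\<Union>j<k. {s \<in> S. F s = (i, j)})"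
      using that by (fastforce simp: fixed_colorings_def PiE_iff)
    then show ?thesis
      unfolding row_def cnt_def comp_def using S by (simp add: card_UN_disjoint disjoint_iff)
  qed
  have col: "col (cnt S F) j = cnt S (snd \<circ> F) j" if "F \<in> fixed_colorings ?X S \<sigma>" "j < k" for F j \<sigma>
  proof -
    have "{s \<in> S. snd (F s) = j} = (\<Union>i<k. {s \<in> S. F s = (i, j)})"
      using that by (fastforce simp: fixed_colorings_def PiE_iff)
    then show ?thesis
      unfolding col_def cnt_def comp_def using S by (simp add: card_UN_disjoint disjoint_iff)
  qed
  have "frob k S A \<sigma> * frob k S A \<sigma> = (\<Sum>F\<in>fixed_colorings ?X S \<sigma>. \<phi> (cnt S F))"
    if \<sigma>: "\<sigma> permutes S" for \<sigma>
  proof -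
    have \<sigma>S: "\<sigma> s \<in> S" if "s \<in> S" for s using that permutes_in_image[OF \<sigma>] by simp
    have "frob k S A \<sigma> * frob k S A \<sigma> =
        (\<Sum>(f, g)\<in>fixed_colorings {..<k} S \<sigma> \<times> fixed_colorings {..<k} S \<sigma>.
          alt_coeff k (\<lambda>i. int (cnt S f i) - A i) * alt_coeff k (\<lambda>i. int (cnt S g i) - A i))"
      by (simp add: frob_def sum_product sum.cartesian_product)
    also have "\<dots> = (\<Sum>F\<in>fixed_colorings ?X S \<sigma>. \<phi> (cnt S F))"
    proof (rule sum.reindex_bij_witness[of _
          "\<lambda>F. (restrict (fst \<circ> F) S, restrict (snd \<circ> F) S)" "\<lambda>(f, g). restrict (\<lambda>s. (f s, g s)) S"])
      fix p assume p: "p \<in> fixed_colorings {..<k} S \<sigma> \<times> fixed_colorings {..<k} S \<sigma>"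
      obtain f g where fg: "p = (f, g)" by force
      let ?F = "restrict (\<lambda>s. (f s, g s)) S"
      have restr: "restrict (fst \<circ> ?F) S = f" "restrict (snd \<circ> ?F) S = g"
        using p by (auto simp: fg fixed_colorings_def fun_eq_iff PiE_iff extensional_def)
      then show "(restrict (fst \<circ> (case p of (f, g) \<Rightarrow> restrict (\<lambda>s. (f s, g s)) S)) S,
          restrict (snd \<circ> (case p of (f, g) \<Rightarrow> restrict (\<lambda>s. (f s, g s)) S)) S) = p"
        by (simp add: fg)
      have F: "?F \<in> fixed_colorings ?X S \<sigma>"
        using p \<sigma>S by (auto simp: fg fixed_colorings_def PiE_iff)
      then show "(case p of (f, g) \<Rightarrow> restrict (\<lambda>s. (f s, g s)) S) \<in> fixed_colorings ?X S \<sigma>"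
        by (simp add: fg)
      have "row (cnt S ?F) i = cnt S f i" "col (cnt S ?F) i = cnt S g i" if "i < k" for i
        unfolding row[OF F that] col[OF F that] by (auto intro: cnt_cong)
      then show "\<phi> (cnt S (case p of (f, g) \<Rightarrow> restrict (\<lambda>s. (f s, g s)) S)) =
          (case p of (f, g) \<Rightarrow> alt_coeff k (\<lambda>i. int (cnt S f i) - A i) * alt_coeff k (\<lambda>i. int (cnt S g i) - A i))"
        by (simp add: fg \<phi>_def cong: alt_coeff_cong)
    next
      fix F assume F: "F \<in> fixed_colorings ?X S \<sigma>"
      show "(case (restrict (fst \<circ> F) S, restrict (snd \<circ> F) S) of (f, g) \<Rightarrow> restrict (\<lambda>s. (f s, g s)) S) = F"
        using F by (auto simp: fixed_colorings_def fun_eq_iff PiE_iff extensional_def)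
      show "(restrict (fst \<circ> F) S, restrict (snd \<circ> F) S)
          \<in> fixed_colorings {..<k} S \<sigma> \<times> fixed_colorings {..<k} S \<sigma>"
        using F \<sigma>S by (fastforce simp: fixed_colorings_def PiE_iff)
    qed
    finally show ?thesis .
  qed
  then have "(\<Sum>\<sigma> | \<sigma> permutes S. frob k S A \<sigma> * frob k S A \<sigma>) =
      fact ?n * (\<Sum>N\<in>contents ?X ?n. \<phi> N)"
    using sum_fixed_colorings[OF S, of ?X \<phi>] by simp
  also have "(\<Sum>N\<in>contents ?X ?n. \<phi> N) = 1"
  proof -
    let ?a = "\<lambda>N. alt_coeff k (\<lambda>i. int (row N i) - A i)"
    have fin: "finite (contents ?X ?n)" by (simp add: finite_contents)
    have dec: "strictly_decreasing k A" and ge: "\<And>i. i < k \<Longrightarrow> - int i \<le> A i"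
      and total: "(\<Sum>i<k. A i + int i) = int ?n"
      using A by (auto simp: strict_shape_def)
    have "(\<Sum>N\<in>contents ?X ?n. \<phi> N) = (\<Sum>N\<in>contents ?X ?n. \<Sum>u | u permutes {..<k}.
        if \<forall>j<k. int (col N j) = A j + int (u j) then sign u * ?a N else 0)"
      unfolding \<phi>_def alt_coeff_def[of k "\<lambda>j. int (col _ j) - A j"] sum_distrib_left
      by (intro sum.cong refl) (auto simp: algebra_simps)
    also have "\<dots> = (\<Sum>u | u permutes {..<k}. \<Sum>N\<in>contents ?X ?n.
        if \<forall>j<k. int (col N j) = A j + int (u j) then sign u * ?a N else 0)"
      by (rule sum.swap)
    also have "\<dots> = (\<Sum>u | u permutes {..<k}. if u = id then 1 else 0)"
    proof (rule sum.cong[OF refl])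
      fix u assume "u \<in> {u. u permutes {..<k}}"
      then have u: "u permutes {..<k}" by simp
      \<comment> \<open>The column sums prescribed by \<open>u\<close>. If one of them is negative,
        \<open>nat\<close> distorts it, but then no matrix has these column sums and the term is
        zero anyway.\<close>
      define \<nu> where "\<nu> j = nat (A j + int (u j))" for j
      have eq: "(\<Sum>N\<in>contents ?X ?n. if \<forall>j<k. int (col N j) = A j + int (u j) then sign u * ?a N else 0) =
          sign u * pieri k \<nu> k A" if nonneg: "\<And>j. j < k \<Longrightarrow> 0 \<le> A j + int (u j)"
      proof -
        have \<nu>: "int (\<nu> j) = A j + int (u j)" if "j < k" for j using nonneg[OF that] by (simp add: \<nu>_def)
        have "int (\<Sum>j<k. \<nu> j) = (\<Sum>j<k. A j) + (\<Sum>j<k. int (u j))" by (simp add: \<nu> sum.distrib)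
        also have "\<dots> = int ?n"
          using total sum_compose_permutes[OF u, of int] by (simp add: sum.distrib)
        finally have sum\<nu>: "(\<Sum>j<k. \<nu> j) = ?n" by linarith
        have "(\<Sum>N\<in>contents ?X ?n. if \<forall>j<k. int (col N j) = A j + int (u j) then sign u * ?a N else 0) =
            (\<Sum>N | N \<in> contents ?X ?n \<and> (\<forall>j<k. (\<Sum>i<k. N (i, j)) = \<nu> j). sign u * ?a N)"
        proof -
          have "int (col N j) = A j + int (u j) \<longleftrightarrow> (\<Sum>i<k. N (i, j)) = \<nu> j" if "j < k" for N j
            using \<nu>[OF that] unfolding col_def by linarith
          then have "(\<forall>j<k. int (col N j) = A j + int (u j)) \<longleftrightarrow> (\<forall>j<k. (\<Sum>i<k. N (i, j)) = \<nu> j)" for N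
            by blast
          then show ?thesis by (simp only: sum.inter_filter[OF fin])
        qed
        also have "\<dots> = sign u * pieri k \<nu> k A"
          unfolding sum_distrib_left[symmetric] row_def matrix_sum_by_columns[OF sum\<nu>, symmetric] ..
        finally show ?thesis .
      qed
      show "(\<Sum>N\<in>contents ?X ?n. if \<forall>j<k. int (col N j) = A j + int (u j) then sign u * ?a N else 0) =
          (if u = id then 1 else 0)"
      proof (cases "u = id")
        case True
        have "int (\<nu> i) = A i + int i" if "i < k" for i using ge[OF that] True by (simp add: \<nu>_def)
        then have "pieri k \<nu> k (\<lambda>i. if i < k then A i else - int i) = 1"
          by (intro pieri_eq_1[OF dec ge]) auto
        moreover have "pieri k \<nu> k (\<lambda>i. if i < k then A i else - int i) = pieri k \<nu> k A"
          unfolding pieri_eq_matrix_sum by (intro sum.cong refl alt_coeff_cong) simp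
        ultimately show ?thesis using eq ge True by (fastforce simp: sign_id)
      next
        case False
        show ?thesis
        proof (cases "\<forall>j<k. 0 \<le> A j + int (u j)")
          case True
          have \<nu>: "int (\<nu> j) = A j + int (u j)" if "j < k" for j using True that by (simp add: \<nu>_def)
          \<comment> \<open>A nonzero value would bound the partial sums of \<open>A j + u j\<close>
            by those of \<open>A j + j\<close>, which forces \<open>u\<close> to be the
            identity.\<close>
          have "pieri k \<nu> k A = 0"
          proof (rule ccontr)
            assume "pieri k \<nu> k A \<noteq> 0"
            from pieri_nonzero[OF dec this order_refl]
            have dom: "\<forall>j\<le>k. (\<Sum>j'<j. int (\<nu> j')) \<le> (\<Sum>i<j. A i + int i)" by blast
            have "(\<Sum>i<j. u i) \<le> (\<Sum>i<j. i)" if "j \<le> k" for j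
            proof -
              have "(\<Sum>i<j. int (\<nu> i)) = (\<Sum>i<j. A i + int (u i))"
                using that \<nu> by (intro sum.cong refl) auto
              then have "(\<Sum>i<j. int (u i)) \<le> (\<Sum>i<j. int i)"
                using dom that by (auto simp: sum.distrib)
              then have "int (\<Sum>i<j. u i) \<le> int (\<Sum>i<j. i)" by (simp only: of_nat_sum)
              then show ?thesis by (simp only: of_nat_le_iff)
            qed
            then have "u i = i" for i
              using dominated_permutation_id[OF u] permutes_not_in[OF u] by (cases "i < k") auto
            then show False using False by auto
          qed
          then show ?thesis using eq True False by simp
        next
          case neg: False
          then have "\<not> (\<forall>j<k. int (col N j) = A j + int (u j))" for N
            by (metis of_nat_0_le_iff)
          then show ?thesis using False by (simp only: if_False sum.neutral_const)
        qed
      qed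
    qed
    also have "\<dots> = 1" by (simp add: finite_permutations permutes_id)
    finally show ?thesis .
  qed
  finally show ?thesis by simp
qed

section \<open>Young symmetrizers\<close>

context primitive_idempotent
begin

lemma conj_sum_conj:
  assumes "h \<in> carrier G" "x \<in> carrier G"
  shows "conj_sum G a (h \<otimes> x \<otimes> inv h) = conj_sum G a x"
proof -
  have "conj_sum G a (h \<otimes> x \<otimes> inv h) = (\<Sum>g\<in>carrier G. a ((g \<otimes> h) \<otimes> x \<otimes> inv (g \<otimes> h)))"
    unfolding conj_sum_def using assms by (intro sum.cong refl) (simp add: inv_mult_group m_assoc)
  also have "\<dots> = conj_sum G a x" unfolding conj_sum_def by (rule sum_right_translate[OF assms(1)])
  finally show ?thesis .
qed

text \<open>A class function does not distinguish the conjugates over which \<open>conj_sum\<close>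
  runs, so an inner product of characters reduces to a pairing with \<open>a\<close> itself.\<close>

lemma sum_conj_sum_mult:
  assumes "\<And>h x. h \<in> carrier G \<Longrightarrow> x \<in> carrier G \<Longrightarrow> \<chi> (h \<otimes> x \<otimes> inv h) = \<chi> x"
  shows "(\<Sum>x\<in>carrier G. conj_sum G a x * \<chi> x) =
    of_nat (card (carrier G)) * (\<Sum>x\<in>carrier G. a x * \<chi> x)"
proof -
  have "(\<Sum>x\<in>carrier G. conj_sum G a x * \<chi> x) =
      (\<Sum>g\<in>carrier G. \<Sum>x\<in>carrier G. a (g \<otimes> x \<otimes> inv g) * \<chi> (g \<otimes> x \<otimes> inv g))"
    unfolding conj_sum_def sum_distrib_right using assms by (subst sum.swap) (intro sum.cong refl, simp)
  also have "\<dots> = (\<Sum>g\<in>carrier G. \<Sum>x\<in>carrier G. a x * \<chi> x)"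
  proof (rule sum.cong[OF refl])
    fix g assume g: "g \<in> carrier G"
    show "(\<Sum>x\<in>carrier G. a (g \<otimes> x \<otimes> inv g) * \<chi> (g \<otimes> x \<otimes> inv g)) = (\<Sum>x\<in>carrier G. a x * \<chi> x)"
      using sum_left_translate[OF g, of "\<lambda>y. a (y \<otimes> inv g) * \<chi> (y \<otimes> inv g)"]
        sum_right_translate[of "inv g" "\<lambda>y. a y * \<chi> y"] g by simp
  qed
  finally show ?thesis by simp
qed

text \<open>With \<open>e h e = \<lambda>(h) e\<close> the sum equals \<open>\<Sum>\<^sub>h \<lambda>(h) e(h)\<close>, and \<open>e = e e e = (\<Sum>\<^sub>h \<lambda>(h) e(h)) e\<close>.\<close>

lemma sum_e_conj_sum_inv: "(\<Sum>g\<in>carrier G. e g * conj_sum G e (inv g)) = 1"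
proof -
  have "\<exists>c. convolution G e (ideal_frame h) = cscale c e" if "h \<in> carrier G" for h
    using prim[of "ideal_frame h"] frame_mem[OF frame_ideal that] by (auto simp: rspace_ideal)
  then obtain c where c: "\<And>h. h \<in> carrier G \<Longrightarrow> convolution G e (ideal_frame h) = cscale (c h) e"
    by metis
  have conv: "c h * e x = (\<Sum>u\<in>carrier G. e u * e (inv h \<otimes> (inv u \<otimes> x)))"
    if "h \<in> carrier G" "x \<in> carrier G" for h x
    using fun_cong[OF c[OF that(1)], of x] that by (simp add: convolution_def ideal_frame_def)
  have "(\<Sum>h\<in>carrier G. c h * e h) = (\<Sum>h\<in>carrier G. \<Sum>u\<in>carrier G. e u * e (inv h \<otimes> inv u \<otimes> inv (inv h)))"
    by (intro sum.cong refl) (simp add: conv m_assoc)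
  also have "\<dots> = (\<Sum>u\<in>carrier G. \<Sum>h\<in>carrier G. e u * e (inv h \<otimes> inv u \<otimes> inv (inv h)))"
    by (rule sum.swap)
  also have "\<dots> = (\<Sum>u\<in>carrier G. e u * conj_sum G e (inv u))"
    unfolding conj_sum_def sum_distrib_left[symmetric] by (intro sum.cong refl arg_cong2[of _ _ _ _ "(*)"] sum_inverse)
  finally have eq: "(\<Sum>u\<in>carrier G. e u * conj_sum G e (inv u)) = (\<Sum>h\<in>carrier G. c h * e h)" ..
  obtain x where x: "x \<in> carrier G" "e x \<noteq> 0"
    using e_nonzero e_alg by (auto simp: group_algebra_def fun_eq_iff)
  have "(\<Sum>h\<in>carrier G. c h * e h) * e x = (\<Sum>h\<in>carrier G. e h * (c h * e x))"
    unfolding sum_distrib_right by (intro sum.cong refl) (simp only: mult_ac)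
  also have "\<dots> = (\<Sum>h\<in>carrier G. \<Sum>u\<in>carrier G. e h * (e u * e (inv h \<otimes> (inv u \<otimes> x))))"
    using x(1) by (intro sum.cong refl) (simp only: conv sum_distrib_left)
  also have "\<dots> = (\<Sum>u\<in>carrier G. \<Sum>h\<in>carrier G. e u * (e h * e (inv h \<otimes> (inv u \<otimes> x))))"
    by (subst sum.swap) (simp only: mult.left_commute)
  also have "\<dots> = convolution G e (convolution G e e) x"
    using x(1) by (simp add: convolution_def sum_distrib_left)
  also have "\<dots> = e x" by (simp only: idem)
  finally show ?thesis using x(2) eq by simp
qed

lemma sum_conj_sum_conj_sum_inv:
  "(\<Sum>x\<in>carrier G. conj_sum G e x * conj_sum G e (inv x)) = of_nat (card (carrier G))"
proof -
  have "conj_sum G e (inv (h \<otimes> x \<otimes> inv h)) = conj_sum G e (inv x)"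
    if "h \<in> carrier G" "x \<in> carrier G" for h x
    using conj_sum_conj[OF that(1), of "inv x" e] that by (simp add: inv_mult_group m_assoc)
  then show ?thesis
    using sum_conj_sum_mult[of "\<lambda>x. conj_sum G e (inv x)" e] sum_e_conj_sum_inv by simp
qed

end

section \<open>The algebra of Young symmetrizers\<close>

text \<open>\<open>R\<close> and \<open>C\<close> stand for the row and the column group and
  \<open>s\<close> for the sign. The assumption \<open>separated\<close> is the combinatorial input
  of von Neumann's lemma: for \<open>g\<close> outside \<open>R C\<close> some element of the row
  group becomes, conjugated by \<open>g\<close>, an odd element of the column group.\<close>

locale young_pair = fin_group +
  fixes R C :: "'g set" and s :: "'g \<Rightarrow> complex"
  assumes subR: "subgroup R G" and subC: "subgroup C G"
    and s_mult: "p \<in> C \<Longrightarrow> q \<in> C \<Longrightarrow> s (p \<otimes> q) = s p * s q"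
    and s_sign: "q \<in> C \<Longrightarrow> s q = 1 \<or> s q = - 1"
    and disj: "R \<inter> C = {\<one>}"
    and separated: "g \<in> carrier G \<Longrightarrow> (\<nexists>p q. p \<in> R \<and> q \<in> C \<and> g = p \<otimes> q) \<Longrightarrow>
      \<exists>t\<in>R. inv g \<otimes> t \<otimes> g \<in> C \<and> s (inv g \<otimes> t \<otimes> g) = - 1"
begin

definition row_sum :: "'g \<Rightarrow> complex" where "row_sum = (\<lambda>p. if p \<in> R then 1 else 0)"

definition column_sum :: "'g \<Rightarrow> complex" where "column_sum = (\<lambda>q. if q \<in> C then s q else 0)"

definition symmetrizer :: "'g \<Rightarrow> complex" where "symmetrizer = convolution G row_sum column_sum"

lemma R_closed: "p \<in> R \<Longrightarrow> p \<in> carrier G" "p \<in> R \<Longrightarrow> q \<in> R \<Longrightarrow> p \<otimes> q \<in> R" "p \<in> R \<Longrightarrow> inv p \<in> R" "\<one> \<in> R"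
  using subR by (auto simp: subgroup.mem_carrier subgroup.m_closed subgroup.m_inv_closed subgroup.one_closed)

lemma C_closed: "p \<in> C \<Longrightarrow> p \<in> carrier G" "p \<in> C \<Longrightarrow> q \<in> C \<Longrightarrow> p \<otimes> q \<in> C" "p \<in> C \<Longrightarrow> inv p \<in> C" "\<one> \<in> C"
  using subC by (auto simp: subgroup.mem_carrier subgroup.m_closed subgroup.m_inv_closed subgroup.one_closed)

lemma s_one: "s \<one> = 1"
  using s_mult[of \<one> \<one>] s_sign[of \<one>] C_closed(4) by auto

lemma s_inv: "q \<in> C \<Longrightarrow> s (inv q) = s q"
  using s_mult[of q "inv q"] s_sign[of q] s_sign[of "inv q"] C_closed s_one by auto

lemma s_square: "q \<in> C \<Longrightarrow> s q * s q = 1"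
  using s_sign[of q] by auto

lemma R_absorb: "p \<in> R \<Longrightarrow> g \<in> carrier G \<Longrightarrow> p \<otimes> g \<in> R \<longleftrightarrow> g \<in> R"
  "p \<in> R \<Longrightarrow> g \<in> carrier G \<Longrightarrow> g \<otimes> p \<in> R \<longleftrightarrow> g \<in> R"
proof -
  show "p \<otimes> g \<in> R \<longleftrightarrow> g \<in> R" if "p \<in> R" "g \<in> carrier G"
    using R_closed(2)[OF R_closed(3)[OF that(1)], of "p \<otimes> g"] R_closed(2)[OF that(1)] R_closed(1)[OF that(1)] that(2)
    by (auto simp: m_assoc[symmetric])
  show "g \<otimes> p \<in> R \<longleftrightarrow> g \<in> R" if "p \<in> R" "g \<in> carrier G"
    using R_closed(2)[OF _ R_closed(3)[OF that(1)], of "g \<otimes> p"] R_closed(2)[OF _ that(1)] R_closed(1)[OF that(1)] that(2)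
    by (auto simp: m_assoc)
qed

lemma C_absorb: "p \<in> C \<Longrightarrow> g \<in> carrier G \<Longrightarrow> p \<otimes> g \<in> C \<longleftrightarrow> g \<in> C"
  "p \<in> C \<Longrightarrow> g \<in> carrier G \<Longrightarrow> g \<otimes> p \<in> C \<longleftrightarrow> g \<in> C"
proof -
  show "p \<otimes> g \<in> C \<longleftrightarrow> g \<in> C" if "p \<in> C" "g \<in> carrier G"
    using C_closed(2)[OF C_closed(3)[OF that(1)], of "p \<otimes> g"] C_closed(2)[OF that(1)] C_closed(1)[OF that(1)] that(2)
    by (auto simp: m_assoc[symmetric])
  show "g \<otimes> p \<in> C \<longleftrightarrow> g \<in> C" if "p \<in> C" "g \<in> carrier G"
    using C_closed(2)[OF _ C_closed(3)[OF that(1)], of "g \<otimes> p"] C_closed(2)[OF _ that(1)] C_closed(1)[OF that(1)] that(2)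
    by (auto simp: m_assoc)
qed

lemma row_sum_left: "p \<in> R \<Longrightarrow> g \<in> carrier G \<Longrightarrow> row_sum (p \<otimes> g) = row_sum g"
  by (simp add: row_sum_def R_absorb)

lemma column_sum_right: "q \<in> C \<Longrightarrow> g \<in> carrier G \<Longrightarrow> column_sum (g \<otimes> q) = s q * column_sum g"
  by (simp add: column_sum_def C_absorb s_mult)

lemma convolution_left_inv:
  assumes "\<And>g. g \<in> carrier G \<Longrightarrow> a (p \<otimes> g) = a g" "p \<in> carrier G" "g \<in> carrier G"
  shows "convolution G a b (p \<otimes> g) = convolution G a b g"
proof -
  have "convolution G a b (p \<otimes> g) = (\<Sum>h\<in>carrier G. a (p \<otimes> h) * b (inv (p \<otimes> h) \<otimes> (p \<otimes> g)))"
    using assms(2,3) by (simp add: convolution_def sum_left_translate[OF assms(2), of "\<lambda>h. a h * b (inv h \<otimes> (p \<otimes> g))"])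
  also have "\<dots> = (\<Sum>h\<in>carrier G. a h * b (inv h \<otimes> g))"
  proof (rule sum.cong[OF refl])
    fix h assume h: "h \<in> carrier G"
    have "inv (p \<otimes> h) \<otimes> (p \<otimes> g) = inv h \<otimes> (inv p \<otimes> (p \<otimes> g))"
      using h assms(2,3) by (simp add: inv_mult_group m_assoc)
    also have "inv p \<otimes> (p \<otimes> g) = g" using assms(2,3) by (simp add: m_assoc[symmetric])
    finally show "a (p \<otimes> h) * b (inv (p \<otimes> h) \<otimes> (p \<otimes> g)) = a h * b (inv h \<otimes> g)"
      using assms(1)[OF h] by simp
  qed
  finally show ?thesis using assms(3) by (simp add: convolution_def)
qed

lemma convolution_right_inv:
  assumes "\<And>g. g \<in> carrier G \<Longrightarrow> b (g \<otimes> q) = r * b g" "q \<in> carrier G" "g \<in> carrier G"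
  shows "convolution G a b (g \<otimes> q) = r * convolution G a b g"
proof -
  have "b (inv h \<otimes> (g \<otimes> q)) = r * b (inv h \<otimes> g)" if "h \<in> carrier G" for h
    using assms(1)[of "inv h \<otimes> g"] that assms(2,3) by (simp add: m_assoc)
  then show ?thesis using assms(2,3) by (simp add: convolution_def sum_distrib_left mult.left_commute)
qed

lemma symmetrizer_left: "p \<in> R \<Longrightarrow> g \<in> carrier G \<Longrightarrow> symmetrizer (p \<otimes> g) = symmetrizer g"
  unfolding symmetrizer_def by (rule convolution_left_inv) (auto simp: row_sum_left R_closed)

lemma symmetrizer_right: "q \<in> C \<Longrightarrow> g \<in> carrier G \<Longrightarrow> symmetrizer (g \<otimes> q) = s q * symmetrizer g"
  unfolding symmetrizer_def by (rule convolution_right_inv) (auto simp: column_sum_right C_closed)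

lemma sum_R: "(\<Sum>h\<in>carrier G. row_sum h * f h) = (\<Sum>p\<in>R. f p)"
proof -
  have "(\<Sum>h\<in>carrier G. row_sum h * f h) = (\<Sum>h\<in>carrier G. if h \<in> R then f h else 0)"
    by (intro sum.cong) (auto simp: row_sum_def)
  also have "\<dots> = sum f (carrier G \<inter> R)" using finite_G by (rule sum.inter_restrict[symmetric])
  also have "carrier G \<inter> R = R" using R_closed by auto
  finally show ?thesis .
qed

lemma sum_C: "(\<Sum>h\<in>carrier G. column_sum h * f h) = (\<Sum>q\<in>C. s q * f q)"
proof -
  have "(\<Sum>h\<in>carrier G. column_sum h * f h) = (\<Sum>h\<in>carrier G. if h \<in> C then s h * f h else 0)"
    by (intro sum.cong) (auto simp: column_sum_def)
  also have "\<dots> = (\<Sum>q\<in>carrier G \<inter> C. s q * f q)" using finite_G by (rule sum.inter_restrict[symmetric])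
  also have "carrier G \<inter> C = C" using C_closed by auto
  finally show ?thesis .
qed

lemma symmetrizer_one: "symmetrizer \<one> = 1"
proof -
  have "symmetrizer \<one> = (\<Sum>p\<in>R. column_sum (inv p))"
    unfolding symmetrizer_def convolution_def
    using sum_R[of "\<lambda>h. column_sum (inv h \<otimes> \<one>)"] by (simp add: R_closed)
  also have "\<dots> = (\<Sum>p\<in>R. if p = \<one> then 1 else 0)"
  proof (rule sum.cong[OF refl])
    fix p assume p: "p \<in> R"
    have "p = \<one>" if "inv p \<in> C"
    proof -
      have "inv p = \<one>" using that p R_closed(3) disj by blast
      then have "inv (inv p) = \<one>" by (simp only: inv_one)
      then show ?thesis using R_closed(1)[OF p] by (simp only: inv_inv)
    qed
    note one = this
    show "column_sum (inv p) = (if p = \<one> then 1 else 0)"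
    proof (cases "p = \<one>")
      case True
      show ?thesis unfolding True column_sum_def inv_one using C_closed(4) s_one by simp
    next
      case False
      then have "inv p \<notin> C" using one by blast
      then show ?thesis unfolding column_sum_def using False by simp
    qed
  qed
  also have "\<dots> = 1"
  proof -
    have "finite R" using finite_G R_closed(1) by (meson finite_subset subsetI)
    then show ?thesis using R_closed(4) by simp
  qed
  finally show ?thesis .
qed

text \<open>On \<open>R C\<close> the two equivariances determine \<open>x\<close> from its value at
  the identity. Elsewhere the \<open>t\<close> of \<open>separated\<close> satisfies
  \<open>t g = g (inv g t g)\<close>, which gives \<open>x g = - x g\<close>. It follows that the
  symmetrizer is primitive up to a scalar.\<close>

lemma biequivariant_eq:
  assumes x: "x \<in> group_algebra G"
    and left: "\<And>p g. p \<in> R \<Longrightarrow> g \<in> carrier G \<Longrightarrow> x (p \<otimes> g) = x g"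
    and right: "\<And>q g. q \<in> C \<Longrightarrow> g \<in> carrier G \<Longrightarrow> x (g \<otimes> q) = s q * x g"
    and g: "g \<in> carrier G"
  shows "x g = x \<one> * symmetrizer g"
proof (cases "\<exists>p q. p \<in> R \<and> q \<in> C \<and> g = p \<otimes> q")
  case True
  then obtain p q where q: "q \<in> C" "p \<in> R" "g = p \<otimes> q" by blast
  then have "x g = s q * x \<one>"
    using left[of p q] right[of q \<one>] C_closed(1) by simp
  moreover have "symmetrizer g = s q"
    using q symmetrizer_left[of p q] symmetrizer_right[of q \<one>] C_closed(1) by (simp add: symmetrizer_one)
  ultimately show ?thesis by simp
next
  case False
  then obtain t where t: "t \<in> R" "inv g \<otimes> t \<otimes> g \<in> C" "s (inv g \<otimes> t \<otimes> g) = - 1"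
    using separated[OF g] by blast
  have tG: "t \<in> carrier G" using t(1) R_closed(1) by blast
  have tg: "t \<otimes> g = g \<otimes> (inv g \<otimes> t \<otimes> g)" using g tG by (simp add: m_assoc[symmetric])
  have "x g = - x g" using left[OF t(1) g] right[OF t(2) g] t(3) by (simp add: tg)
  moreover have "symmetrizer g = - symmetrizer g"
    using symmetrizer_left[OF t(1) g] symmetrizer_right[OF t(2) g] t(3) by (simp add: tg)
  ultimately show ?thesis by simp
qed

lemma biequivariant_scalar:
  assumes x: "x \<in> group_algebra G"
    and left: "\<And>p g. p \<in> R \<Longrightarrow> g \<in> carrier G \<Longrightarrow> x (p \<otimes> g) = x g"
    and right: "\<And>q g. q \<in> C \<Longrightarrow> g \<in> carrier G \<Longrightarrow> x (g \<otimes> q) = s q * x g"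
  shows "x = cscale (x \<one>) symmetrizer"
proof
  fix g
  show "x g = cscale (x \<one>) symmetrizer g"
  proof (cases "g \<in> carrier G")
    case True
    then show ?thesis using biequivariant_eq[OF x left right True] by simp
  next
    case False
    then show ?thesis using x by (simp add: symmetrizer_def convolution_outside group_algebra_def)
  qed
qed

lemma symmetrizer_sandwich:
  "\<exists>c. convolution G symmetrizer (convolution G x symmetrizer) = cscale c symmetrizer"
proof -
  let ?y = "convolution G symmetrizer (convolution G x symmetrizer)"
  have "?y = cscale (?y \<one>) symmetrizer"
  proof (rule biequivariant_scalar[OF convolution_mem])
    show "?y (p \<otimes> g) = ?y g" if "p \<in> R" "g \<in> carrier G" for p g
      using that by (intro convolution_left_inv symmetrizer_left) (auto simp: R_closed)
    show "?y (g \<otimes> q) = s q * ?y g" if "q \<in> C" "g \<in> carrier G" for q g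
      unfolding convolution_assoc[symmetric]
      using that by (intro convolution_right_inv symmetrizer_right) (auto simp: C_closed)
  qed
  then show ?thesis by blast
qed

text \<open>The scalar in \<open>c c = hook c\<close> for the symmetrizer \<open>c\<close>, read off
  at the identity, where \<open>c\<close> has value 1. For a tableau it is the product of the hook
  lengths.\<close>

definition hook :: complex where "hook = convolution G symmetrizer symmetrizer \<one>"

lemma symmetrizer_square: "convolution G symmetrizer symmetrizer = cscale hook symmetrizer"
  unfolding hook_def
proof (rule biequivariant_scalar[OF convolution_mem])
  show "convolution G symmetrizer symmetrizer (p \<otimes> g) = convolution G symmetrizer symmetrizer g"
    if "p \<in> R" "g \<in> carrier G" for p g
    using that by (intro convolution_left_inv symmetrizer_left) (auto simp: R_closed)
  show "convolution G symmetrizer symmetrizer (g \<otimes> q) = s q * convolution G symmetrizer symmetrizer g"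
    if "q \<in> C" "g \<in> carrier G" for q g
    using that by (intro convolution_right_inv symmetrizer_right) (auto simp: C_closed)
qed

lemma row_sum_square: "convolution G row_sum row_sum = cscale (of_nat (card R)) row_sum"
proof
  fix g
  show "convolution G row_sum row_sum g = cscale (of_nat (card R)) row_sum g"
  proof (cases "g \<in> carrier G")
    case True
    have "convolution G row_sum row_sum g = (\<Sum>p\<in>R. row_sum (inv p \<otimes> g))"
      using True sum_R[of "\<lambda>h. row_sum (inv h \<otimes> g)"] by (simp add: convolution_def)
    also have "\<dots> = (\<Sum>p\<in>R. row_sum g)"
      using True by (intro sum.cong refl row_sum_left R_closed(3))
    finally show ?thesis by simp
  qed (use R_closed(1) in \<open>auto simp: convolution_outside row_sum_def\<close>)
qed

lemma column_sum_left: "q \<in> C \<Longrightarrow> g \<in> carrier G \<Longrightarrow> column_sum (q \<otimes> g) = s q * column_sum g"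
  by (simp add: column_sum_def C_absorb s_mult)

lemma column_sum_square: "convolution G column_sum column_sum = cscale (of_nat (card C)) column_sum"
proof
  fix g
  show "convolution G column_sum column_sum g = cscale (of_nat (card C)) column_sum g"
  proof (cases "g \<in> carrier G")
    case True
    have "convolution G column_sum column_sum g = (\<Sum>q\<in>C. s q * column_sum (inv q \<otimes> g))"
      using True sum_C[of "\<lambda>h. column_sum (inv h \<otimes> g)"] by (simp add: convolution_def)
    also have "\<dots> = (\<Sum>q\<in>C. column_sum g)"
      using True by (intro sum.cong refl)
        (simp add: column_sum_left C_closed(3) s_inv s_square mult.assoc[symmetric])
    finally show ?thesis by simp
  qed (use C_closed(1) in \<open>auto simp: convolution_outside column_sum_def\<close>)
qed

lemma row_sum_inv: "g \<in> carrier G \<Longrightarrow> row_sum (inv g) = row_sum g"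
  using R_closed(3) by (auto simp: row_sum_def) (metis inv_inv)

lemma column_sum_inv: "g \<in> carrier G \<Longrightarrow> column_sum (inv g) = column_sum g"
  using C_closed(3) s_inv by (auto simp: column_sum_def) (metis inv_inv)

text \<open>Inversion reverses products and preserves both factors. As all values are real, the
  adjoint of the symmetrizer is the product in the opposite order.\<close>

lemma symmetrizer_inv:
  assumes "g \<in> carrier G"
  shows "symmetrizer (inv g) = convolution G column_sum row_sum g"
proof -
  have "symmetrizer (inv g) = (\<Sum>h\<in>carrier G. row_sum h * column_sum (inv h \<otimes> inv g))"
    using assms by (simp add: symmetrizer_def convolution_def)
  also have "\<dots> = (\<Sum>h\<in>carrier G. row_sum (inv h) * column_sum (inv (inv h) \<otimes> inv g))"
    by (rule sum_inverse[symmetric])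
  also have "\<dots> = (\<Sum>h\<in>carrier G. column_sum (g \<otimes> inv h) * row_sum h)"
  proof (rule sum.cong[OF refl])
    fix h assume h: "h \<in> carrier G"
    have "inv (inv h) \<otimes> inv g = inv (g \<otimes> inv h)" using h assms by (simp add: inv_mult_group)
    then show "row_sum (inv h) * column_sum (inv (inv h) \<otimes> inv g) = column_sum (g \<otimes> inv h) * row_sum h"
      using h assms by (simp only: row_sum_inv column_sum_inv inv_closed m_closed mult.commute)
  qed
  also have "\<dots> = convolution G column_sum row_sum g"
    using assms by (simp add: convolution_def convolution_expand)
  finally show ?thesis .
qed

lemma cnj_symmetrizer: "cnj (symmetrizer g) = symmetrizer g"
proof -
  have "cnj (row_sum h) = row_sum h" "cnj (column_sum h) = column_sum h" for h
    using s_sign[of h] by (auto simp: row_sum_def column_sum_def)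
  then show ?thesis by (simp add: symmetrizer_def convolution_def)
qed

text \<open>Let \<open>a\<close> be the row sum, \<open>b\<close> the column sum,
  \<open>c = a b\<close> and \<open>c' = b a\<close>, which are adjoint to each other. Then
  \<open>y = c c'\<close> is nonzero and self-adjoint, so \<open>y y \<noteq> 0\<close>. But
  \<open>c c' c = a b b a a b\<close> is a multiple of \<open>a b a b = c c\<close>, so
  \<open>c c = 0\<close> would give \<open>y y = 0\<close>.\<close>

lemma hook_nonzero: "hook \<noteq> 0"
proof
  assume "hook = 0"
  then have cc: "convolution G symmetrizer symmetrizer = 0" using symmetrizer_square by simp
  define c' where "c' = convolution G column_sum row_sum"
  have star: "(\<lambda>g. if g \<in> carrier G then cnj (c' (inv g)) else 0) = symmetrizer"
  proof
    fix g
    show "(if g \<in> carrier G then cnj (c' (inv g)) else 0) = symmetrizer g"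
    proof (cases "g \<in> carrier G")
      case True
      then have "c' (inv g) = symmetrizer g" using symmetrizer_inv[of "inv g"] by (simp add: c'_def)
      then show ?thesis using True cnj_symmetrizer by simp
    qed (simp add: symmetrizer_def convolution_outside)
  qed
  have "c' \<one> \<noteq> 0" using fun_cong[OF star, of \<one>] symmetrizer_one by auto
  then have "c' \<noteq> 0" by auto
  define y where "y = convolution G symmetrizer c'"
  have "y \<one> \<noteq> 0"
    unfolding y_def using convolution_star_nonzero[of c'] star \<open>c' \<noteq> 0\<close> by (simp add: c'_def convolution_mem)
  then have "y \<noteq> 0" by auto
  have "(\<lambda>g. if g \<in> carrier G then cnj (y (inv g)) else 0) = y"
    using convolution_star_star[of c'] by (simp only: star y_def)
  then have "convolution G y y \<one> \<noteq> 0"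
    using convolution_star_nonzero[of y] \<open>y \<noteq> 0\<close> by (simp add: y_def convolution_mem)
  moreover have "convolution G y y = convolution G (convolution G symmetrizer (convolution G c' symmetrizer)) c'"
    by (simp add: y_def convolution_assoc)
  moreover have "convolution G symmetrizer (convolution G c' symmetrizer) = 0"
  proof -
    have "convolution G symmetrizer (convolution G c' symmetrizer) =
        convolution G row_sum (convolution G (convolution G column_sum column_sum)
          (convolution G (convolution G row_sum row_sum) column_sum))"
      by (simp add: symmetrizer_def c'_def convolution_assoc)
    also have "\<dots> = cscale (of_nat (card C)) (cscale (of_nat (card R)) (convolution G symmetrizer symmetrizer))"
      by (simp only: column_sum_square row_sum_square convolution_scale_left convolution_scale_right
        symmetrizer_def convolution_assoc) (rule cfun.scale_left_commute)
    finally show ?thesis by (simp only: cc cfun.scale_zero_right)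
  qed
  ultimately show False by (simp add: convolution_0)
qed

definition young_idem :: "'g \<Rightarrow> complex" where "young_idem = cscale (1 / hook) symmetrizer"

lemma primitive_young_idem: "primitive_idempotent G young_idem"
proof
  show "young_idem \<in> group_algebra G"
    unfolding young_idem_def symmetrizer_def
    by (rule cfun.subspace_scale[OF subspace_group_algebra convolution_mem])
  show "convolution G young_idem young_idem = young_idem"
    using hook_nonzero
    by (simp add: young_idem_def convolution_scale_left convolution_scale_right symmetrizer_square)
  show "young_idem \<noteq> 0"
    using symmetrizer_one hook_nonzero by (auto simp: young_idem_def fun_eq_iff intro!: exI[of _ \<one>])
  fix a
  obtain c where "convolution G symmetrizer (convolution G a symmetrizer) = cscale c symmetrizer"
    using symmetrizer_sandwich by blast
  then have "convolution G young_idem (convolution G a young_idem) = cscale (c / hook) young_idem"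
    by (simp add: young_idem_def convolution_scale_left convolution_scale_right)
  then show "\<exists>c. convolution G young_idem (convolution G a young_idem) = cscale c young_idem" by blast
qed

lemma left_ideal_rep_symmetrizer: "left_ideal_rep G symmetrizer = left_ideal_rep G young_idem"
proof -
  have "(\<lambda>a. convolution G a symmetrizer) ` group_algebra G = (\<lambda>a. convolution G a young_idem) ` group_algebra G"
  proof (intro equalityI subsetI)
    fix x assume "x \<in> (\<lambda>a. convolution G a symmetrizer) ` group_algebra G"
    then obtain a where a: "a \<in> group_algebra G" "x = convolution G a symmetrizer" by auto
    have "x = convolution G (cscale hook a) young_idem"
      using hook_nonzero by (simp add: a young_idem_def convolution_scale_left convolution_scale_right)
    then show "x \<in> (\<lambda>a. convolution G a young_idem) ` group_algebra G"
      using cfun.subspace_scale[OF subspace_group_algebra a(1)] by blast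
  next
    fix x assume "x \<in> (\<lambda>a. convolution G a young_idem) ` group_algebra G"
    then obtain a where a: "a \<in> group_algebra G" "x = convolution G a young_idem" by auto
    have "x = convolution G (cscale (1 / hook) a) symmetrizer"
      by (simp add: a young_idem_def convolution_scale_left convolution_scale_right)
    then show "x \<in> (\<lambda>a. convolution G a symmetrizer) ` group_algebra G"
      using cfun.subspace_scale[OF subspace_group_algebra a(1)] by blast
  qed
  then show ?thesis by (simp add: left_ideal_rep_def)
qed

lemma sum_symmetrizer:
  "(\<Sum>g\<in>carrier G. symmetrizer g * f g) = (\<Sum>p\<in>R. \<Sum>q\<in>C. s q * f (p \<otimes> q))"
proof -
  have "(\<Sum>g\<in>carrier G. symmetrizer g * f g) =
      (\<Sum>g\<in>carrier G. \<Sum>p\<in>R. column_sum (inv p \<otimes> g) * f g)"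
    unfolding symmetrizer_def convolution_def
    using sum_R by (intro sum.cong refl) (simp add: sum_distrib_right)
  also have "\<dots> = (\<Sum>p\<in>R. \<Sum>g\<in>carrier G. column_sum (inv p \<otimes> g) * f g)"
    by (rule sum.swap)
  also have "\<dots> = (\<Sum>p\<in>R. \<Sum>g\<in>carrier G. column_sum g * f (p \<otimes> g))"
  proof (rule sum.cong[OF refl])
    fix p assume "p \<in> R"
    then have p: "p \<in> carrier G" by (rule R_closed)
    have "(\<Sum>g\<in>carrier G. column_sum (inv p \<otimes> g) * f g) =
        (\<Sum>g\<in>carrier G. column_sum (inv p \<otimes> (p \<otimes> g)) * f (p \<otimes> g))"
      by (rule sum_left_translate[OF p, symmetric])
    then show "(\<Sum>g\<in>carrier G. column_sum (inv p \<otimes> g) * f g) =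
        (\<Sum>g\<in>carrier G. column_sum g * f (p \<otimes> g))"
      using p by (simp add: m_assoc[symmetric])
  qed
  finally show ?thesis by (simp only: sum_C)
qed

text \<open>The signed count is the form in which the pairing of the symmetrizer with the Frobenius
  function comes out in \<open>symmetrizer_frob_int\<close>; the two are compared without evaluating
  either.\<close>

lemma hook_eq:
  "hook = (\<Sum>p\<in>R. \<Sum>q\<in>C. \<Sum>q'\<in>C. if q \<otimes> p \<otimes> q' \<in> R then s q * s q' else 0)"
proof -
  have eq: "symmetrizer g = (\<Sum>q\<in>C. s q * row_sum (g \<otimes> q))" if g: "g \<in> carrier G" for g
  proof -
    have "symmetrizer g = (\<Sum>h\<in>carrier G. row_sum (g \<otimes> inv h) * column_sum h)"
      using g by (simp add: symmetrizer_def convolution_def convolution_expand)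
    also have "\<dots> = (\<Sum>h\<in>carrier G. column_sum (inv h) * row_sum (g \<otimes> inv h))"
      by (intro sum.cong refl) (simp add: column_sum_inv mult.commute)
    also have "\<dots> = (\<Sum>h\<in>carrier G. column_sum h * row_sum (g \<otimes> h))"
      by (rule sum_inverse)
    finally show ?thesis by (simp only: sum_C)
  qed
  have inv_R: "(\<Sum>p\<in>R. f (inv p)) = (\<Sum>p\<in>R. f p)" for f :: "'g \<Rightarrow> complex"
    by (rule sum.reindex_bij_witness[of _ "\<lambda>p. inv p" "\<lambda>p. inv p"]) (auto simp: R_closed)
  have inv_C: "(\<Sum>p\<in>C. f (inv p)) = (\<Sum>p\<in>C. f p)" for f :: "'g \<Rightarrow> complex"
    by (rule sum.reindex_bij_witness[of _ "\<lambda>p. inv p" "\<lambda>p. inv p"]) (auto simp: C_closed)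
  have "hook = (\<Sum>g\<in>carrier G. symmetrizer g * symmetrizer (inv g))"
    by (simp add: hook_def convolution_def)
  also have "\<dots> = (\<Sum>p\<in>R. \<Sum>q\<in>C. s q * symmetrizer (inv (p \<otimes> q)))" by (rule sum_symmetrizer)
  also have "\<dots> = (\<Sum>p\<in>R. \<Sum>q\<in>C. s (inv q) * symmetrizer (inv q \<otimes> inv p))"
    by (intro sum.cong refl) (simp add: inv_mult_group R_closed C_closed s_inv)
  also have "\<dots> = (\<Sum>p\<in>R. \<Sum>q\<in>C. s q * symmetrizer (q \<otimes> inv p))"
    by (intro sum.cong refl inv_C)
  also have "\<dots> = (\<Sum>p\<in>R. \<Sum>q\<in>C. s q * symmetrizer (q \<otimes> p))"
    by (rule inv_R)
  also have "\<dots> = (\<Sum>p\<in>R. \<Sum>q\<in>C. \<Sum>q'\<in>C. if q \<otimes> p \<otimes> q' \<in> R then s q * s q' else 0)"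
    by (intro sum.cong refl) (auto simp: eq R_closed C_closed sum_distrib_left row_sum_def intro!: sum.cong)
  finally show ?thesis .
qed

text \<open>The trace property: a sum over conjugates does not distinguish \<open>a b\<close> from
  \<open>b a\<close>.\<close>

lemma conj_sum_convolution_commute:
  assumes x: "x \<in> carrier G"
  shows "conj_sum G (convolution G a b) x = conj_sum G (convolution G b a) x"
proof -
  have "conj_sum G (convolution G a b) x =
      (\<Sum>u\<in>carrier G. \<Sum>h\<in>carrier G. a u * b (inv u \<otimes> (h \<otimes> x \<otimes> inv h)))"
    unfolding conj_sum_def convolution_def using x by (subst sum.swap) simp
  also have "\<dots> = (\<Sum>u\<in>carrier G. \<Sum>h\<in>carrier G. b ((h \<otimes> x \<otimes> inv h) \<otimes> inv u) * a u)"
  proof (rule sum.cong[OF refl])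
    fix u assume u: "u \<in> carrier G"
    have "(\<Sum>h\<in>carrier G. a u * b (inv u \<otimes> (h \<otimes> x \<otimes> inv h))) =
        (\<Sum>h\<in>carrier G. a u * b (inv u \<otimes> ((u \<otimes> h) \<otimes> x \<otimes> inv (u \<otimes> h))))"
      by (rule sum_left_translate[OF u, symmetric])
    also have "\<dots> = (\<Sum>h\<in>carrier G. b ((h \<otimes> x \<otimes> inv h) \<otimes> inv u) * a u)"
    proof (rule sum.cong[OF refl])
      fix h assume h: "h \<in> carrier G"
      have "inv u \<otimes> ((u \<otimes> h) \<otimes> x \<otimes> inv (u \<otimes> h)) = (inv u \<otimes> u) \<otimes> (h \<otimes> x \<otimes> inv h \<otimes> inv u)"
        using u h x by (simp only: inv_mult_group m_assoc m_closed inv_closed)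
      then show "a u * b (inv u \<otimes> ((u \<otimes> h) \<otimes> x \<otimes> inv (u \<otimes> h))) = b ((h \<otimes> x \<otimes> inv h) \<otimes> inv u) * a u"
        using u h x by (simp add: mult.commute)
    qed
    finally show "(\<Sum>h\<in>carrier G. a u * b (inv u \<otimes> (h \<otimes> x \<otimes> inv h))) =
        (\<Sum>h\<in>carrier G. b ((h \<otimes> x \<otimes> inv h) \<otimes> inv u) * a u)" .
  qed
  also have "\<dots> = (\<Sum>h\<in>carrier G. \<Sum>u\<in>carrier G. b ((h \<otimes> x \<otimes> inv h) \<otimes> inv u) * a u)"
    by (rule sum.swap)
  also have "\<dots> = conj_sum G (convolution G b a) x"
    unfolding conj_sum_def
  proof (rule sum.cong[OF refl])
    fix h assume "h \<in> carrier G"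
    then have hx: "h \<otimes> x \<otimes> inv h \<in> carrier G" using x by simp
    then show "(\<Sum>u\<in>carrier G. b ((h \<otimes> x \<otimes> inv h) \<otimes> inv u) * a u) =
        convolution G b a (h \<otimes> x \<otimes> inv h)"
      unfolding convolution_def convolution_expand[OF hx, of b a] by simp
  qed
  finally show ?thesis .
qed

lemma conj_sum_young_idem_scale:
  "conj_sum G young_idem x = conj_sum G symmetrizer x / hook"
  by (simp add: conj_sum_def young_idem_def sum_divide_distrib)

text \<open>Inversion turns row times column into column times row, and by the trace property these
  have the same \<open>conj_sum\<close>.\<close>

lemma conj_sum_young_idem_inv:
  assumes x: "x \<in> carrier G"
  shows "conj_sum G young_idem (inv x) = conj_sum G young_idem x"
proof -
  have "conj_sum G symmetrizer (inv x) = conj_sum G (convolution G column_sum row_sum) x"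
    unfolding conj_sum_def
  proof (rule sum.cong[OF refl])
    fix h assume h: "h \<in> carrier G"
    have "h \<otimes> inv x \<otimes> inv h = inv (h \<otimes> x \<otimes> inv h)" using h x by (simp add: inv_mult_group m_assoc)
    then show "symmetrizer (h \<otimes> inv x \<otimes> inv h) = convolution G column_sum row_sum (h \<otimes> x \<otimes> inv h)"
      using h x by (simp add: symmetrizer_inv)
  qed
  also have "\<dots> = conj_sum G symmetrizer x"
    unfolding symmetrizer_def by (rule conj_sum_convolution_commute[OF x])
  finally show ?thesis by (simp add: conj_sum_young_idem_scale)
qed

lemma cnj_conj_sum_young_idem: "cnj (conj_sum G young_idem x) = conj_sum G young_idem x"
proof -
  have "cnj hook = hook"
    by (simp add: hook_def convolution_def cnj_symmetrizer)
  then show ?thesis unfolding conj_sum_young_idem_scale by (simp add: conj_sum_def cnj_symmetrizer)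
qed

text \<open>Both functions have norm 1 and their inner product is 1, so their difference vanishes.\<close>

theorem conj_sum_young_idem_unique:
  assumes class_fun: "\<And>h x. h \<in> carrier G \<Longrightarrow> x \<in> carrier G \<Longrightarrow> \<chi> (h \<otimes> x \<otimes> inv h) = \<chi> x"
    and real: "\<And>x. cnj (\<chi> x) = \<chi> x"
    and norm: "(\<Sum>x\<in>carrier G. \<chi> x * \<chi> x) = of_nat (card (carrier G))"
    and inner: "(\<Sum>p\<in>R. \<Sum>q\<in>C. s q * \<chi> (p \<otimes> q)) = hook"
    and x: "x \<in> carrier G"
  shows "conj_sum G young_idem x = \<chi> x"
proof -
  interpret e: primitive_idempotent G young_idem by (rule primitive_young_idem)
  let ?\<psi> = "conj_sum G young_idem" and ?n = "of_nat (card (carrier G)) :: complex"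
  have "(\<Sum>x\<in>carrier G. young_idem x * \<chi> x) = (\<Sum>x\<in>carrier G. symmetrizer x * \<chi> x) / hook"
    by (simp add: young_idem_def sum_divide_distrib)
  also have "\<dots> = 1" using inner hook_nonzero by (simp add: sum_symmetrizer)
  finally have 1: "(\<Sum>x\<in>carrier G. ?\<psi> x * \<chi> x) = ?n"
    using e.sum_conj_sum_mult[OF class_fun, of young_idem] by simp
  have "(\<Sum>x\<in>carrier G. ?\<psi> x * ?\<psi> x) = (\<Sum>x\<in>carrier G. ?\<psi> x * ?\<psi> (inv x))"
    by (intro sum.cong refl) (simp add: conj_sum_young_idem_inv)
  then have 2: "(\<Sum>x\<in>carrier G. ?\<psi> x * ?\<psi> x) = ?n"
    by (simp only: e.sum_conj_sum_conj_sum_inv)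
  have "of_real (\<Sum>x\<in>carrier G. (cmod (?\<psi> x - \<chi> x))\<^sup>2) =
      (\<Sum>x\<in>carrier G. (?\<psi> x - \<chi> x) * (?\<psi> x - \<chi> x))"
    unfolding of_real_sum complex_norm_square
    by (intro sum.cong refl) (simp add: cnj_conj_sum_young_idem real)
  also have "\<dots> = (\<Sum>x\<in>carrier G. ?\<psi> x * ?\<psi> x) - 2 * (\<Sum>x\<in>carrier G. ?\<psi> x * \<chi> x) +
      (\<Sum>x\<in>carrier G. \<chi> x * \<chi> x)"
    by (simp add: algebra_simps sum.distrib sum_subtractf sum_distrib_left)
  also have "\<dots> = 0" by (simp add: 1 2 norm)
  finally have "(\<Sum>x\<in>carrier G. (cmod (?\<psi> x - \<chi> x))\<^sup>2) = 0" by (simp only: of_real_eq_0_iff)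
  then have "\<forall>x\<in>carrier G. (cmod (?\<psi> x - \<chi> x))\<^sup>2 = 0"
    using finite_G by (subst (asm) sum_nonneg_eq_0_iff) auto
  then show ?thesis using x by simp
qed

end

section \<open>Symmetric groups and the combinatorics of a tableau\<close>

lemma fin_group_sym_group: "fin_group (sym_group n)"
proof -
  have "finite (carrier (sym_group n))"
    using finite_permutations[of "{1..n}"] by (simp add: sym_group_def)
  then show ?thesis
    using sym_group_is_group by (simp add: fin_group_def fin_group_axioms_def)
qed

lemma frob_conj:
  assumes h: "h permutes S" and x: "x permutes S" and S: "finite S"
  shows "frob k S A (h \<circ> x \<circ> inv' h) = frob k S A x"
proof -
  have "frob k (h ` S) A (h \<circ> x \<circ> inv' h) = frob k S A x"
    using permutes_in_image[OF x] permutes_inverses[OF h] permutes_inj[OF h] S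
    by (intro frob_relabel) (auto intro: inj_on_subset)
  then show ?thesis by (simp only: permutes_image[OF h])
qed

lemma frob_inv:
  assumes x: "x permutes S"
  shows "frob k S A (inv' x) = frob k S A x"
proof -
  have "fixed_colorings {..<k} S (inv' x) = fixed_colorings {..<k} S x"
  proof -
    have "(\<forall>s\<in>S. f (inv' x s) = f s) \<longleftrightarrow> (\<forall>s\<in>S. f (x s) = f s)" for f :: "'a \<Rightarrow> nat"
      using permutes_in_image[OF x] permutes_in_image[OF permutes_inv[OF x]] permutes_inverses[OF x] by metis
    then show ?thesis by (simp add: fixed_colorings_def)
  qed
  then show ?thesis by (simp add: frob_def)
qed

text \<open>The filling is given by the positions of the entries: \<open>row\<close> is then itself
  a colouring of the entries by rows, the extremal one in the dominance arguments.\<close>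

locale tableau =
  fixes n k :: nat and \<kappa> row col :: "nat \<Rightarrow> nat"
  assumes decreasing: "antimono \<kappa>"
    and rows: "k \<le> i \<Longrightarrow> \<kappa> i = 0"
    and cells: "bij_betw (\<lambda>s. (row s, col s)) {1..n} {(i, j). j < \<kappa> i}"
begin

abbreviation "S \<equiv> {1..n}"

definition rstab :: "(nat \<Rightarrow> nat) set" where
  "rstab = {p. p permutes S \<and> (\<forall>s\<in>S. row (p s) = row s)}"

definition cstab :: "(nat \<Rightarrow> nat) set" where
  "cstab = {p. p permutes S \<and> (\<forall>s\<in>S. col (p s) = col s)}"

lemma cell_inj: "s \<in> S \<Longrightarrow> t \<in> S \<Longrightarrow> row s = row t \<Longrightarrow> col s = col t \<Longrightarrow> s = t"
  using cells unfolding bij_betw_def inj_on_def by blast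

lemma cell_in: "s \<in> S \<Longrightarrow> col s < \<kappa> (row s)"
  using cells unfolding bij_betw_def by blast

lemma cell_ex: "j < \<kappa> i \<Longrightarrow> \<exists>s\<in>S. row s = i \<and> col s = j"
proof -
  assume "j < \<kappa> i"
  then have "(i, j) \<in> (\<lambda>s. (row s, col s)) ` S" using cells unfolding bij_betw_def by blast
  then show ?thesis by blast
qed

lemma row_less: "s \<in> S \<Longrightarrow> row s < k"
  using cell_in rows by (metis not_less not_less0)

lemma col_less: "s \<in> S \<Longrightarrow> col s < \<kappa> 0"
  using cell_in[of s] antimonoD[OF decreasing, of 0 "row s"] by simp

text \<open>The length of column \<open>c\<close>, a part of the conjugate partition. The
  \<open>LEAST\<close> exists since \<open>\<kappa>\<close> vanishes from \<open>k\<close>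
  on.\<close>

definition height :: "nat \<Rightarrow> nat" where "height c = (LEAST i. \<kappa> i \<le> c)"

lemma less_height_iff: "i < height c \<longleftrightarrow> c < \<kappa> i"
proof
  assume "i < height c"
  then have "\<not> \<kappa> i \<le> c" unfolding height_def by (rule not_less_Least)
  then show "c < \<kappa> i" by simp
next
  assume c: "c < \<kappa> i"
  have "\<kappa> (height c) \<le> c" unfolding height_def by (rule LeastI[of _ k]) (simp add: rows)
  show "i < height c"
  proof (rule ccontr)
    assume "\<not> i < height c"
    then have "\<kappa> i \<le> \<kappa> (height c)" by (intro antimonoD[OF decreasing]) simp
    then show False using c \<open>\<kappa> (height c) \<le> c\<close> by simp
  qed
qed

lemma height_le: "height c \<le> k"
  using less_height_iff[of k c] rows[of k] by simp

lemma card_column_below: "card {s \<in> S. col s = c \<and> row s < j} = min j (height c)"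
proof -
  have "bij_betw row {s \<in> S. col s = c \<and> row s < j} {..<min j (height c)}"
    unfolding bij_betw_def
  proof
    show "inj_on row {s \<in> S. col s = c \<and> row s < j}"
      by (rule inj_onI, rule cell_inj) auto
    show "row ` {s \<in> S. col s = c \<and> row s < j} = {..<min j (height c)}"
    proof (intro equalityI subsetI)
      fix i assume "i \<in> row ` {s \<in> S. col s = c \<and> row s < j}"
      then show "i \<in> {..<min j (height c)}" using cell_in by (auto simp: less_height_iff)
    next
      fix i assume i: "i \<in> {..<min j (height c)}"
      then have "c < \<kappa> i" "i < j" by (auto simp: less_height_iff)
      then show "i \<in> row ` {s \<in> S. col s = c \<and> row s < j}" using cell_ex[of c i] by blast
    qed
  qed
  from bij_betw_same_card[OF this] show ?thesis by simp
qed

lemma card_column: "card {s \<in> S. col s = c} = height c"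
proof -
  have "{s \<in> S. col s = c} = {s \<in> S. col s = c \<and> row s < k}" using row_less by auto
  then show ?thesis using card_column_below[of c k] height_le[of c] by simp
qed

lemma card_by_columns: "card {s \<in> S. P s} = (\<Sum>c<\<kappa> 0. card {s \<in> S. col s = c \<and> P s})"
proof -
  have "{s \<in> S. P s} = (\<Union>c<\<kappa> 0. {s \<in> S. col s = c \<and> P s})" using col_less by blast
  then show ?thesis by (simp only:) (subst card_UN_disjoint; auto)
qed

lemma sum_cnt_less: "(\<Sum>i<j. cnt S f i) = card {s \<in> S. f s < j}" for f :: "nat \<Rightarrow> nat"
proof -
  have "{s \<in> S. f s < j} = (\<Union>i<j. {s \<in> S. f s = i})" by blast
  then show ?thesis unfolding cnt_def by (simp only:) (subst card_UN_disjoint; auto)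
qed

lemma cnt_row: "cnt S row i = \<kappa> i"
proof -
  have "bij_betw col {s \<in> S. row s = i} {..<\<kappa> i}"
    unfolding bij_betw_def
  proof
    show "inj_on col {s \<in> S. row s = i}" by (rule inj_onI, rule cell_inj) auto
    show "col ` {s \<in> S. row s = i} = {..<\<kappa> i}"
    proof (intro equalityI subsetI)
      fix j assume "j \<in> {..<\<kappa> i}"
      then show "j \<in> col ` {s \<in> S. row s = i}" using cell_ex[of j i] by blast
    next
      fix j assume "j \<in> col ` {s \<in> S. row s = i}"
      then obtain t where "t \<in> S" "row t = i" "j = col t" by blast
      then show "j \<in> {..<\<kappa> i}" using cell_in[of t] by simp
    qed
  qed
  from bij_betw_same_card[OF this] show ?thesis by (simp add: cnt_def)
qed

definition column_injective :: "(nat \<Rightarrow> nat) \<Rightarrow> bool" where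
  "column_injective f \<longleftrightarrow> (\<forall>s\<in>S. \<forall>t\<in>S. col s = col t \<longrightarrow> f s = f t \<longrightarrow> s = t)"

lemma column_injective_bound:
  assumes "column_injective f"
  shows "card {s \<in> S. col s = c \<and> f s < j} \<le> min j (height c)"
proof (rule min.boundedI)
  have "card {s \<in> S. col s = c \<and> f s < j} \<le> card {..<j}"
  proof (rule card_inj_on_le[of f])
    show "inj_on f {s \<in> S. col s = c \<and> f s < j}"
      using assms unfolding column_injective_def inj_on_def by blast
  qed auto
  then show "card {s \<in> S. col s = c \<and> f s < j} \<le> j" by simp
  have "card {s \<in> S. col s = c \<and> f s < j} \<le> card {s \<in> S. col s = c}"
    by (rule card_mono) auto
  then show "card {s \<in> S. col s = c \<and> f s < j} \<le> height c" by (simp only: card_column)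
qed

text \<open>In column \<open>c\<close> at most \<open>min j (height c)\<close> entries have colours
  below \<open>j\<close>, and the colouring \<open>row\<close> attains this bound in every
  column.\<close>

lemma column_injective_dominated:
  assumes "column_injective f"
  shows "(\<Sum>i<j. cnt S f i) \<le> (\<Sum>i<j. \<kappa> i)"
proof -
  have "(\<Sum>i<j. cnt S f i) = (\<Sum>c<\<kappa> 0. card {s \<in> S. col s = c \<and> f s < j})"
    unfolding sum_cnt_less by (rule card_by_columns)
  also have "\<dots> \<le> (\<Sum>c<\<kappa> 0. card {s \<in> S. col s = c \<and> row s < j})"
    unfolding card_column_below by (intro sum_mono column_injective_bound assms)
  also have "\<dots> = (\<Sum>i<j. cnt S row i)"
    unfolding sum_cnt_less by (rule card_by_columns[symmetric])
  finally show ?thesis by (simp only: cnt_row)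
qed

text \<open>Equal totals force equality in every column, so a column of height \<open>h\<close>
  carries exactly the colours below \<open>h\<close>. Moving each entry to the box of its column
  whose row is its colour is the required permutation.\<close>

lemma column_injective_eq_row:
  assumes f: "column_injective f" and dom: "\<And>j. (\<Sum>i<j. \<kappa> i) \<le> (\<Sum>i<j. cnt S f i)"
  obtains q where "q \<in> cstab" "\<And>s. s \<in> S \<Longrightarrow> f s = row (q s)"
proof -
  have eq: "card {s \<in> S. col s = c \<and> f s < j} = min j (height c)" if "c < \<kappa> 0" for c j
  proof -
    have "(\<Sum>c<\<kappa> 0. card {s \<in> S. col s = c \<and> f s < j}) = (\<Sum>i<j. \<kappa> i)"
      using column_injective_dominated[OF f, of j] dom[of j]
      unfolding sum_cnt_less card_by_columns[of "\<lambda>s. f s < j"] by simp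
    also have "\<dots> = (\<Sum>c<\<kappa> 0. min j (height c))"
      using sum_cnt_less[where f = row and j = j]
      unfolding cnt_row card_by_columns[of "\<lambda>s. row s < j"] card_column_below .
    finally show ?thesis
      by (rule sum_mono_inv) (use column_injective_bound[OF f] that in auto)
  qed
  have less: "f s < height (col s)" if s: "s \<in> S" for s
  proof -
    have "card {t \<in> S. col t = col s \<and> f t < height (col s)} = card {t \<in> S. col t = col s}"
      unfolding card_column using eq[OF col_less[OF s], of "height (col s)"] by (simp only: min.idem)
    then have "{t \<in> S. col t = col s \<and> f t < height (col s)} = {t \<in> S. col t = col s}"
      by (intro card_subset_eq) auto
    then show ?thesis using s by blast
  qed
  then have "\<forall>s\<in>S. \<exists>t\<in>S. row t = f s \<and> col t = col s"
    using cell_ex by (simp add: less_height_iff)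
  then obtain q where q: "\<And>s. s \<in> S \<Longrightarrow> q s \<in> S \<and> row (q s) = f s \<and> col (q s) = col s"
    by metis
  define q' where "q' s = (if s \<in> S then q s else s)" for s
  have "inj_on q S"
  proof (rule inj_onI)
    fix s t assume st: "s \<in> S" "t \<in> S" "q s = q t"
    then have "col s = col t" "f s = f t" using q[OF st(1)] q[OF st(2)] by simp_all
    then show "s = t" using f st(1,2) unfolding column_injective_def by blast
  qed
  moreover have "q ` S \<subseteq> S" using q by auto
  ultimately have "bij_betw q S S" by (simp add: endo_inj_surj bij_betw_def)
  then have "bij_betw q' S S" by (rule bij_betw_cong[THEN iffD1, rotated]) (simp add: q'_def)
  then have "q' permutes S" by (rule bij_imp_permutes) (simp only: q'_def if_False)
  then have "q' \<in> cstab" using q by (auto simp: cstab_def q'_def)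
  then show ?thesis using that q by (auto simp: q'_def)
qed

end

sublocale tableau \<subseteq> sym: fin_group "sym_group n"
  by (rule fin_group_sym_group)

context tableau
begin

lemma stab_closed:
  assumes "p permutes S" "\<forall>s\<in>S. g (p s) = g s" "q permutes S" "\<forall>s\<in>S. g (q s) = g s"
  shows "\<forall>s\<in>S. g ((p \<circ> q) s) = g s" "\<forall>s\<in>S. g (inv' p s) = g s"
proof -
  show "\<forall>s\<in>S. g ((p \<circ> q) s) = g s"
    using assms permutes_in_image[OF assms(3)] by simp
  show "\<forall>s\<in>S. g (inv' p s) = g s"
    using assms(2) permutes_in_image[OF permutes_inv[OF assms(1)]] permutes_inverses(1)[OF assms(1)] by metis
qed

lemma subgroup_stab: "subgroup {p. p permutes S \<and> (\<forall>s\<in>S. g (p s) = g s)} (sym_group n)"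
proof (rule group.subgroupI[OF sym_group_is_group])
  show "{p. p permutes S \<and> (\<forall>s\<in>S. g (p s) = g s)} \<noteq> {}" using permutes_id by fastforce
  show "inv\<^bsub>sym_group n\<^esub> p \<in> {p. p permutes S \<and> (\<forall>s\<in>S. g (p s) = g s)}"
    if "p \<in> {p. p permutes S \<and> (\<forall>s\<in>S. g (p s) = g s)}" for p
    using that stab_closed(2)[of p g p] permutes_inv[of p S] by (simp add: sym_group_carrier)
  show "p \<otimes>\<^bsub>sym_group n\<^esub> q \<in> {p. p permutes S \<and> (\<forall>s\<in>S. g (p s) = g s)}"
    if "p \<in> {p. p permutes S \<and> (\<forall>s\<in>S. g (p s) = g s)}"
      "q \<in> {p. p permutes S \<and> (\<forall>s\<in>S. g (p s) = g s)}" for p q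
    using that stab_closed(1)[of p g q] permutes_compose[of q S p] by (simp add: sym_group_mult)
qed (auto simp: sym_group_carrier)

lemma permutes_permutation: "p permutes S \<Longrightarrow> permutation p"
  using permutation_permutes by blast

lemma transpose_cstab:
  assumes "x \<in> S" "y \<in> S" "col x = col y"
  shows "transpose x y \<in> cstab"
  using assms permutes_swap_id[of x S y] by (auto simp: cstab_def transpose_def)

text \<open>If \<open>g\<close> sends no two entries of a column to the same row, then
  \<open>row \<circ> g\<close> is column-injective with content \<open>\<kappa>\<close>, and a
  rearrangement of the columns factors \<open>g\<close>. Otherwise the transposition of two such
  images lies in the row group and is conjugate under \<open>g\<close> to a transposition within a
  column.\<close>

lemma young_pair_tableau: "young_pair (sym_group n) rstab cstab (\<lambda>q. of_int (sign q))"
proof (intro young_pair.intro young_pair_axioms.intro fin_group_sym_group)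
  show "subgroup rstab (sym_group n)" unfolding rstab_def by (rule subgroup_stab)
  show "subgroup cstab (sym_group n)" unfolding cstab_def by (rule subgroup_stab)
  show "of_int (sign (p \<otimes>\<^bsub>sym_group n\<^esub> q)) = of_int (sign p) * (of_int (sign q) :: complex)"
    if "p \<in> cstab" "q \<in> cstab" for p q
    using that sign_compose[of p q] permutes_permutation by (simp add: sym_group_mult cstab_def)
  show "of_int (sign q) = (1 :: complex) \<or> of_int (sign q) = (- 1 :: complex)" for q :: "nat \<Rightarrow> nat"
    by (simp add: sign_def)
  show "rstab \<inter> cstab = {\<one>\<^bsub>sym_group n\<^esub>}"
  proof (intro equalityI subsetI)
    fix p assume p: "p \<in> rstab \<inter> cstab"
    have "p s = s" for s
    proof (cases "s \<in> S")
      case True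
      show ?thesis
      proof (rule cell_inj[OF _ True])
        show "p s \<in> S" using p True permutes_in_image[of p S s] by (simp add: rstab_def)
        show "row (p s) = row s" "col (p s) = col s"
          using p True by (simp_all add: rstab_def cstab_def)
      qed
    next
      case False
      then show ?thesis using p permutes_not_in[of p S s] by (auto simp: rstab_def)
    qed
    then show "p \<in> {\<one>\<^bsub>sym_group n\<^esub>}" by (auto simp: sym_group_one)
  qed (auto simp: sym_group_one rstab_def cstab_def permutes_id)
  fix g assume "g \<in> carrier (sym_group n)"
    and no: "\<nexists>p q. p \<in> rstab \<and> q \<in> cstab \<and> g = p \<otimes>\<^bsub>sym_group n\<^esub> q"
  then have g: "g permutes S" by (simp add: sym_group_carrier)
  have gS: "g s \<in> S \<longleftrightarrow> s \<in> S" for s by (rule permutes_in_image[OF g])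
  have "\<not> column_injective (\<lambda>s. row (g s))"
  proof
    assume inj: "column_injective (\<lambda>s. row (g s))"
    have "cnt S (\<lambda>s. row (g s)) i = \<kappa> i" for i
      using cnt_compose[OF g, of row i] cnt_row by (rule trans)
    then obtain q where q: "q \<in> cstab" "\<And>s. s \<in> S \<Longrightarrow> row (g s) = row (q s)"
      using column_injective_eq_row[OF inj] by auto
    have qp: "q permutes S" using q(1) by (simp add: cstab_def)
    have "row ((g \<circ> inv' q) s) = row s" if "s \<in> S" for s
      using q(2)[of "inv' q s"] that permutes_in_image[OF permutes_inv[OF qp]] permutes_inverses(1)[OF qp] by simp
    then have "g \<circ> inv' q \<in> rstab"
      using permutes_compose[OF permutes_inv[OF qp] g] by (simp add: rstab_def)
    moreover have "g = (g \<circ> inv' q) \<otimes>\<^bsub>sym_group n\<^esub> q"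
      by (simp add: sym_group_mult fun_eq_iff permutes_inverses[OF qp])
    ultimately show False using no q(1) by blast
  qed
  then obtain u v where uv: "u \<in> S" "v \<in> S" "col u = col v" "row (g u) = row (g v)" "u \<noteq> v"
    unfolding column_injective_def by blast
  let ?t = "transpose (g u) (g v)"
  have t: "?t \<in> rstab"
    using uv gS permutes_swap_id[of "g u" S "g v"] by (auto simp: rstab_def transpose_def)
  have "inv' g \<circ> ?t \<circ> g = transpose u v"
    using permutes_inverses[OF g] permutes_inj[OF g] by (auto simp: fun_eq_iff transpose_def inj_eq)
  then have eq: "inv\<^bsub>sym_group n\<^esub> g \<otimes>\<^bsub>sym_group n\<^esub> ?t \<otimes>\<^bsub>sym_group n\<^esub> g = transpose u v"
    using g by (simp add: sym_group_mult sym_group_carrier)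
  show "\<exists>t\<in>rstab. inv\<^bsub>sym_group n\<^esub> g \<otimes>\<^bsub>sym_group n\<^esub> t \<otimes>\<^bsub>sym_group n\<^esub> g \<in> cstab \<and>
      of_int (sign (inv\<^bsub>sym_group n\<^esub> g \<otimes>\<^bsub>sym_group n\<^esub> t \<otimes>\<^bsub>sym_group n\<^esub> g)) = (- 1 :: complex)"
    using t transpose_cstab[OF uv(1,2,3)] uv(5)
    by (intro bexI[of _ ?t]) (simp_all only: eq sign_swap_id, simp)
qed

end

sublocale tableau \<subseteq> young: young_pair "sym_group n" rstab cstab "\<lambda>q. of_int (sign q)"
  by (rule young_pair_tableau)

context tableau
begin

section \<open>The pairing of the Young symmetrizer with the Frobenius function\<close>

definition shape :: "nat \<Rightarrow> int" where "shape i = int (\<kappa> i) - int i"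

lemma sum_\<kappa>: "(\<Sum>i<k. \<kappa> i) = n"
  using sum_cnt[of "{..<k}" S row] row_less unfolding cnt_row by simp

lemma strict_shape: "strict_shape k n shape"
proof -
  have "shape j < shape i" if "i < j" for i j
    using antimonoD[OF decreasing, of i j] that by (simp add: shape_def)
  moreover have "(\<Sum>i<k. shape i + int i) = int n"
    using sum_\<kappa> by (simp add: shape_def flip: of_nat_sum)
  ultimately show ?thesis by (simp add: strict_shape_def strictly_decreasing_def) (simp add: shape_def)
qed

definition weight :: "(nat \<Rightarrow> nat) \<Rightarrow> int" where
  "weight f = alt_coeff k (\<lambda>i. int (cnt S f i) - shape i)"

lemma weight_row:
  assumes "q \<in> cstab"
  shows "weight (restrict (\<lambda>s. row (q s)) S) = 1"
proof -
  have "q permutes S" using assms by (simp add: cstab_def)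
  then have "cnt S (\<lambda>s. row (q s)) i = \<kappa> i" for i by (simp only: cnt_compose cnt_row)
  moreover have "cnt S (restrict (\<lambda>s. row (q s)) S) i = cnt S (\<lambda>s. row (q s)) i" for i
    by (rule cnt_cong) simp
  ultimately have "cnt S (restrict (\<lambda>s. row (q s)) S) i = \<kappa> i" for i by (simp only:)
  then show ?thesis
    unfolding weight_def using alt_coeff_perm[of id k "\<lambda>i. int i"] permutes_id[of "{..<k}"]
    by (simp add: shape_def)
qed

text \<open>The content of \<open>f\<close> is \<open>\<kappa> i - i + w i\<close> for a permutation
  \<open>w\<close>. As a column-injective colouring is dominated by \<open>\<kappa>\<close>,
  \<open>w\<close> is the identity, and content \<open>\<kappa>\<close> occurs only for column
  rearrangements of \<open>row\<close>.\<close>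

lemma weight_nonzero_row:
  assumes f: "f \<in> S \<rightarrow>\<^sub>E {..<k}" "column_injective f" "weight f \<noteq> 0"
  shows "\<exists>q\<in>cstab. f = restrict (\<lambda>s. row (q s)) S"
proof -
  obtain w where w: "w permutes {..<k}" "\<And>i. i < k \<Longrightarrow> int (cnt S f i) - shape i = int (w i)"
    using f(3) unfolding weight_def by (rule alt_coeff_nonzeroE) blast
  have cnt_f: "int (cnt S f i) = int (\<kappa> i) - int i + int (w i)" if "i < k" for i
    using w(2)[OF that] by (simp add: shape_def)
  have "(\<Sum>i<j. w i) \<le> (\<Sum>i<j. i)" if j: "j \<le> k" for j
  proof -
    have "int (\<Sum>i<j. cnt S f i) = (\<Sum>i<j. int (\<kappa> i) - int i + int (w i))"
      using j cnt_f by simp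
    also have "\<dots> = int (\<Sum>i<j. \<kappa> i) - int (\<Sum>i<j. i) + int (\<Sum>i<j. w i)"
      by (simp only: sum.distrib sum_subtractf of_nat_sum)
    finally show ?thesis using column_injective_dominated[OF f(2), of j] by linarith
  qed
  then have "w i = i" if "i < k" for i by (rule dominated_permutation_id[OF w(1) _ that])
  then have cnt_\<kappa>: "cnt S f i = \<kappa> i" if "i < k" for i using cnt_f[OF that] that by simp
  have "cnt S f i = \<kappa> i" for i
  proof (cases "i < k")
    case False
    then have "{s \<in> S. f s = i} = {}" using f(1) by fastforce
    then show ?thesis unfolding cnt_def using rows[of i] False by (simp only: card.empty)
  qed (rule cnt_\<kappa>)
  then obtain q where q: "q \<in> cstab" "\<And>s. s \<in> S \<Longrightarrow> f s = row (q s)"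
    using column_injective_eq_row[OF f(2)] by auto
  have "f = restrict (\<lambda>s. row (q s)) S"
  proof
    fix s
    show "f s = restrict (\<lambda>s. row (q s)) S s"
      using q(2)[of s] f(1) by (cases "s \<in> S") (auto simp: PiE_iff extensional_def)
  qed
  with q(1) show ?thesis by blast
qed


lemma cstab_compose: "p \<in> cstab \<Longrightarrow> q \<in> cstab \<Longrightarrow> p \<circ> q \<in> cstab"
  using young.C_closed(2)[of p q] by (simp add: sym_group_mult)

lemma cstab_inv: "p \<in> cstab \<Longrightarrow> inv' p \<in> cstab"
  using young.C_closed(3)[of p] young.C_closed(1)[of p] by simp

lemma sign_cstab: "p \<in> cstab \<Longrightarrow> q \<in> cstab \<Longrightarrow> sign (p \<circ> q) = sign p * sign q"
  unfolding cstab_def by (intro sign_compose permutes_permutation) blast+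

lemma sum_cstab_left: "t \<in> cstab \<Longrightarrow> (\<Sum>q\<in>cstab. F (t \<circ> q)) = (\<Sum>q\<in>cstab. F q)"
  for F :: "(nat \<Rightarrow> nat) \<Rightarrow> int"
proof (rule sum.reindex_bij_witness[of _ "\<lambda>q. inv' t \<circ> q" "\<lambda>q. t \<circ> q"])
  assume t: "t \<in> cstab"
  then have tp: "t permutes S" by (simp add: cstab_def)
  show "inv' t \<circ> (t \<circ> q) = q" "t \<circ> (inv' t \<circ> q) = q" for q
    by (simp_all add: fun_eq_iff permutes_inverses[OF tp])
qed (auto simp: cstab_compose cstab_inv)

text \<open>If \<open>f\<close> takes equal values on two boxes of a column, the transposition of these boxes
  reverses the sign of every term.\<close>

lemma signed_sum_not_column_injective:
  assumes "\<not> column_injective f" and p: "p permutes S"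
  shows "(\<Sum>q\<in>cstab. if \<forall>s\<in>S. f (q (p s)) = f s then sign q else 0) = 0"
proof -
  obtain x y where xy: "x \<in> S" "y \<in> S" "col x = col y" "f x = f y" "x \<noteq> y"
    using assms(1) unfolding column_injective_def by blast
  let ?t = "transpose x y" and ?F = "\<lambda>q. if \<forall>s\<in>S. f (q (p s)) = f s then sign q else 0"
  have t: "?t \<in> cstab" by (rule transpose_cstab[OF xy(1,2,3)])
  have ft: "f (?t s) = f s" for s using xy(4) by (simp add: transpose_def)
  have "(\<Sum>q\<in>cstab. ?F q) = (\<Sum>q\<in>cstab. ?F (?t \<circ> q))" by (rule sum_cstab_left[OF t, symmetric])
  also have "\<dots> = (\<Sum>q\<in>cstab. - ?F q)"
    using sign_cstab[OF t] xy(5) by (intro sum.cong refl) (simp add: ft sign_swap_id)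
  finally show ?thesis by (simp add: sum_negf)
qed

lemma frob_swap:
  assumes "p permutes S" "q permutes S"
  shows "frob k S A (p \<circ> q) = frob k S A (q \<circ> p)"
proof -
  have "inv' p \<circ> (p \<circ> q) \<circ> inv' (inv' p) = q \<circ> p"
    by (simp add: fun_eq_iff permutes_inverses[OF assms(1)] permutes_inv_inv[OF assms(1)])
  then show ?thesis
    using frob_conj[OF permutes_inv[OF assms(1)] permutes_compose[OF assms(2,1)], of k A] by simp
qed

text \<open>The colouring is \<open>row\<close> transported by \<open>q0\<close>, so fixing it means
  fixing \<open>row\<close> after conjugation by \<open>q0\<close>.\<close>

lemma row_fixed_iff:
  assumes "q0 \<in> cstab" "q \<in> cstab" "p permutes S"
  shows "(\<forall>s\<in>S. restrict (\<lambda>s. row (q0 s)) S (q (p s)) = restrict (\<lambda>s. row (q0 s)) S s) \<longleftrightarrow>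
    q0 \<circ> q \<circ> p \<circ> inv' q0 \<in> rstab"
proof -
  have q0: "q0 permutes S" and q: "q permutes S" using assms by (auto simp: cstab_def)
  have mem: "q (p s) \<in> S" "inv' q0 s \<in> S" "q0 s \<in> S" if "s \<in> S" for s
    using that permutes_in_image[OF q] permutes_in_image[OF assms(3)]
      permutes_in_image[OF permutes_inv[OF q0]] permutes_in_image[OF q0] by auto
  have perm: "q0 \<circ> q \<circ> p \<circ> inv' q0 permutes S"
    by (intro permutes_compose permutes_inv q0 q assms(3))
  have "(\<forall>s\<in>S. row (q0 (q (p s))) = row (q0 s)) \<longleftrightarrow> (\<forall>s\<in>S. row (q0 (q (p (inv' q0 s)))) = row s)"
  proof
    assume L: "\<forall>s\<in>S. row (q0 (q (p s))) = row (q0 s)"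
    show "\<forall>s\<in>S. row (q0 (q (p (inv' q0 s)))) = row s"
      using L mem(2) permutes_inverses(1)[OF q0] by simp
  next
    assume R: "\<forall>s\<in>S. row (q0 (q (p (inv' q0 s)))) = row s"
    show "\<forall>s\<in>S. row (q0 (q (p s))) = row (q0 s)"
    proof
      fix s assume "s \<in> S"
      from bspec[OF R mem(3)[OF this]] show "row (q0 (q (p s))) = row (q0 s)"
        by (simp only: permutes_inverses(2)[OF q0])
    qed
  qed
  then show ?thesis using perm mem(1) by (simp add: rstab_def)
qed

text \<open>Antisymmetrizing over the columns kills every colouring that is not column-injective.
  Among the others only the rearrangements of \<open>row\<close> by some
  \<open>q0 \<in> cstab\<close> have nonzero weight, namely 1. That such a colouring is fixed
  becomes membership in the row group, and substitutions in \<open>q\<close> and \<open>q0\<close>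
  produce the signed count of \<open>hook_eq\<close>.\<close>

lemma symmetrizer_frob_int:
  "(\<Sum>p\<in>rstab. \<Sum>q\<in>cstab. sign q * frob k S shape (p \<circ> q)) =
    (\<Sum>p\<in>rstab. \<Sum>q\<in>cstab. \<Sum>q'\<in>cstab. if q \<circ> p \<circ> q' \<in> rstab then sign q * sign q' else 0)"
proof -
  let ?F = "S \<rightarrow>\<^sub>E {..<k}"
  have finF: "finite ?F" by (simp add: finite_PiE)
  have rp: "p permutes S" if "p \<in> rstab" for p using that by (simp add: rstab_def)
  have cp: "q permutes S" if "q \<in> cstab" for q using that by (simp add: cstab_def)
  define T where "T f = (\<Sum>p\<in>rstab. \<Sum>q\<in>cstab. if \<forall>s\<in>S. f (q (p s)) = f s then sign q else 0)" for f :: "nat \<Rightarrow> nat"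
  let ?r = "\<lambda>q. restrict (\<lambda>s. row (q s)) S"
  have "(\<Sum>p\<in>rstab. \<Sum>q\<in>cstab. sign q * frob k S shape (p \<circ> q)) =
      (\<Sum>p\<in>rstab. \<Sum>q\<in>cstab. \<Sum>f\<in>?F. (if \<forall>s\<in>S. f (q (p s)) = f s then sign q else 0) * weight f)"
  proof (intro sum.cong refl)
    fix p q assume "p \<in> rstab" "q \<in> cstab"
    \<comment> \<open>Conjugation invariance exchanges \<open>p\<close> and \<open>q\<close>. The
      column element must be applied last, so that composing it with a transposition that preserves
      \<open>f\<close> does not affect the condition.\<close>
    then have "frob k S shape (p \<circ> q) = (\<Sum>f\<in>{f \<in> ?F. \<forall>s\<in>S. f (q (p s)) = f s}. weight f)"
      using frob_swap[OF rp cp] by (simp add: frob_def fixed_colorings_def weight_def)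
    also have "\<dots> = (\<Sum>f\<in>?F. if \<forall>s\<in>S. f (q (p s)) = f s then weight f else 0)"
      by (rule sum.inter_filter[OF finF])
    finally show "sign q * frob k S shape (p \<circ> q) =
        (\<Sum>f\<in>?F. (if \<forall>s\<in>S. f (q (p s)) = f s then sign q else 0) * weight f)"
      by (simp only: sum_distrib_left) (intro sum.cong refl, simp)
  qed
  also have "\<dots> = (\<Sum>p\<in>rstab. \<Sum>f\<in>?F. \<Sum>q\<in>cstab. (if \<forall>s\<in>S. f (q (p s)) = f s then sign q else 0) * weight f)"
    by (intro sum.cong refl sum.swap)
  also have "\<dots> = (\<Sum>f\<in>?F. \<Sum>p\<in>rstab. \<Sum>q\<in>cstab. (if \<forall>s\<in>S. f (q (p s)) = f s then sign q else 0) * weight f)"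
    by (rule sum.swap)
  also have "\<dots> = (\<Sum>f\<in>?F. T f * weight f)"
    by (simp only: T_def sum_distrib_right)
  also have "\<dots> = (\<Sum>f\<in>?r ` cstab. T f * weight f)"
  proof (rule sum.mono_neutral_right[OF finF])
    show "?r ` cstab \<subseteq> ?F"
    proof
      fix f assume "f \<in> ?r ` cstab"
      then obtain q where q: "q \<in> cstab" "f = ?r q" by blast
      show "f \<in> ?F"
        unfolding q(2) using row_less permutes_in_image[OF cp[OF q(1)]] by (auto simp del: atLeastAtMost_iff)
    qed
    show "\<forall>f\<in>?F - ?r ` cstab. T f * weight f = 0"
    proof
      fix f assume f: "f \<in> ?F - ?r ` cstab"
      show "T f * weight f = 0"
      proof (cases "column_injective f")
        case True
        then have "weight f = 0" using weight_nonzero_row[of f] f by blast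
        then show ?thesis by simp
      next
        case False
        have "T f = 0" unfolding T_def
          by (intro sum.neutral ballI signed_sum_not_column_injective[OF False] rp)
        then show ?thesis by simp
      qed
    qed
  qed
  also have "\<dots> = (\<Sum>q\<in>cstab. T (?r q) * weight (?r q))"
  proof (rule sum.reindex_cong[OF _ refl refl])
    show "inj_on ?r cstab"
    proof (rule inj_onI)
      fix q q' assume q: "q \<in> cstab" "q' \<in> cstab" "?r q = ?r q'"
      show "q = q'"
      proof
        fix s
        show "q s = q' s"
        proof (cases "s \<in> S")
          case True
          show ?thesis
          proof (rule cell_inj)
            show "q s \<in> S" "q' s \<in> S"
              using True permutes_in_image[OF cp[OF q(1)], of s] permutes_in_image[OF cp[OF q(2)], of s]
              by blast+
            show "row (q s) = row (q' s)" using fun_cong[OF q(3), of s] True by simp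
            show "col (q s) = col (q' s)" using q(1,2) True by (simp add: cstab_def)
          qed
        next
          case False
          then show ?thesis
            using permutes_not_in[OF cp[OF q(1)], of s] permutes_not_in[OF cp[OF q(2)], of s] by simp
        qed
      qed
    qed
  qed
  also have "\<dots> = (\<Sum>q0\<in>cstab. \<Sum>p\<in>rstab. \<Sum>q\<in>cstab. if q0 \<circ> q \<circ> p \<circ> inv' q0 \<in> rstab then sign q else 0)"
  proof (rule sum.cong[OF refl])
    fix q0 assume q0: "q0 \<in> cstab"
    have "T (?r q0) = (\<Sum>p\<in>rstab. \<Sum>q\<in>cstab. if q0 \<circ> q \<circ> p \<circ> inv' q0 \<in> rstab then sign q else 0)"
      unfolding T_def by (intro sum.cong refl) (simp only: row_fixed_iff[OF q0 _ rp])
    then show "T (?r q0) * weight (?r q0) =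
        (\<Sum>p\<in>rstab. \<Sum>q\<in>cstab. if q0 \<circ> q \<circ> p \<circ> inv' q0 \<in> rstab then sign q else 0)"
      by (simp only: weight_row[OF q0] mult_1_right)
  qed
  also have "\<dots> = (\<Sum>q0\<in>cstab. \<Sum>p\<in>rstab. \<Sum>q\<in>cstab. if q \<circ> p \<circ> inv' q0 \<in> rstab then sign q * sign q0 else 0)"
  proof (rule sum.cong[OF refl], rule sum.cong[OF refl])
    fix q0 p assume q0: "q0 \<in> cstab"
    let ?G = "\<lambda>q. if q \<circ> p \<circ> inv' q0 \<in> rstab then sign q * sign q0 else 0"
    \<comment> \<open>The substitution of \<open>q0 \<circ> q\<close> for \<open>q\<close> absorbs
      \<open>q0\<close>; the factor \<open>sign q0\<close> in \<open>?G\<close> compensates the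
      change of sign.\<close>
    have "(\<Sum>q\<in>cstab. ?G q) = (\<Sum>q\<in>cstab. ?G (q0 \<circ> q))"
      by (rule sum_cstab_left[OF q0, symmetric])
    also have "\<dots> = (\<Sum>q\<in>cstab. if q0 \<circ> q \<circ> p \<circ> inv' q0 \<in> rstab then sign q else 0)"
    proof (rule sum.cong[OF refl])
      fix q assume q: "q \<in> cstab"
      have "sign q0 * sign q0 = 1" by (simp add: sign_def)
      then have "sign (q0 \<circ> q) * sign q0 = sign q"
        using sign_cstab[OF q0 q] by (simp add: mult.commute mult.left_commute)
      then show "?G (q0 \<circ> q) = (if q0 \<circ> q \<circ> p \<circ> inv' q0 \<in> rstab then sign q else 0)" by simp
    qed
    finally show "(\<Sum>q\<in>cstab. if q0 \<circ> q \<circ> p \<circ> inv' q0 \<in> rstab then sign q else 0) = (\<Sum>q\<in>cstab. ?G q)" ..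
  qed
  also have "\<dots> = (\<Sum>q0\<in>cstab. \<Sum>p\<in>rstab. \<Sum>q\<in>cstab. if q \<circ> p \<circ> q0 \<in> rstab then sign q * sign q0 else 0)"
  proof (rule sum.reindex_bij_witness[of _ "inv'" "inv'"])
    show "inv' q0 \<in> cstab" if "q0 \<in> cstab" for q0 using that by (rule cstab_inv)
    show "inv' q0 \<in> cstab" if "q0 \<in> cstab" for q0 using that by (rule cstab_inv)
    show "inv' (inv' q0) = q0" if "q0 \<in> cstab" for q0 by (rule permutes_inv_inv[OF cp[OF that]])
    show "inv' (inv' q0) = q0" if "q0 \<in> cstab" for q0 by (rule permutes_inv_inv[OF cp[OF that]])
    fix q0 assume q0: "q0 \<in> cstab"
    have "sign (inv' q0) = sign q0" using sign_inverse permutes_permutation[OF cp[OF q0]] by blast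
    then show "(\<Sum>p\<in>rstab. \<Sum>q\<in>cstab. if q \<circ> p \<circ> inv' q0 \<in> rstab then sign q * sign (inv' q0) else 0) =
      (\<Sum>p\<in>rstab. \<Sum>q\<in>cstab. if q \<circ> p \<circ> inv' q0 \<in> rstab then sign q * sign q0 else 0)" by (simp only:)
  qed
  also have "\<dots> = (\<Sum>p\<in>rstab. \<Sum>q0\<in>cstab. \<Sum>q\<in>cstab. if q \<circ> p \<circ> q0 \<in> rstab then sign q * sign q0 else 0)"
    by (rule sum.swap)
  also have "\<dots> = (\<Sum>p\<in>rstab. \<Sum>q\<in>cstab. \<Sum>q'\<in>cstab. if q \<circ> p \<circ> q' \<in> rstab then sign q * sign q' else 0)"
    by (intro sum.cong refl sum.swap)
  finally show ?thesis .
qed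

lemma symmetrizer_frob:
  "(\<Sum>p\<in>rstab. \<Sum>q\<in>cstab. of_int (sign q) * of_int (frob k S shape (p \<otimes>\<^bsub>sym_group n\<^esub> q))) = young.hook"
proof -
  have "young.hook = (\<Sum>p\<in>rstab. \<Sum>q\<in>cstab. \<Sum>q'\<in>cstab.
      of_int (if q \<circ> p \<circ> q' \<in> rstab then sign q * sign q' else 0))"
    unfolding young.hook_eq by (intro sum.cong refl) (simp add: sym_group_mult)
  also have "\<dots> = of_int (\<Sum>p\<in>rstab. \<Sum>q\<in>cstab. sign q * frob k S shape (p \<circ> q))"
    by (simp only: symmetrizer_frob_int of_int_sum)
  finally show ?thesis by (simp add: sym_group_mult)
qed

text \<open>Frobenius' formula. Orthonormality of the signed counts supplies the norm, and
  \<open>symmetrizer_frob\<close> the inner product with the irreducible character.\<close>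

theorem conj_sum_young_idem_eq_frob:
  assumes "x \<in> carrier (sym_group n)"
  shows "conj_sum (sym_group n) young.young_idem x = of_int (frob k S shape x)"
proof (rule young.conj_sum_young_idem_unique[where \<chi> = "\<lambda>x. of_int (frob k S shape x)", OF _ _ _ symmetrizer_frob assms])
  show "of_int (frob k S shape (h \<otimes>\<^bsub>sym_group n\<^esub> x \<otimes>\<^bsub>sym_group n\<^esub> inv\<^bsub>sym_group n\<^esub> h)) =
      (of_int (frob k S shape x) :: complex)"
    if "h \<in> carrier (sym_group n)" "x \<in> carrier (sym_group n)" for h x
    using that frob_conj[of h S x k shape] by (simp add: sym_group_mult sym_group_carrier)
  show "(\<Sum>x\<in>carrier (sym_group n). of_int (frob k S shape x) * of_int (frob k S shape x)) =
      (of_nat (card (carrier (sym_group n))) :: complex)"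
  proof -
    have "carrier (sym_group n) = {\<sigma>. \<sigma> permutes S}" by (auto simp: sym_group_carrier)
    moreover have "(\<Sum>\<sigma> | \<sigma> permutes S. frob k S shape \<sigma> * frob k S shape \<sigma>) = fact n"
      using sum_frob_frob[of k S shape] strict_shape by simp
    then have "(of_int (\<Sum>\<sigma> | \<sigma> permutes S. frob k S shape \<sigma> * frob k S shape \<sigma>) :: complex) = of_int (fact n)"
      by (rule arg_cong)
    ultimately show ?thesis unfolding sym_group_card_carrier by simp
  qed
qed simp

end

subsection \<open>Specht modules\<close>

definition rows_shape :: "(nat \<Rightarrow> nat) \<Rightarrow> nat \<Rightarrow> int"
  where "rows_shape \<kappa> i = int (\<kappa> i) - int i"

lemma psize_eq_sum:
  assumes "\<And>i. k \<le> i \<Longrightarrow> \<kappa> i = 0"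
  shows "psize \<kappa> = (\<Sum>i<k. \<kappa> i)"
  unfolding psize_def
proof (rule sum.mono_neutral_left)
  show "{i. \<kappa> i \<noteq> 0} \<subseteq> {..<k}"
  proof
    fix i assume "i \<in> {i. \<kappa> i \<noteq> 0}"
    then have "\<not> k \<le> i" using assms by auto
    then show "i \<in> {..<k}" by simp
  qed
qed auto

lemma bij_betw_row_tableau:
  assumes "\<And>i. k \<le> i \<Longrightarrow> \<kappa> i = 0"
  shows "bij_betw (\<lambda>(i, j). row_tableau \<kappa> i j) {(i, j). j < \<kappa> i} {1..psize \<kappa>}"
proof -
  define P where "P i = (\<Sum>i'<i. \<kappa> i')" for i
  have P_Suc: "P (Suc i) = P i + \<kappa> i" for i by (simp add: P_def)
  have mono: "P i \<le> P j" if "i \<le> j" for i j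
    unfolding P_def by (rule sum_mono2) (use that in auto)
  have Pk: "P k = psize \<kappa>" using psize_eq_sum[OF assms] by (simp add: P_def)
  have T: "row_tableau \<kappa> i j = P i + Suc j" for i j by (simp add: row_tableau_def P_def)
  have less: "P i + Suc j < P i' + Suc j'" if "i < i'" "j < \<kappa> i" for i i' j j'
  proof -
    have "P i + Suc j \<le> P (Suc i)" using that P_Suc[of i] by simp
    also have "\<dots> \<le> P i'" using that by (intro mono) simp
    finally show ?thesis by simp
  qed
  show ?thesis
    unfolding bij_betw_def
  proof
    show "inj_on (\<lambda>(i, j). row_tableau \<kappa> i j) {(i, j). j < \<kappa> i}"
    proof (rule inj_onI, clarify)
      fix i j i' j' assume a: "j < \<kappa> i" "j' < \<kappa> i'" "row_tableau \<kappa> i j = row_tableau \<kappa> i' j'"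
      have "i = i'" using less[of i i' j j'] less[of i' i j' j] a by (auto simp: T intro: linorder_cases)
      then show "i = i' \<and> j = j'" using a by (simp add: T)
    qed
    show "(\<lambda>(i, j). row_tableau \<kappa> i j) ` {(i, j). j < \<kappa> i} = {1..psize \<kappa>}"
    proof (intro equalityI subsetI)
      fix s assume "s \<in> (\<lambda>(i, j). row_tableau \<kappa> i j) ` {(i, j). j < \<kappa> i}"
      then obtain i j where ij: "j < \<kappa> i" "s = P i + Suc j" by (auto simp: T)
      have "i < k" using ij(1) assms by (metis not_le not_less0)
      then have "P (Suc i) \<le> psize \<kappa>" unfolding Pk[symmetric] by (intro mono) simp
      then show "s \<in> {1..psize \<kappa>}" using ij P_Suc[of i] by simp
    next
      fix s assume s: "s \<in> {1..psize \<kappa>}"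
      \<comment> \<open>Entries start at 1, so the row of \<open>s\<close> is the predecessor of the
        first index whose partial sum reaches \<open>s\<close>.\<close>
      define m where "m = (LEAST m. s \<le> P m)"
      have sm: "s \<le> P m" unfolding m_def by (rule LeastI[of _ k]) (use s Pk in simp)
      have "m \<noteq> 0" using sm s by (intro notI) (simp add: P_def)
      then obtain i where i: "m = Suc i" by (cases m) auto
      have "\<not> s \<le> P i" unfolding m_def[symmetric] using i not_less_Least[of i "\<lambda>m. s \<le> P m"] m_def by simp
      then have "s - P i - 1 < \<kappa> i" "s = P i + Suc (s - P i - 1)" using sm i P_Suc[of i] by auto
      then show "s \<in> (\<lambda>(i, j). row_tableau \<kappa> i j) ` {(i, j). j < \<kappa> i}"
        by (intro image_eqI[of _ _ "(i, s - P i - 1)"]) (auto simp: T)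
    qed
  qed
qed

text \<open>The stabilizers of the definition are phrased through the filling and have to be matched
  with those phrased through positions. The idempotent is the symmetrizer divided by
  \<open>hook\<close>, which generates the same left ideal.\<close>

lemma specht_frobenius:
  assumes \<kappa>: "is_partition \<kappa>" and k: "\<And>i. k \<le> i \<Longrightarrow> \<kappa> i = 0"
  obtains e where "primitive_idempotent (sym_group (psize \<kappa>)) e"
    "specht \<kappa> = left_ideal_rep (sym_group (psize \<kappa>)) e"
    "\<And>x. x permutes {1..psize \<kappa>} \<Longrightarrow>
      conj_sum (sym_group (psize \<kappa>)) e x = of_int (frob k {1..psize \<kappa>} (rows_shape \<kappa>) x)"
proof -
  let ?n = "psize \<kappa>" and ?cells = "{(i, j). j < \<kappa> i}" and ?T = "\<lambda>(i, j). row_tableau \<kappa> i j"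
  have bij: "bij_betw ?T ?cells {1..?n}" by (rule bij_betw_row_tableau[OF k])
  define pos where "pos = the_inv_into ?cells ?T"
  define row where "row s = fst (pos s)" for s
  define col where "col s = snd (pos s)" for s
  have pos_bij: "bij_betw pos {1..?n} ?cells"
    unfolding pos_def by (rule bij_betw_the_inv_into[OF bij])
  have tab: "tableau ?n k \<kappa> row col"
  proof
    show "antimono \<kappa>" using \<kappa> by (simp add: is_partition_def)
    show "bij_betw (\<lambda>s. (row s, col s)) {1..?n} ?cells" using pos_bij by (simp add: row_def col_def)
  qed (rule k)
  interpret tableau ?n k \<kappa> row col by (rule tab)
  have pos_T: "row (row_tableau \<kappa> i j) = i" "col (row_tableau \<kappa> i j) = j" "row_tableau \<kappa> i j \<in> {1..?n}"
    if "j < \<kappa> i" for i j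
  proof -
    have "pos (?T (i, j)) = (i, j)"
      unfolding pos_def using bij that by (intro the_inv_into_f_f) (auto simp: bij_betw_def)
    then show "row (row_tableau \<kappa> i j) = i" "col (row_tableau \<kappa> i j) = j" by (auto simp: row_def col_def)
    have "?T (i, j) \<in> {1..?n}" by (rule bij_betwE[OF bij, rule_format]) (use that in simp)
    then show "row_tableau \<kappa> i j \<in> {1..?n}" by simp
  qed
  have T_pos: "row_tableau \<kappa> (row s) (col s) = s" if "s \<in> {1..?n}" for s
    using f_the_inv_into_f_bij_betw[OF bij, of s] that by (simp add: pos_def row_def col_def split_beta)
  have R: "row_stabilizer \<kappa> = rstab"
  proof (intro equalityI subsetI)
    fix p assume p: "p \<in> row_stabilizer \<kappa>"
    then have pp: "p permutes {1..?n}" by (simp add: row_stabilizer_def sym_group_carrier)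
    have "row (p s) = row s" if s: "s \<in> {1..?n}" for s
    proof -
      obtain j' where "j' < \<kappa> (row s)" "p (row_tableau \<kappa> (row s) (col s)) = row_tableau \<kappa> (row s) j'"
        using p cell_in[OF s] unfolding row_stabilizer_def by blast
      then show ?thesis using pos_T(1) by (simp add: T_pos[OF s])
    qed
    then show "p \<in> rstab" using pp by (simp add: rstab_def)
  next
    fix p assume p: "p \<in> rstab"
    then have pp: "p permutes {1..?n}" by (simp add: rstab_def)
    have "\<exists>j'<\<kappa> i. p (row_tableau \<kappa> i j) = row_tableau \<kappa> i j'" if ij: "j < \<kappa> i" for i j
    proof -
      let ?s = "row_tableau \<kappa> i j"
      have ps: "p ?s \<in> {1..?n}" using permutes_in_image[OF pp] pos_T(3)[OF ij] by blast
      have "\<forall>s\<in>S. row (p s) = row s" using p unfolding rstab_def mem_Collect_eq by (rule conjunct2)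
      from bspec[OF this pos_T(3)[OF ij]] have "row (p ?s) = i" by (simp only: pos_T(1)[OF ij])
      then show ?thesis using cell_in[OF ps] T_pos[OF ps] by (intro exI[of _ "col (p ?s)"]) simp
    qed
    then show "p \<in> row_stabilizer \<kappa>" using pp by (simp add: row_stabilizer_def sym_group_carrier)
  qed
  have C: "column_stabilizer \<kappa> = cstab"
  proof (intro equalityI subsetI)
    fix p assume p: "p \<in> column_stabilizer \<kappa>"
    then have pp: "p permutes {1..?n}" by (simp add: column_stabilizer_def sym_group_carrier)
    have "col (p s) = col s" if s: "s \<in> {1..?n}" for s
    proof -
      obtain i' where "col s < \<kappa> i'" "p (row_tableau \<kappa> (row s) (col s)) = row_tableau \<kappa> i' (col s)"
        using p cell_in[OF s] unfolding column_stabilizer_def by blast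
      then show ?thesis using pos_T(2) by (simp add: T_pos[OF s])
    qed
    then show "p \<in> cstab" using pp by (simp add: cstab_def)
  next
    fix p assume p: "p \<in> cstab"
    then have pp: "p permutes {1..?n}" by (simp add: cstab_def)
    have "\<exists>i'. j < \<kappa> i' \<and> p (row_tableau \<kappa> i j) = row_tableau \<kappa> i' j" if ij: "j < \<kappa> i" for i j
    proof -
      let ?s = "row_tableau \<kappa> i j"
      have ps: "p ?s \<in> {1..?n}" using permutes_in_image[OF pp] pos_T(3)[OF ij] by blast
      have "\<forall>s\<in>S. col (p s) = col s" using p unfolding cstab_def mem_Collect_eq by (rule conjunct2)
      from bspec[OF this pos_T(3)[OF ij]] have "col (p ?s) = j" by (simp only: pos_T(2)[OF ij])
      then show ?thesis using cell_in[OF ps] T_pos[OF ps] by (intro exI[of _ "row (p ?s)"]) simp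
    qed
    then show "p \<in> column_stabilizer \<kappa>" using pp by (simp add: column_stabilizer_def sym_group_carrier)
  qed
  have "young_symmetrizer \<kappa> = young.symmetrizer"
    unfolding young_symmetrizer_def young.symmetrizer_def young.row_sum_def young.column_sum_def R C ..
  then have "specht \<kappa> = left_ideal_rep (sym_group ?n) young.young_idem"
    unfolding young.left_ideal_rep_symmetrizer[symmetric]
    by (simp add: specht_def left_ideal_rep_def Let_def)
  moreover have "shape = rows_shape \<kappa>" by (simp add: fun_eq_iff shape_def rows_shape_def)
  ultimately show ?thesis
    using that[OF young.primitive_young_idem] conj_sum_young_idem_eq_frob by (simp add: sym_group_carrier)
qed

section \<open>Character formulas for the coefficients\<close>

declare One_nat_def [simp del]

lemma fin_group_DirProd: "fin_group G \<Longrightarrow> fin_group H \<Longrightarrow> fin_group (G \<times>\<times> H)"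
  unfolding fin_group_def fin_group_axioms_def by (simp add: DirProd_group)

lemma fin_rep_intro: "fin_group G \<Longrightarrow> representation G W \<Longrightarrow> fin_rep G W"
  by (simp add: fin_rep_def fin_rep_axioms_def)

lemma specht_character:
  assumes "is_partition \<kappa>" "\<And>i. k \<le> i \<Longrightarrow> \<kappa> i = 0"
  obtains X d where "representation (sym_group (psize \<kappa>)) (specht \<kappa>)" "frame (specht \<kappa>) X d"
    "\<And>x. x permutes {1..psize \<kappa>} \<Longrightarrow>
      frame_character (specht \<kappa>) X d x = of_int (frob k {1..psize \<kappa>} (rows_shape \<kappa>) x)"
proof -
  obtain e where e: "primitive_idempotent (sym_group (psize \<kappa>)) e"
    "specht \<kappa> = left_ideal_rep (sym_group (psize \<kappa>)) e"
    "\<And>x. x permutes {1..psize \<kappa>} \<Longrightarrow>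
      conj_sum (sym_group (psize \<kappa>)) e x = of_int (frob k {1..psize \<kappa>} (rows_shape \<kappa>) x)"
    using specht_frobenius[OF assms] by blast
  interpret primitive_idempotent "sym_group (psize \<kappa>)" e by (rule e(1))
  have "frame_character (specht \<kappa>) (carrier (sym_group (psize \<kappa>))) ideal_frame x =
      of_int (frob k {1..psize \<kappa>} (rows_shape \<kappa>) x)" if x: "x permutes {1..psize \<kappa>}" for x
  proof -
    have "x \<in> carrier (sym_group (psize \<kappa>))" using x by (simp add: sym_group_carrier)
    then have "frame_character (specht \<kappa>) (carrier (sym_group (psize \<kappa>))) ideal_frame x =
        conj_sum (sym_group (psize \<kappa>)) e (inv' x)"
      unfolding e(2) using frame_character_ideal[of x] by simp
    \<comment> \<open>The character is \<open>conj_sum\<close> at the inverse, but a permutation and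
      its inverse fix the same colourings.\<close>
    then show ?thesis using e(3)[OF permutes_inv[OF x]] frob_inv[OF x] by simp
  qed
  then show ?thesis
    using that[of "carrier (sym_group (psize \<kappa>))" ideal_frame] frame_ideal ideal.rep by (simp only: e(2))
qed

lemma multiplicity_specht_ind:
  assumes \<kappa>: "is_partition \<kappa>" "\<And>i. k \<le> i \<Longrightarrow> \<kappa> i = 0"
    and H: "fin_group H" and V: "representation H V" "frame V X d"
    and \<phi>: "group_hom H (sym_group (psize \<kappa>)) \<phi>"
  shows "of_nat (multiplicity_rep (sym_group (psize \<kappa>)) (specht \<kappa>)
      (ind_rep H (sym_group (psize \<kappa>)) \<phi> V)) =
    (\<Sum>h\<in>carrier H. of_int (frob k {1..psize \<kappa>} (rows_shape \<kappa>) (\<phi> h)) * frame_character V X d h) /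
      of_nat (card (carrier H))"
proof -
  let ?G = "sym_group (psize \<kappa>)"
  obtain e where e: "primitive_idempotent ?G e" "specht \<kappa> = left_ideal_rep ?G e"
    "\<And>x. x permutes {1..psize \<kappa>} \<Longrightarrow>
      conj_sum ?G e x = of_int (frob k {1..psize \<kappa>} (rows_shape \<kappa>) x)"
    using specht_frobenius[OF \<kappa>] by blast
  interpret induction H V ?G \<phi>
    using fin_rep_intro[OF H V(1)] fin_group_sym_group \<phi> by (simp add: induction_def)
  have "\<phi> h permutes {1..psize \<kappa>}" if "h \<in> carrier H" for h
    using hom.hom_closed[OF that] by (simp add: sym_group_carrier)
  then show ?thesis
    unfolding e(2) multiplicity_ind[OF e(1) V(2)] using e(3) by (simp cong: sum.cong)
qed

subsection \<open>Young subgroups\<close>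

text \<open>\<open>young_embed\<close> tests \<open>i \<le> p\<close>, so the fixed point 0 belongs
  to the first block. This bound and the next one keep images inside their block.\<close>

lemma permutes_le: "a permutes {1..p} \<Longrightarrow> i \<le> p \<Longrightarrow> a i \<le> p" for p :: nat
  using permutes_in_image[of a "{1..p}" i] permutes_not_in[of a "{1..p}" i] by (cases "i = 0") auto

lemma permutes_ge: "a permutes {1..p} \<Longrightarrow> 1 \<le> i \<Longrightarrow> 1 \<le> a i" for p :: nat
  using permutes_in_image[of a "{1..p}" i] permutes_not_in[of a "{1..p}" i] by (cases "i \<le> p") auto

lemma young_embed_comp:
  assumes "a' permutes {1..p}" "b' permutes {1..q}"
  shows "young_embed p (a \<circ> a') (b \<circ> b') = young_embed p a b \<circ> young_embed p a' b'"
proof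
  fix i
  show "young_embed p (a \<circ> a') (b \<circ> b') i = (young_embed p a b \<circ> young_embed p a' b') i"
  proof (cases "i \<le> p")
    case True
    then show ?thesis using permutes_le[OF assms(1) True] by (simp add: young_embed_def)
  next
    case False
    then have "1 \<le> b' (i - p)" by (intro permutes_ge[OF assms(2)]) simp
    then show ?thesis using False by (simp add: young_embed_def)
  qed
qed

lemma young_embed_id: "young_embed p id id = id"
  by (auto simp: young_embed_def)

lemma young_embed_permutes:
  assumes a: "a permutes {1..p}" and b: "b permutes {1..q}"
  shows "young_embed p a b permutes {1..p + q}"
proof -
  let ?f = "young_embed p a b" and ?g = "young_embed p (inv' a) (inv' b)"
  have "?f \<circ> ?g = id"
    using young_embed_comp[OF permutes_inv[OF a] permutes_inv[OF b], of a b]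
    by (simp add: permutes_inv_o[OF a] permutes_inv_o[OF b] young_embed_id)
  moreover have "?g \<circ> ?f = id"
    using young_embed_comp[OF a b, of "inv' a" "inv' b"]
    by (simp add: permutes_inv_o[OF a] permutes_inv_o[OF b] young_embed_id)
  ultimately have fg: "?f (?g y) = y" "?g (?f x) = x" for x y
    by (simp_all add: fun_eq_iff)
  have "?f x = x" if "x \<notin> {1..p + q}" for x
  proof (cases "x = 0")
    case True
    then show ?thesis using permutes_not_in[OF a, of x] by (simp add: young_embed_def)
  next
    case False
    then have "p + q < x" using that by simp
    then have "x - p \<notin> {1..q}" by auto
    then have "b (x - p) = x - p" by (rule permutes_not_in[OF b])
    then show ?thesis using \<open>p + q < x\<close> by (simp add: young_embed_def)
  qed
  then show ?thesis unfolding permutes_def using fg by metis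
qed

lemma group_hom_young_embed:
  "group_hom (sym_group p \<times>\<times> sym_group q) (sym_group (p + q)) (\<lambda>(a, b). young_embed p a b)"
  unfolding group_hom_def group_hom_axioms_def hom_def
  by (auto simp: DirProd_group sym_group_is_group sym_group_carrier sym_group_mult
    young_embed_permutes young_embed_comp)

lemma group_hom_young_embed3:
  "group_hom (sym_group p \<times>\<times> sym_group q \<times>\<times> sym_group r) (sym_group (p + (q + r)))
     (\<lambda>(a, b, c). young_embed p a (young_embed q b c))"
  unfolding group_hom_def group_hom_axioms_def hom_def
  by (auto simp: DirProd_group sym_group_is_group sym_group_carrier sym_group_mult
    young_embed_permutes young_embed_comp young_embed_comp[where q = "q + r"])

lemma group_hom_diagonal:
  "group_hom (sym_group p \<times>\<times> sym_group q \<times>\<times> sym_group r) (sym_group (p + q) \<times>\<times> sym_group (q + r))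
     (\<lambda>(a, b, c). (young_embed p a b, young_embed q b c))"
  unfolding group_hom_def group_hom_axioms_def hom_def
  by (auto simp: DirProd_group sym_group_is_group sym_group_carrier sym_group_mult
    young_embed_permutes young_embed_comp)

lemma atLeastAtMost_split: "{1..p + q} = {1..p} \<union> (\<lambda>i. p + i) ` {1..(q::nat)}"
proof -
  have "x \<in> (\<lambda>i. p + i) ` {1..q}" if "p < x" "x \<le> p + q" for x
    using that by (intro image_eqI[of _ _ "x - p"]) auto
  then show ?thesis by (auto simp: not_le)
qed

text \<open>Two versions, because the middle group of the Heisenberg product is the second factor of
  one of the two smaller groups and the first factor of the other.\<close>

lemma frob_young_embed:
  assumes a: "a permutes {1..p}" and b: "b permutes {1..q}"
  shows "frob k {1..p + q} A (young_embed p a b) =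
      (\<Sum>g\<in>fixed_colorings {..<k} {1..q} b. frob k {1..p} (\<lambda>i. A i - int (cnt {1..q} g i)) a)"
    and "frob k {1..p + q} A (young_embed p a b) =
      (\<Sum>g\<in>fixed_colorings {..<k} {1..p} a. frob k {1..q} (\<lambda>i. A i - int (cnt {1..p} g i)) b)"
proof -
  have a_in: "a s \<in> {1..p}" if "s \<in> {1..p}" for s using that permutes_in_image[OF a] by blast
  have b_in: "b s \<in> {1..q}" if "s \<in> {1..q}" for s using that permutes_in_image[OF b] by blast
  show "frob k {1..p + q} A (young_embed p a b) =
      (\<Sum>g\<in>fixed_colorings {..<k} {1..q} b. frob k {1..p} (\<lambda>i. A i - int (cnt {1..q} g i)) a)"
  proof (rule frob_split)
    show "{1..p + q} = id ` {1..p} \<union> (\<lambda>i. p + i) ` {1..q}" using atLeastAtMost_split[of p q] by simp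
    show "young_embed p a b (id s) = id (a s)" if "s \<in> {1..p}" for s
      using that by (simp add: young_embed_def)
    show "young_embed p a b (p + s) = p + b s" if "s \<in> {1..q}" for s
      using that by (simp add: young_embed_def)
  qed (use a_in b_in in auto)
  show "frob k {1..p + q} A (young_embed p a b) =
      (\<Sum>g\<in>fixed_colorings {..<k} {1..p} a. frob k {1..q} (\<lambda>i. A i - int (cnt {1..p} g i)) b)"
  proof (rule frob_split)
    show "{1..p + q} = (\<lambda>i. p + i) ` {1..q} \<union> id ` {1..p}" using atLeastAtMost_split[of p q] by auto
    show "young_embed p a b (id s) = id (a s)" if "s \<in> {1..p}" for s
      using that by (simp add: young_embed_def)
    show "young_embed p a b (p + s) = p + b s" if "s \<in> {1..q}" for s
      using that by (simp add: young_embed_def)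
  qed (use a_in b_in in auto)
qed

lemma frob_young_embed3:
  assumes a: "a permutes {1..p}" and b: "b permutes {1..q}" and c: "c permutes {1..r}"
  shows "frob k {1..p + (q + r)} A (young_embed p a (young_embed q b c)) =
    (\<Sum>g\<in>fixed_colorings {..<k} {1..q} b.
      frob k {1..p + r} (\<lambda>i. A i - int (cnt {1..q} g i)) (young_embed p a c))"
proof -
  \<comment> \<open>Inserts the gap left by the middle block: the points of \<open>a\<close> keep
    their places, and those of \<open>c\<close> move behind the \<open>q\<close> points on which
    \<open>b\<close> acts.\<close>
  let ?\<pi> = "\<lambda>i. if i \<le> p then i else i + q"
  have b_in: "b s \<in> {1..q}" if "s \<in> {1..q}" for s using that permutes_in_image[OF b] by blast
  have ac: "young_embed p a c s \<in> {1..p + r}" if "s \<in> {1..p + r}" for s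
    using that permutes_in_image[OF young_embed_permutes[OF a c]] by blast
  show ?thesis
  proof (rule frob_split)
    show "{1..p + (q + r)} = ?\<pi> ` {1..p + r} \<union> (\<lambda>i. p + i) ` {1..q}"
    proof (intro equalityI subsetI)
      fix x assume x: "x \<in> {1..p + (q + r)}"
      consider "x \<le> p" | "p < x" "x \<le> p + q" | "p + q < x" by linarith
      then show "x \<in> ?\<pi> ` {1..p + r} \<union> (\<lambda>i. p + i) ` {1..q}"
      proof cases
        case 1
        then show ?thesis using x by (intro UnI1 image_eqI[of _ _ x]) auto
      next
        case 2
        then show ?thesis by (intro UnI2 image_eqI[of _ _ "x - p"]) auto
      next
        case 3
        then show ?thesis using x by (intro UnI1 image_eqI[of _ _ "x - q"]) auto
      qed
    qed (auto split: if_splits)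
    show "?\<pi> ` {1..p + r} \<inter> (\<lambda>i. p + i) ` {1..q} = {}" by (auto split: if_splits)
    show "inj_on ?\<pi> {1..p + r}" by (auto simp: inj_on_def split: if_splits)
    show "young_embed p a (young_embed q b c) (?\<pi> s) = ?\<pi> (young_embed p a c s)" if "s \<in> {1..p + r}" for s
    proof (cases "s \<le> p")
      case True
      then show ?thesis using permutes_le[OF a True] by (simp add: young_embed_def)
    next
      case False
      then have "1 \<le> c (s - p)" by (intro permutes_ge[OF c]) simp
      moreover have "\<not> s + q \<le> p" "\<not> s + q - p \<le> q" "s + q - p - q = s - p" using False by auto
      ultimately show ?thesis using False by (simp add: young_embed_def)
    qed
    show "young_embed p a (young_embed q b c) (p + s) = p + b s" if "s \<in> {1..q}" for s
      using that by (simp add: young_embed_def)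
  qed (use b_in ac in auto)
qed

subsection \<open>The coefficients as pairings of Frobenius functions\<close>

text \<open>The inner product over a Young subgroup that gives a Littlewood-Richardson coefficient
  for shifted partitions of matching sizes, extended to all integer vectors.\<close>

definition frob_pairing ::
    "nat \<Rightarrow> nat \<Rightarrow> nat \<Rightarrow> (nat \<Rightarrow> int) \<Rightarrow> (nat \<Rightarrow> int) \<Rightarrow> (nat \<Rightarrow> int) \<Rightarrow> complex"
  where "frob_pairing k p r A B C =
    (\<Sum>a | a permutes {1..p}. \<Sum>c | c permutes {1..r}. of_int (frob k {1..p + r} A (young_embed p a c) *
      frob k {1..p} B a * frob k {1..r} C c)) / (fact p * fact r)"

lemma carrier_sym_group: "carrier (sym_group n) = {p. p permutes {1..n}}"
  by (auto simp: sym_group_carrier)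

lemma tensor_specht:
  assumes \<mu>: "is_partition \<mu>" "\<And>i. k \<le> i \<Longrightarrow> \<mu> i = 0" and \<nu>: "is_partition \<nu>" "\<And>i. k \<le> i \<Longrightarrow> \<nu> i = 0"
  obtains X d where
    "representation (sym_group (psize \<mu>) \<times>\<times> sym_group (psize \<nu>)) (tensor_rep (specht \<mu>) (specht \<nu>))"
    "frame (tensor_rep (specht \<mu>) (specht \<nu>)) X d"
    "\<And>x y. x permutes {1..psize \<mu>} \<Longrightarrow> y permutes {1..psize \<nu>} \<Longrightarrow>
      frame_character (tensor_rep (specht \<mu>) (specht \<nu>)) X d (x, y) =
        of_int (frob k {1..psize \<mu>} (rows_shape \<mu>) x * frob k {1..psize \<nu>} (rows_shape \<nu>) y)"
proof -
  obtain X d where X: "representation (sym_group (psize \<mu>)) (specht \<mu>)" "frame (specht \<mu>) X d"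
    "\<And>x. x permutes {1..psize \<mu>} \<Longrightarrow>
      frame_character (specht \<mu>) X d x = of_int (frob k {1..psize \<mu>} (rows_shape \<mu>) x)"
    using specht_character[OF \<mu>] by blast
  obtain Y d' where Y: "representation (sym_group (psize \<nu>)) (specht \<nu>)" "frame (specht \<nu>) Y d'"
    "\<And>x. x permutes {1..psize \<nu>} \<Longrightarrow>
      frame_character (specht \<nu>) Y d' x = of_int (frob k {1..psize \<nu>} (rows_shape \<nu>) x)"
    using specht_character[OF \<nu>] by blast
  interpret tensor_pair "sym_group (psize \<mu>)" "specht \<mu>" "sym_group (psize \<nu>)" "specht \<nu>"
    using fin_rep_intro[OF fin_group_sym_group X(1)] fin_rep_intro[OF fin_group_sym_group Y(1)]
    by (simp add: tensor_pair_def)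
  show ?thesis
    using that[OF representation_tensor frame_tensor[OF X(2) Y(2)]] frame_character_tensor[OF X(2) Y(2)]
      X(3) Y(3) by (simp add: sym_group_carrier)
qed

theorem lr_coeff_eq_frob_pairing:
  assumes \<mu>: "is_partition \<mu>" "\<And>i. k \<le> i \<Longrightarrow> \<mu> i = 0" and \<nu>: "is_partition \<nu>" "\<And>i. k \<le> i \<Longrightarrow> \<nu> i = 0"
    and \<kappa>: "is_partition \<kappa>" "\<And>i. k \<le> i \<Longrightarrow> \<kappa> i = 0" and size: "psize \<kappa> = psize \<mu> + psize \<nu>"
  shows "of_nat (lr_coeff \<mu> \<nu> \<kappa>) =
    frob_pairing k (psize \<mu>) (psize \<nu>) (rows_shape \<kappa>) (rows_shape \<mu>) (rows_shape \<nu>)"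
proof -
  let ?n = "psize \<mu>" and ?m = "psize \<nu>"
  let ?V = "tensor_rep (specht \<mu>) (specht \<nu>)" and ?H = "sym_group ?n \<times>\<times> sym_group ?m"
  obtain X d where V: "representation ?H ?V" "frame ?V X d"
    "\<And>x y. x permutes {1..?n} \<Longrightarrow> y permutes {1..?m} \<Longrightarrow> frame_character ?V X d (x, y) =
        of_int (frob k {1..?n} (rows_shape \<mu>) x * frob k {1..?m} (rows_shape \<nu>) y)"
    using tensor_specht[OF \<mu> \<nu>] by blast
  have "of_nat (lr_coeff \<mu> \<nu> \<kappa>) = (\<Sum>h\<in>carrier ?H. of_int (frob k {1..psize \<kappa>} (rows_shape \<kappa>)
      (case h of (a, b) \<Rightarrow> young_embed ?n a b)) * frame_character ?V X d h) / of_nat (card (carrier ?H))"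
    unfolding lr_coeff_def Let_def size[symmetric]
    using group_hom_young_embed[of ?n ?m] fin_group_DirProd[OF fin_group_sym_group fin_group_sym_group]
    by (intro multiplicity_specht_ind \<kappa> V) (simp_all add: size)
  also have "(\<Sum>h\<in>carrier ?H. of_int (frob k {1..psize \<kappa>} (rows_shape \<kappa>)
      (case h of (a, b) \<Rightarrow> young_embed ?n a b)) * frame_character ?V X d h) =
      (\<Sum>(a, b)\<in>{a. a permutes {1..?n}} \<times> {b. b permutes {1..?m}}.
        of_int (frob k {1..?n + ?m} (rows_shape \<kappa>) (young_embed ?n a b) *
          frob k {1..?n} (rows_shape \<mu>) a * frob k {1..?m} (rows_shape \<nu>) b))"
    by (intro sum.cong) (auto simp: carrier_sym_group V(3) size)
  also have "card (carrier ?H) = fact ?n * fact ?m"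
    by (simp add: card_cartesian_product sym_group_card_carrier)
  finally show ?thesis
    by (simp add: frob_pairing_def sum.cartesian_product)
qed

text \<open>With the sum over the middle component \<open>b\<close> outermost, each of the three
  characters is freed from the \<open>q\<close> points on which \<open>b\<close> acts, at the cost
  of one colouring of these points. The three colourings vary independently but are all fixed by the
  same \<open>b\<close>; what remains is a pairing over the two outer groups.\<close>

theorem heisenberg_coeff_eq:
  assumes \<mu>: "is_partition \<mu>" "\<And>i. k \<le> i \<Longrightarrow> \<mu> i = 0" and \<nu>: "is_partition \<nu>" "\<And>i. k \<le> i \<Longrightarrow> \<nu> i = 0"
    and \<kappa>: "is_partition \<kappa>" "\<And>i. k \<le> i \<Longrightarrow> \<kappa> i = 0"
    and sizes: "psize \<mu> = p + q" "psize \<nu> = q + r" "psize \<kappa> = p + (q + r)"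
  shows "of_nat (heisenberg_coeff \<mu> \<nu> \<kappa>) = (\<Sum>b | b permutes {1..q}.
      \<Sum>f\<in>fixed_colorings {..<k} {1..q} b. \<Sum>g\<in>fixed_colorings {..<k} {1..q} b.
      \<Sum>h\<in>fixed_colorings {..<k} {1..q} b.
        frob_pairing k p r (\<lambda>i. rows_shape \<kappa> i - int (cnt {1..q} f i))
          (\<lambda>i. rows_shape \<mu> i - int (cnt {1..q} g i)) (\<lambda>i. rows_shape \<nu> i - int (cnt {1..q} h i))) / fact q"
proof -
  let ?T = "tensor_rep (specht \<mu>) (specht \<nu>)" and ?H = "sym_group p \<times>\<times> sym_group q \<times>\<times> sym_group r"
  let ?\<psi> = "\<lambda>(a, b, c). (young_embed p a b, young_embed q b c)"
  let ?\<phi> = "\<lambda>(a, b, c). young_embed p a (young_embed q b c)"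
  let ?P = "\<lambda>n. {a. a permutes {1..n}}"
  obtain X d where T: "representation (sym_group (psize \<mu>) \<times>\<times> sym_group (psize \<nu>)) ?T" "frame ?T X d"
    "\<And>x y. x permutes {1..psize \<mu>} \<Longrightarrow> y permutes {1..psize \<nu>} \<Longrightarrow> frame_character ?T X d (x, y) =
        of_int (frob k {1..psize \<mu>} (rows_shape \<mu>) x * frob k {1..psize \<nu>} (rows_shape \<nu>) y)"
    using tensor_specht[OF \<mu> \<nu>] by blast
  have V: "representation ?H (res_rep ?\<psi> ?T)" "frame (res_rep ?\<psi> ?T) X d"
    using representation_res[OF T(1)[unfolded sizes] group_hom_diagonal] frame_res[OF T(2)] by auto
  have hom: "group_hom ?H (sym_group (psize \<kappa>)) ?\<phi>"
    unfolding sizes(3) by (rule group_hom_young_embed3)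
  have heis: "heisenberg_coeff \<mu> \<nu> \<kappa> = multiplicity_rep (sym_group (psize \<kappa>)) (specht \<kappa>)
      (ind_rep ?H (sym_group (psize \<kappa>)) ?\<phi> (res_rep ?\<psi> ?T))"
    unfolding heisenberg_coeff_def heisenberg_component_def Let_def sizes by simp
  have "of_nat (heisenberg_coeff \<mu> \<nu> \<kappa>) =
      (\<Sum>h\<in>carrier ?H. of_int (frob k {1..psize \<kappa>} (rows_shape \<kappa>) (?\<phi> h)) *
      frame_character (res_rep ?\<psi> ?T) X d h) / of_nat (card (carrier ?H))"
    unfolding heis by (intro multiplicity_specht_ind \<kappa> V hom fin_group_DirProd fin_group_sym_group)
  also have "(\<Sum>h\<in>carrier ?H. of_int (frob k {1..psize \<kappa>} (rows_shape \<kappa>) (?\<phi> h)) *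
      frame_character (res_rep ?\<psi> ?T) X d h) =
      (\<Sum>(a, b, c)\<in>?P p \<times> ?P q \<times> ?P r.
        of_int (frob k {1..p + (q + r)} (rows_shape \<kappa>) (young_embed p a (young_embed q b c)) *
          (frob k {1..p + q} (rows_shape \<mu>) (young_embed p a b) *
           frob k {1..q + r} (rows_shape \<nu>) (young_embed q b c))))"
  proof (rule sum.cong)
    show "carrier ?H = ?P p \<times> ?P q \<times> ?P r" by (simp only: carrier_sym_group DirProd_def partial_object.simps)
    fix t assume "t \<in> ?P p \<times> ?P q \<times> ?P r"
    then obtain a b c where t: "t = (a, b, c)" "a permutes {1..p}" "b permutes {1..q}" "c permutes {1..r}" by auto
    have "frame_character (res_rep ?\<psi> ?T) X d t = of_int (frob k {1..p + q} (rows_shape \<mu>) (young_embed p a b) *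
        frob k {1..q + r} (rows_shape \<nu>) (young_embed q b c))"
      unfolding frame_character_res t(1) prod.case
      using T(3)[unfolded sizes, OF young_embed_permutes[OF t(2,3)] young_embed_permutes[OF t(3,4)]] .
    then show "of_int (frob k {1..psize \<kappa>} (rows_shape \<kappa>) (?\<phi> t)) * frame_character (res_rep ?\<psi> ?T) X d t =
        (case t of (a, b, c) \<Rightarrow>
          of_int (frob k {1..p + (q + r)} (rows_shape \<kappa>) (young_embed p a (young_embed q b c)) *
            (frob k {1..p + q} (rows_shape \<mu>) (young_embed p a b) *
             frob k {1..q + r} (rows_shape \<nu>) (young_embed q b c))))"
      unfolding t(1) prod.case sizes(3) by (simp only: of_int_mult)
  qed
  also have "\<dots> = (\<Sum>a\<in>?P p. \<Sum>b\<in>?P q. \<Sum>c\<in>?P r.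
      \<Sum>f\<in>fixed_colorings {..<k} {1..q} b. \<Sum>g\<in>fixed_colorings {..<k} {1..q} b.
      \<Sum>h\<in>fixed_colorings {..<k} {1..q} b.
        of_int (frob k {1..p + r} (\<lambda>i. rows_shape \<kappa> i - int (cnt {1..q} f i)) (young_embed p a c) *
          frob k {1..p} (\<lambda>i. rows_shape \<mu> i - int (cnt {1..q} g i)) a *
          frob k {1..r} (\<lambda>i. rows_shape \<nu> i - int (cnt {1..q} h i)) c))"
    unfolding sum.cartesian_product[symmetric]
  proof (intro sum.cong refl)
    fix a b c assume abc: "a \<in> ?P p" "b \<in> ?P q" "c \<in> ?P r"
    then have a: "a permutes {1..p}" and b: "b permutes {1..q}" and c: "c permutes {1..r}" by auto
    show "of_int (frob k {1..p + (q + r)} (rows_shape \<kappa>) (young_embed p a (young_embed q b c)) *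
          (frob k {1..p + q} (rows_shape \<mu>) (young_embed p a b) *
           frob k {1..q + r} (rows_shape \<nu>) (young_embed q b c))) =
      (\<Sum>f\<in>fixed_colorings {..<k} {1..q} b. \<Sum>g\<in>fixed_colorings {..<k} {1..q} b.
      \<Sum>h\<in>fixed_colorings {..<k} {1..q} b.
        of_int (frob k {1..p + r} (\<lambda>i. rows_shape \<kappa> i - int (cnt {1..q} f i)) (young_embed p a c) *
          frob k {1..p} (\<lambda>i. rows_shape \<mu> i - int (cnt {1..q} g i)) a *
          frob k {1..r} (\<lambda>i. rows_shape \<nu> i - int (cnt {1..q} h i)) c) :: complex)"
      unfolding frob_young_embed3[OF a b c] frob_young_embed(1)[OF a b] frob_young_embed(2)[OF b c]
    proof -
      have "(\<Sum>f\<in>D. x f) * ((\<Sum>g\<in>D. y g) * (\<Sum>h\<in>D. z h)) = (\<Sum>f\<in>D. \<Sum>g\<in>D. \<Sum>h\<in>D. x f * y g * z h)"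
        for D :: "(nat \<Rightarrow> nat) set" and x y z :: "(nat \<Rightarrow> nat) \<Rightarrow> int"
        unfolding sum_product[of y D z D] sum_product[of x D _ D]
        by (simp only: sum_distrib_left mult.assoc)
      then show "of_int ((\<Sum>f\<in>D. x f) * ((\<Sum>g\<in>D. y g) * (\<Sum>h\<in>D. z h))) =
          (\<Sum>f\<in>D. \<Sum>g\<in>D. \<Sum>h\<in>D. of_int (x f * y g * z h) :: complex)"
        for D :: "(nat \<Rightarrow> nat) set" and x y z by (simp only: of_int_sum)
    qed
  qed
  also have "\<dots> = (\<Sum>b\<in>?P q. \<Sum>a\<in>?P p. \<Sum>c\<in>?P r.
      \<Sum>f\<in>fixed_colorings {..<k} {1..q} b. \<Sum>g\<in>fixed_colorings {..<k} {1..q} b.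
      \<Sum>h\<in>fixed_colorings {..<k} {1..q} b.
        of_int (frob k {1..p + r} (\<lambda>i. rows_shape \<kappa> i - int (cnt {1..q} f i)) (young_embed p a c) *
          frob k {1..p} (\<lambda>i. rows_shape \<mu> i - int (cnt {1..q} g i)) a *
          frob k {1..r} (\<lambda>i. rows_shape \<nu> i - int (cnt {1..q} h i)) c))"
    by (rule sum.swap)
  also have "\<dots> = (\<Sum>b\<in>?P q. \<Sum>f\<in>fixed_colorings {..<k} {1..q} b. \<Sum>g\<in>fixed_colorings {..<k} {1..q} b.
      \<Sum>h\<in>fixed_colorings {..<k} {1..q} b. \<Sum>a\<in>?P p. \<Sum>c\<in>?P r.
        of_int (frob k {1..p + r} (\<lambda>i. rows_shape \<kappa> i - int (cnt {1..q} f i)) (young_embed p a c) *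
          frob k {1..p} (\<lambda>i. rows_shape \<mu> i - int (cnt {1..q} g i)) a *
          frob k {1..r} (\<lambda>i. rows_shape \<nu> i - int (cnt {1..q} h i)) c))"
  proof (rule sum.cong[OF refl])
    have swap5: "(\<Sum>a\<in>A. \<Sum>c\<in>C. \<Sum>f\<in>D. \<Sum>g\<in>D. \<Sum>h\<in>D. F a c f g h) =
        (\<Sum>f\<in>D. \<Sum>g\<in>D. \<Sum>h\<in>D. \<Sum>a\<in>A. \<Sum>c\<in>C. F a c f g h)"
      for A C :: "(nat \<Rightarrow> nat) set" and D :: "(nat \<Rightarrow> nat) set" and F :: "_ \<Rightarrow> _ \<Rightarrow> _ \<Rightarrow> _ \<Rightarrow> _ \<Rightarrow> complex"
    proof -
      have swap: "(\<Sum>a\<in>A. \<Sum>c\<in>C. \<Sum>f\<in>D. G a c f) = (\<Sum>f\<in>D. \<Sum>a\<in>A. \<Sum>c\<in>C. G a c f)"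
        for G :: "_ \<Rightarrow> _ \<Rightarrow> _ \<Rightarrow> complex"
        by (rule trans[OF sum.cong[OF refl sum.swap] sum.swap])
      show ?thesis
        by (rule trans[OF swap], rule sum.cong[OF refl], rule trans[OF swap], rule sum.cong[OF refl], rule swap)
    qed
    show "(\<Sum>a\<in>?P p. \<Sum>c\<in>?P r.
      \<Sum>f\<in>fixed_colorings {..<k} {1..q} b. \<Sum>g\<in>fixed_colorings {..<k} {1..q} b.
      \<Sum>h\<in>fixed_colorings {..<k} {1..q} b. F a c f g h) =
      (\<Sum>f\<in>fixed_colorings {..<k} {1..q} b. \<Sum>g\<in>fixed_colorings {..<k} {1..q} b.
      \<Sum>h\<in>fixed_colorings {..<k} {1..q} b. \<Sum>a\<in>?P p. \<Sum>c\<in>?P r. F a c f g h)"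
      for b and F :: "_ \<Rightarrow> _ \<Rightarrow> _ \<Rightarrow> _ \<Rightarrow> _ \<Rightarrow> complex" by (rule swap5)
  qed
  also have "card (carrier ?H) = fact p * (fact q * fact r)"
    by (simp add: card_cartesian_product sym_group_card_carrier)
  finally show ?thesis
    by (simp add: frob_pairing_def sum_divide_distrib[symmetric] mult_ac)
qed

section \<open>Stability\<close>

lemma partition_rows:
  assumes "is_partition \<kappa>"
  obtains k where "\<And>i. k \<le> i \<Longrightarrow> \<kappa> i = 0"
proof -
  have "finite {i. \<kappa> i \<noteq> 0}" using assms by (simp add: is_partition_def)
  then obtain k where "\<forall>i\<in>{i. \<kappa> i \<noteq> 0}. i < k" using finite_nat_set_iff_bounded by blast
  then have "\<kappa> i = 0" if "k \<le> i" for i using that by (meson mem_Collect_eq not_le)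
  then show ?thesis using that by blast
qed

lemma partitions_rows:
  assumes "finite P" "\<forall>\<tau>\<in>P. is_partition \<tau>"
  shows "\<exists>k. \<forall>\<tau>\<in>P. \<forall>i\<ge>k. \<tau> i = 0"
  using assms
proof (induction P rule: finite_induct)
  case (insert \<tau> P)
  then obtain k where k: "\<forall>\<tau>\<in>P. \<forall>i\<ge>k. \<tau> i = 0" by auto
  obtain l where l: "\<And>i. l \<le> i \<Longrightarrow> \<tau> i = 0" using partition_rows insert.prems by blast
  show ?case by (rule exI[of _ "max k l"]) (use k l in simp)
qed simp

lemma is_partitionI:
  assumes "antimono \<kappa>" "\<And>i. k \<le> i \<Longrightarrow> \<kappa> i = 0"
  shows "is_partition \<kappa>"
proof -
  have "{i. \<kappa> i \<noteq> 0} \<subseteq> {..<k}"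
  proof
    fix i assume "i \<in> {i. \<kappa> i \<noteq> 0}"
    then have "\<not> k \<le> i" using assms(2) by auto
    then show "i \<in> {..<k}" by simp
  qed
  then show ?thesis using assms(1) finite_subset by (auto simp: is_partition_def)
qed

lemma is_partition_add:
  assumes "is_partition \<kappa>" "is_partition \<alpha>"
  shows "is_partition (\<lambda>i. \<kappa> i + m * \<alpha> i)"
proof -
  obtain k where k: "\<And>i. k \<le> i \<Longrightarrow> \<kappa> i = 0" using partition_rows[OF assms(1)] by blast
  obtain l where l: "\<And>i. l \<le> i \<Longrightarrow> \<alpha> i = 0" using partition_rows[OF assms(2)] by blast
  have "antimono (\<lambda>i. \<kappa> i + m * \<alpha> i)"
    using assms by (auto simp: is_partition_def antimono_def intro!: add_mono mult_le_mono2)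
  then show ?thesis by (rule is_partitionI[where k = "max k l"]) (use k l in auto)
qed

lemma psize_add:
  assumes "\<And>i. k \<le> i \<Longrightarrow> \<kappa> i = 0" "\<And>i. k \<le> i \<Longrightarrow> \<alpha> i = 0"
  shows "psize (\<lambda>i. \<kappa> i + m * \<alpha> i) = psize \<kappa> + m * psize \<alpha>"
  using psize_eq_sum[of k \<kappa>] psize_eq_sum[of k \<alpha>] psize_eq_sum[of k "\<lambda>i. \<kappa> i + m * \<alpha> i"] assms
  by (simp add: sum.distrib sum_distrib_left)

section \<open>Vanishing and straightening of Frobenius functions\<close>

text \<open>A contributing colouring has content \<open>A i + w i\<close> for a permutation
  \<open>w\<close>. This is nonnegative while \<open>w i < k\<close>, and the contents add up to the
  number of points.\<close>

lemma frob_nonzeroD: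
  assumes "frob k S A \<sigma> \<noteq> 0" "finite S"
  shows "(\<Sum>i<k. A i + int i) = int (card S)" and "i < k \<Longrightarrow> - int k < A i"
proof -
  have "\<exists>f\<in>fixed_colorings {..<k} S \<sigma>. alt_coeff k (\<lambda>i. int (cnt S f i) - A i) \<noteq> 0"
    using assms(1) sum.neutral[of "fixed_colorings {..<k} S \<sigma>" "\<lambda>f. alt_coeff k (\<lambda>i. int (cnt S f i) - A i)"]
    unfolding frob_def by blast
  then obtain f where f: "f \<in> fixed_colorings {..<k} S \<sigma>" "alt_coeff k (\<lambda>i. int (cnt S f i) - A i) \<noteq> 0"
    by blast
  obtain w where w: "w permutes {..<k}" "\<And>i. i < k \<Longrightarrow> int (cnt S f i) - A i = int (w i)"
    using alt_coeff_nonzeroE[OF f(2)] by metis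
  have "(\<Sum>i<k. cnt S f i) = card S"
    using f(1) assms(2) by (intro sum_cnt) (auto simp: fixed_colorings_def)
  then have "int (card S) = (\<Sum>i<k. int (cnt S f i))" by (simp flip: of_nat_sum)
  also have "\<dots> = (\<Sum>i<k. A i + int (w i))" using w(2) by (intro sum.cong refl) (simp add: algebra_simps)
  also have "\<dots> = (\<Sum>i<k. A i + int i)"
    using sum_compose_permutes[OF w(1), of int] by (simp add: sum.distrib)
  finally show "(\<Sum>i<k. A i + int i) = int (card S)" ..
  show "- int k < A i" if "i < k"
    using w(2)[OF that] permutes_in_image[OF w(1), of i] that by auto
qed

text \<open>Exchanging the two equal entries changes the sign but not the vector.\<close>

lemma frob_equal_entries:
  assumes "i < j" "j < k" "A i = A j" "\<And>s. s \<in> S \<Longrightarrow> \<sigma> s \<in> S"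
  shows "frob k S A \<sigma> = 0"
proof -
  have u: "transpose i j permutes {..<k}" using assms by (intro permutes_swap_id) auto
  have "(\<lambda>x. A (transpose i j x)) = A" using assms(3) by (auto simp: transpose_def fun_eq_iff)
  then have "frob k S A \<sigma> = sign (transpose i j) * frob k S A \<sigma>"
    using frob_compose[OF u assms(4), where A = A] by simp
  then show ?thesis using assms(1) by (simp add: sign_swap_id)
qed

lemma sorting_permutation:
  fixes A :: "nat \<Rightarrow> int"
  assumes inj: "inj_on A {..<k}"
  obtains u where "u permutes {..<k}" "strictly_decreasing k (\<lambda>i. A (u i))"
proof -
  define xs where "xs = sort_key (\<lambda>i. - A i) [0..<k]"
  have len: "length xs = k" and dist: "distinct xs" and set: "set xs = {..<k}"
    by (auto simp: xs_def)
  define u where "u i = (if i < k then xs ! i else i)" for i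
  have "bij_betw (\<lambda>i. xs ! i) {..<k} {..<k}"
    using bij_betw_nth[OF dist] len set by simp
  then have "bij_betw u {..<k} {..<k}"
    by (rule bij_betw_cong[THEN iffD1, rotated]) (simp add: u_def)
  then have u: "u permutes {..<k}" by (rule bij_imp_permutes) (simp add: u_def)
  have "sorted (map (\<lambda>i. - A i) xs)" by (simp add: xs_def)
  then have le: "A (u j) \<le> A (u i)" if "i < j" "j < k" for i j
    using that len sorted_nth_mono[of "map (\<lambda>i. - A i) xs" i j] by (simp add: u_def)
  have "A (u j) < A (u i)" if "i < j" "j < k" for i j
  proof -
    have "u i \<noteq> u j" using permutes_inj[OF u] that by (metis injD less_irrefl)
    moreover have "u i < k" "u j < k" using permutes_in_image[OF u] that by auto
    ultimately have "A (u i) \<noteq> A (u j)" using inj by (auto simp: inj_on_def)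
    then show ?thesis using le[OF that] by simp
  qed
  then show ?thesis using that[OF u] by (simp add: strictly_decreasing_def)
qed

text \<open>Both sequences are decreasing arrangements of the same multiset. For the sorting
  permutation this means that it maps each block of constant \<open>\<alpha>\<close> to
  itself.\<close>

lemma decreasing_rearrangement_eq:
  fixes \<alpha> :: "nat \<Rightarrow> nat"
  assumes u: "u permutes {..<k}" and dec: "\<And>i j. i < j \<Longrightarrow> j < k \<Longrightarrow> \<alpha> j \<le> \<alpha> i"
    and dec': "\<And>i j. i < j \<Longrightarrow> j < k \<Longrightarrow> \<alpha> (u j) \<le> \<alpha> (u i)" and "i < k"
  shows "\<alpha> (u i) = \<alpha> i"
proof -
  let ?f = "\<lambda>i. - int (\<alpha> i)"
  let ?xs = "map ?f [0..<k]" and ?ys = "map (\<lambda>i. ?f (u i)) [0..<k]"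
  have mono: "sorted (map g [0..<k])" if "\<And>i j. i < j \<Longrightarrow> j < k \<Longrightarrow> g i \<le> g j" for g :: "nat \<Rightarrow> int"
    using that by (auto simp: sorted_iff_nth_mono_less)
  have "mset ?ys = image_mset ?f (image_mset u (mset_set {0..<k}))"
    by (simp add: image_mset.compositionality comp_def)
  also have "image_mset u (mset_set {0..<k}) = mset_set {0..<k}"
    using permutes_image[OF u] permutes_inj[OF u]
    by (simp add: image_mset_mset_set inj_on_subset lessThan_atLeast0)
  finally have "mset ?ys = mset ?xs" by simp
  moreover have "sorted ?ys" by (rule mono) (use dec' in simp)
  ultimately have "sort ?xs = ?ys" by (rule properties_for_sort)
  moreover have "sort ?xs = ?xs"
    by (rule properties_for_sort[OF refl], rule mono) (use dec in simp)
  ultimately have "?ys = ?xs" by (simp only:)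
  then have "?ys ! i = ?xs ! i" by (rule arg_cong)
  then show ?thesis using \<open>i < k\<close> by simp
qed

text \<open>One factor and one partition serve all \<open>m\<close> at once, so that the
  straightened sequence again moves in the direction \<open>\<alpha>\<close>. The factor
  \<open>\<epsilon> = 0\<close> covers vanishing for all \<open>m\<close>.\<close>

definition straightens ::
    "nat \<Rightarrow> (nat \<Rightarrow> int) \<Rightarrow> (nat \<Rightarrow> nat) \<Rightarrow> nat \<Rightarrow> int \<Rightarrow> (nat \<Rightarrow> nat) \<Rightarrow> bool"
  where "straightens k A \<alpha> N \<epsilon> \<kappa> \<longleftrightarrow> is_partition \<kappa> \<and> (\<forall>i\<ge>k. \<kappa> i = 0) \<and>
    (\<forall>m S \<sigma>. finite S \<longrightarrow> (\<forall>s\<in>S. \<sigma> s \<in> S) \<longrightarrow>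
      frob k (S :: nat set) (\<lambda>i. A i + int (N + m) * int (\<alpha> i)) \<sigma> =
        \<epsilon> * frob k S (rows_shape (\<lambda>i. \<kappa> i + m * \<alpha> i)) \<sigma>)"

lemma straightensD:
  fixes n :: nat
  assumes "straightens k A \<alpha> N \<epsilon> \<kappa>"
  shows "is_partition \<kappa>" and "k \<le> i \<Longrightarrow> \<kappa> i = 0"
    and "\<sigma> permutes {1..n} \<Longrightarrow> frob k {1..n} (\<lambda>i. A i + int (N + m) * int (\<alpha> i)) \<sigma> =
        \<epsilon> * frob k {1..n} (rows_shape (\<lambda>i. \<kappa> i + m * \<alpha> i)) \<sigma>"
proof -
  show "is_partition \<kappa>" "k \<le> i \<Longrightarrow> \<kappa> i = 0" using assms unfolding straightens_def by (elim conjE; simp only:)+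
  assume \<sigma>: "\<sigma> permutes {1..n}"
  have range: "\<sigma> s \<in> {1..n}" if "s \<in> {1..n}" for s using permutes_in_image[OF \<sigma>] that by blast
  have "\<forall>m S \<sigma>. finite S \<longrightarrow> (\<forall>s\<in>S. \<sigma> s \<in> S) \<longrightarrow>
      frob k (S :: nat set) (\<lambda>i. A i + int (N + m) * int (\<alpha> i)) \<sigma> =
        \<epsilon> * frob k S (rows_shape (\<lambda>i. \<kappa> i + m * \<alpha> i)) \<sigma>"
    using assms unfolding straightens_def by (elim conjE)
  note H = this[rule_format]
  show "frob k {1..n} (\<lambda>i. A i + int (N + m) * int (\<alpha> i)) \<sigma> =
        \<epsilon> * frob k {1..n} (rows_shape (\<lambda>i. \<kappa> i + m * \<alpha> i)) \<sigma>"
    by (rule H) (rule finite_atLeastAtMost, rule range)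
qed

text \<open>For large \<open>N\<close> the entries of \<open>A + N \<alpha>\<close> belonging to different values of \<open>\<alpha>\<close> are ordered as
  these values, so sorting only permutes the blocks on which \<open>\<alpha>\<close> is constant.\<close>

lemma straighten:
  fixes A :: "nat \<Rightarrow> int" and \<alpha> :: "nat \<Rightarrow> nat"
  assumes \<alpha>: "antimono \<alpha>" "\<And>i. k \<le> i \<Longrightarrow> \<alpha> i = 0"
  obtains N0 where "\<And>N. N0 \<le> N \<Longrightarrow> \<exists>\<epsilon> \<kappa>. straightens k A \<alpha> N \<epsilon> \<kappa>"
proof -
  \<comment> \<open>A bound for all entries of \<open>A\<close>: beyond \<open>2 * M\<close> a
    difference of 1 in \<open>\<alpha>\<close> outweighs every difference in
    \<open>A\<close>.\<close>
  define M where "M = (\<Sum>i<k. \<bar>A i\<bar>)"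
  have M: "\<bar>A i\<bar> \<le> M" if "i < k" for i
    unfolding M_def using that by (intro member_le_sum) auto
  have large: "A j + int n * int (\<alpha> j) < A i + int n * int (\<alpha> i)"
    if "nat (2 * M) + 1 \<le> n" "i < k" "j < k" "\<alpha> j < \<alpha> i" for i j n
  proof -
    have "2 * M < int n" using that(1) by linarith
    moreover have "int n * (int (\<alpha> j) + 1) \<le> int n * int (\<alpha> i)"
      using that(4) by (intro mult_left_mono) auto
    ultimately show ?thesis using M[OF that(2)] M[OF that(3)] by (simp add: algebra_simps)
  qed
  have nonneg: "0 \<le> A i + int n * int (\<alpha> i)" if "nat (2 * M) + 1 \<le> n" "i < k" "\<alpha> i \<noteq> 0" for i n
  proof -
    have "0 \<le> M" using M[OF that(2)] by simp
    then have "M \<le> int n" using that(1) by linarith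
    moreover have "int n * 1 \<le> int n * int (\<alpha> i)" using that(3) by (intro mult_left_mono) auto
    ultimately show ?thesis using M[OF that(2)] by simp
  qed
  show ?thesis
  proof (rule that)
    fix N assume N: "nat (2 * M) + 1 \<le> N"
    let ?A = "\<lambda>m i. A i + int (N + m) * int (\<alpha> i)"
    let ?P = "\<lambda>\<epsilon> \<kappa>. is_partition \<kappa> \<and> (\<forall>i\<ge>k. \<kappa> i = 0) \<and>
      (\<forall>m S \<sigma>. finite S \<longrightarrow> (\<forall>s\<in>S. \<sigma> s \<in> S) \<longrightarrow>
        frob k (S :: nat set) (?A m) \<sigma> = \<epsilon> * frob k S (rows_shape (\<lambda>i. \<kappa> i + m * \<alpha> i)) \<sigma>)"
    have zero: "\<exists>\<epsilon> \<kappa>. ?P \<epsilon> \<kappa>"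
      if "\<And>m S \<sigma>. finite S \<Longrightarrow> (\<And>s. s \<in> S \<Longrightarrow> \<sigma> s \<in> S) \<Longrightarrow> frob k (S :: nat set) (?A m) \<sigma> = 0"
      using that by (intro exI[of _ 0] exI[of _ "\<lambda>_. 0"]) (auto simp: is_partition_def antimono_def)
    have "\<exists>\<epsilon> \<kappa>. ?P \<epsilon> \<kappa>"
    proof (cases "inj_on (?A 0) {..<k}")
      case False
      then obtain i j where ij: "i < j" "j < k" "?A 0 i = ?A 0 j"
        unfolding inj_on_def by (metis lessThan_iff linorder_neqE_nat)
      \<comment> \<open>Coincident entries can occur only where \<open>\<alpha>\<close> agrees;
        hence they coincide for all \<open>m\<close>, and antisymmetry gives zero.\<close>
      have "\<alpha> j \<le> \<alpha> i" using ij by (intro antimonoD[OF \<alpha>(1)]) simp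
      moreover have "\<not> \<alpha> j < \<alpha> i" using large[of "N + 0" i j] N ij by auto
      ultimately have "\<alpha> i = \<alpha> j" by simp
      then have entries: "?A m i = ?A m j" for m using ij(3) by simp
      show ?thesis
      proof (rule zero)
        fix m \<sigma> and S :: "nat set"
        assume "\<And>s. s \<in> S \<Longrightarrow> \<sigma> s \<in> S"
        then show "frob k S (?A m) \<sigma> = 0" by (rule frob_equal_entries[OF ij(1,2) entries])
      qed
    next
      case True
      obtain u where u: "u permutes {..<k}" "strictly_decreasing k (\<lambda>i. ?A 0 (u i))"
        using sorting_permutation[OF True] by blast
      have uk: "u i < k \<longleftrightarrow> i < k" for i using permutes_in_image[OF u(1), of i] by simp
      have "\<alpha> (u j) \<le> \<alpha> (u i)" if ij: "i < j" "j < k" for i j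
      proof (rule ccontr)
        assume "\<not> \<alpha> (u j) \<le> \<alpha> (u i)"
        then have "?A 0 (u i) < ?A 0 (u j)"
          using large[of "N + 0" "u j" "u i"] N ij uk by auto
        moreover have "?A 0 (u j) < ?A 0 (u i)" using u(2) ij unfolding strictly_decreasing_def by blast
        ultimately show False by simp
      qed
      then have \<alpha>u: "\<alpha> (u i) = \<alpha> i" if "i < k" for i
        using that by (intro decreasing_rearrangement_eq[OF u(1)]) (auto intro: antimonoD[OF \<alpha>(1)])
      define B where "B i = ?A 0 (u i)" for i
      have Am: "?A m (u i) = B i + int m * int (\<alpha> i)" if "i < k" for m i
        using \<alpha>u[OF that] by (simp add: B_def algebra_simps)
      have decB: "B j < B i" if "i < j" "j < k" for i j
        using u(2) that by (simp add: strictly_decreasing_def B_def)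
      have frob_u: "frob k S (?A m) \<sigma> = sign u * frob k S (\<lambda>i. ?A m (u i)) \<sigma>"
        if "\<And>s. s \<in> S \<Longrightarrow> \<sigma> s \<in> S" for m \<sigma> and S :: "nat set"
        using frob_compose[OF u(1), of S \<sigma> "?A m"] that by (simp add: sign_def)
      show ?thesis
      proof (cases "\<forall>i<k. - int i \<le> B i")
        case True
        define \<kappa> where "\<kappa> i = (if i < k then nat (B i + int i) else 0)" for i
        have rows: "\<kappa> i = 0" if "k \<le> i" for i using that by (simp add: \<kappa>_def)
        have "\<kappa> (Suc i) \<le> \<kappa> i" for i
          using decB[of i "Suc i"] by (auto simp: \<kappa>_def)
        then have "antimono \<kappa>" by (rule decseq_SucI)
        then have "is_partition \<kappa>" using rows by (rule is_partitionI)
        moreover have "frob k S (?A m) \<sigma> = sign u * frob k S (rows_shape (\<lambda>i. \<kappa> i + m * \<alpha> i)) \<sigma>"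
          if "\<And>s. s \<in> S \<Longrightarrow> \<sigma> s \<in> S" for m \<sigma> and S :: "nat set"
        proof -
          have "0 \<le> B i + int i" if "i < k" for i using True[rule_format, OF that] by simp
          then have "frob k S (\<lambda>i. ?A m (u i)) \<sigma> = frob k S (rows_shape (\<lambda>i. \<kappa> i + m * \<alpha> i)) \<sigma>"
            using Am by (intro frob_cong) (simp add: rows_shape_def \<kappa>_def)
          then show ?thesis using frob_u[OF that] by simp
        qed
        ultimately show ?thesis using rows by (intro exI[of _ "sign u"] exI[of _ \<kappa>]) blast
      next
        case False
        then obtain i where i: "i < k" "B i < - int i" by (auto simp: not_le)
        \<comment> \<open>Strict decrease pushes the last entry down to \<open>- k\<close> or less,
          where no colouring contributes. A nonzero part of \<open>\<alpha>\<close> would have made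
          that entry nonnegative, so it does not change with \<open>m\<close>.\<close>
        have "B (i + d) \<le> B i - int d" if "i + d < k" for d
          using that
        proof (induction d)
          case (Suc d)
          then show ?case using decB[of "i + d" "i + Suc d"] by simp
        qed simp
        from this[of "k - 1 - i"] i have last: "B (k - 1) \<le> - int k" by (simp add: of_nat_diff)
        have "\<alpha> (u (k - 1)) = 0"
        proof (rule ccontr)
          assume "\<alpha> (u (k - 1)) \<noteq> 0"
          then have "0 \<le> B (k - 1)" using nonneg[of "N + 0" "u (k - 1)"] N uk[of "k - 1"] i by (simp add: B_def)
          then show False using last i by simp
        qed
        then have small: "?A m (u (k - 1)) \<le> - int k" for m using last by (simp add: B_def)
        have "u (k - 1) < k" using uk[of "k - 1"] i by simp
        show ?thesis
        proof (rule zero)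
          fix m \<sigma> and S :: "nat set"
          assume S: "finite S"
          show "frob k S (?A m) \<sigma> = 0"
          proof (rule ccontr)
            assume "frob k S (?A m) \<sigma> \<noteq> 0"
            from frob_nonzeroD(2)[OF this S \<open>u (k - 1) < k\<close>] show False using small[of m] by simp
          qed
        qed
      qed
    qed
    then show "\<exists>\<epsilon> \<kappa>. straightens k A \<alpha> N \<epsilon> \<kappa>" unfolding straightens_def .
  qed
qed

section \<open>Eventually constant sequences and stability of the pairings\<close>

lemma eventually_constant_sum:
  fixes f :: "'i \<Rightarrow> nat \<Rightarrow> 'a::comm_monoid_add"
  assumes "\<And>i. i \<in> I \<Longrightarrow> eventually_constant (f i)"
  shows "eventually_constant (\<lambda>n. \<Sum>i\<in>I. f i n)"
  using assms
proof (induction I rule: infinite_finite_induct)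
  case (insert i I)
  have "eventually_constant (f i)" "eventually_constant (\<lambda>n. \<Sum>i\<in>I. f i n)"
    using insert.IH insert.prems by blast+
  then obtain c d where "\<forall>\<^sub>F n in sequentially. f i n = c" "\<forall>\<^sub>F n in sequentially. (\<Sum>i\<in>I. f i n) = d"
    unfolding eventually_constant_def by blast
  then have "\<forall>\<^sub>F n in sequentially. (\<Sum>i\<in>insert i I. f i n) = c + d"
    by eventually_elim (use insert.hyps in simp)
  then show ?case unfolding eventually_constant_def by blast
qed (auto simp: eventually_constant_def)

lemma eventually_constant_comp: "eventually_constant f \<Longrightarrow> eventually_constant (\<lambda>n. g (f n))"
  unfolding eventually_constant_def by (metis (mono_tags, lifting) eventually_mono)

lemma eventually_constant_shift: "eventually_constant (\<lambda>m. f (N + m)) \<Longrightarrow> eventually_constant f"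
proof -
  assume "eventually_constant (\<lambda>m. f (N + m))"
  then obtain c M where c: "\<And>m. M \<le> m \<Longrightarrow> f (N + m) = c"
    by (auto simp: eventually_constant_def eventually_sequentially)
  have "f n = c" if "N + M \<le> n" for n using c[of "n - N"] that by simp
  then show ?thesis unfolding eventually_constant_def eventually_sequentially by blast
qed

lemma frob_rows_shape_size:
  assumes "frob k S (rows_shape \<kappa>) \<sigma> \<noteq> 0" "finite S" "\<And>i. k \<le> i \<Longrightarrow> \<kappa> i = 0"
  shows "psize \<kappa> = card S"
proof -
  have "int (\<Sum>i<k. \<kappa> i) = int (card S)"
    using frob_nonzeroD(1)[OF assms(1,2)] by (simp add: rows_shape_def)
  then have "(\<Sum>i<k. \<kappa> i) = card S" by (simp only: of_nat_eq_iff)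
  moreover have "psize \<kappa> = (\<Sum>i<k. \<kappa> i)" by (rule psize_eq_sum) (rule assms(3))
  ultimately show ?thesis by simp
qed

text \<open>From a common index on all three vectors are straightened, and the pairing is a constant
  multiple of a pairing of three sequences of shifted partitions moving in the direction
  \<open>(\<alpha>, \<beta>, \<gamma>)\<close>. LR-stability applies to these.\<close>

lemma frob_pairing_eventually_constant:
  assumes stable: "LR_stable \<alpha> \<beta> \<gamma>"
    and k: "\<And>i. k \<le> i \<Longrightarrow> \<alpha> i = 0" "\<And>i. k \<le> i \<Longrightarrow> \<beta> i = 0" "\<And>i. k \<le> i \<Longrightarrow> \<gamma> i = 0"
  shows "eventually_constant (\<lambda>n. frob_pairing k (p + n * psize \<beta>) (r + n * psize \<gamma>)
    (\<lambda>i. A i + int n * int (\<alpha> i)) (\<lambda>i. B i + int n * int (\<beta> i)) (\<lambda>i. C i + int n * int (\<gamma> i)))"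
    (is "eventually_constant ?f")
proof -
  have part: "is_partition \<alpha>" "is_partition \<beta>" "is_partition \<gamma>"
    and size: "psize \<alpha> = psize \<beta> + psize \<gamma>"
    using stable by (auto simp: LR_stable_def LR_triple_def)
  then have anti: "antimono \<alpha>" "antimono \<beta>" "antimono \<gamma>" by (auto simp: is_partition_def)
  obtain N1 where N1: "\<And>N. N1 \<le> N \<Longrightarrow> \<exists>\<epsilon> \<kappa>. straightens k A \<alpha> N \<epsilon> \<kappa>"
    using straighten[OF anti(1) k(1)] by blast
  obtain N2 where N2: "\<And>N. N2 \<le> N \<Longrightarrow> \<exists>\<epsilon> \<kappa>. straightens k B \<beta> N \<epsilon> \<kappa>"
    using straighten[OF anti(2) k(2)] by blast
  obtain N3 where N3: "\<And>N. N3 \<le> N \<Longrightarrow> \<exists>\<epsilon> \<kappa>. straightens k C \<gamma> N \<epsilon> \<kappa>"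
    using straighten[OF anti(3) k(3)] by blast
  define N where "N = max N1 (max N2 N3)"
  have le: "N1 \<le> N" "N2 \<le> N" "N3 \<le> N" by (auto simp: N_def)
  obtain \<epsilon>1 \<kappa> where \<kappa>0: "straightens k A \<alpha> N \<epsilon>1 \<kappa>" using N1[OF le(1)] by blast
  obtain \<epsilon>2 \<mu> where \<mu>0: "straightens k B \<beta> N \<epsilon>2 \<mu>" using N2[OF le(2)] by blast
  obtain \<epsilon>3 \<nu> where \<nu>0: "straightens k C \<gamma> N \<epsilon>3 \<nu>" using N3[OF le(3)] by blast
  note \<kappa> = straightensD[OF \<kappa>0] and \<mu> = straightensD[OF \<mu>0] and \<nu> = straightensD[OF \<nu>0]
  let ?\<kappa> = "\<lambda>m i. \<kappa> i + m * \<alpha> i" and ?\<mu> = "\<lambda>m i. \<mu> i + m * \<beta> i" and ?\<nu> = "\<lambda>m i. \<nu> i + m * \<gamma> i"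
  have rows: "?\<kappa> m i = 0" "?\<mu> m i = 0" "?\<nu> m i = 0" if "k \<le> i" for m i
    using that k \<kappa>(2) \<mu>(2) \<nu>(2) by auto
  have sizes: "psize (?\<kappa> m) = psize \<kappa> + m * psize \<alpha>" "psize (?\<mu> m) = psize \<mu> + m * psize \<beta>"
    "psize (?\<nu> m) = psize \<nu> + m * psize \<gamma>" for m
    using psize_add[OF \<kappa>(2) k(1)] psize_add[OF \<mu>(2) k(2)] psize_add[OF \<nu>(2) k(3)] by auto
  let ?p = "\<lambda>m. p + (N + m) * psize \<beta>" and ?r = "\<lambda>m. r + (N + m) * psize \<gamma>"
  let ?X = "\<lambda>m. frob_pairing k (?p m) (?r m) (rows_shape (?\<kappa> m)) (rows_shape (?\<mu> m)) (rows_shape (?\<nu> m))"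
  have eq: "?f (N + m) = of_int (\<epsilon>1 * \<epsilon>2 * \<epsilon>3) * ?X m" for m
  proof -
    let ?n = "?p m + ?r m"
    have "frob k {1..?n} (\<lambda>i. A i + int (N + m) * int (\<alpha> i)) (young_embed (?p m) a c) *
        frob k {1..?p m} (\<lambda>i. B i + int (N + m) * int (\<beta> i)) a *
        frob k {1..?r m} (\<lambda>i. C i + int (N + m) * int (\<gamma> i)) c =
        (\<epsilon>1 * \<epsilon>2 * \<epsilon>3) * (frob k {1..?n} (rows_shape (?\<kappa> m)) (young_embed (?p m) a c) *
          frob k {1..?p m} (rows_shape (?\<mu> m)) a * frob k {1..?r m} (rows_shape (?\<nu> m)) c)"
      if a: "a permutes {1..?p m}" and c: "c permutes {1..?r m}" for a c
      unfolding \<kappa>(3)[OF young_embed_permutes[OF a c]] \<mu>(3)[OF a] \<nu>(3)[OF c] by (simp only: mult_ac)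
    then show ?thesis
      unfolding frob_pairing_def times_divide_eq_right sum_distrib_left
      by (intro arg_cong2[of _ _ _ _ "(/)"] sum.cong refl) (simp only: of_int_mult mem_Collect_eq)
  qed
  have "eventually_constant ?X"
  \<comment> \<open>Because \<open>psize \<alpha> = psize \<beta> + psize \<gamma>\<close>, the
    sizes match the groups for every \<open>m\<close> or for none. In the second case each product
    of three values contains a zero.\<close>
  proof (cases "psize \<mu> = ?p 0 \<and> psize \<nu> = ?r 0 \<and> psize \<kappa> = ?p 0 + ?r 0")
    case True
    have "?X m = of_nat (lr_coeff (?\<mu> m) (?\<nu> m) (?\<kappa> m))" for m
    proof -
      have sz: "psize (?\<mu> m) = ?p m" "psize (?\<nu> m) = ?r m" "psize (?\<kappa> m) = psize (?\<mu> m) + psize (?\<nu> m)"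
        using True by (auto simp: sizes size algebra_simps)
      show ?thesis
        unfolding sz(1,2)[symmetric]
        by (rule lr_coeff_eq_frob_pairing[symmetric])
          (use rows sz(3) is_partition_add part \<kappa>(1) \<mu>(1) \<nu>(1) in auto)
    qed
    moreover have "eventually_constant (\<lambda>m. lr_coeff (?\<mu> m) (?\<nu> m) (?\<kappa> m))"
      using stable \<kappa>(1) \<mu>(1) \<nu>(1) True unfolding LR_stable_def by simp
    ultimately show ?thesis using eventually_constant_comp by fastforce
  next
    case False
    have "?X m = 0" for m
    proof -
      have "frob k {1..?p m + ?r m} (rows_shape (?\<kappa> m)) x * frob k {1..?p m} (rows_shape (?\<mu> m)) a *
          frob k {1..?r m} (rows_shape (?\<nu> m)) c = 0" for x a c
      proof (rule ccontr)
        assume "\<not> ?thesis"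
        then have nz: "frob k {1..?p m + ?r m} (rows_shape (?\<kappa> m)) x \<noteq> 0"
            "frob k {1..?p m} (rows_shape (?\<mu> m)) a \<noteq> 0" "frob k {1..?r m} (rows_shape (?\<nu> m)) c \<noteq> 0"
          by auto
        have "psize (?\<kappa> m) = ?p m + ?r m" "psize (?\<mu> m) = ?p m" "psize (?\<nu> m) = ?r m"
          using frob_rows_shape_size[OF nz(1) finite_atLeastAtMost rows(1)]
            frob_rows_shape_size[OF nz(2) finite_atLeastAtMost rows(2)]
            frob_rows_shape_size[OF nz(3) finite_atLeastAtMost rows(3)] by simp_all
        then show False using False by (simp add: sizes size algebra_simps)
      qed
      then show ?thesis unfolding frob_pairing_def by (simp only: of_int_0 sum.neutral_const div_0)
    qed
    then show ?thesis unfolding eventually_constant_def by auto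
  qed
  then have "eventually_constant (\<lambda>m. ?f (N + m))"
    unfolding eq by (rule eventually_constant_comp)
  then show ?thesis by (rule eventually_constant_shift)
qed

text \<open>Here \<open>q = 0\<close>: the middle group is trivial and the only colouring of the
  empty set has content zero, so a single pairing remains.\<close>

lemma heisenberg_coeff_eq_lr_coeff:
  assumes part: "is_partition \<mu>" "is_partition \<nu>" "is_partition \<kappa>" and size: "psize \<kappa> = psize \<mu> + psize \<nu>"
  shows "heisenberg_coeff \<mu> \<nu> \<kappa> = lr_coeff \<mu> \<nu> \<kappa>"
proof -
  obtain k where "\<forall>\<tau>\<in>{\<mu>, \<nu>, \<kappa>}. \<forall>i\<ge>k. \<tau> i = 0"
    using partitions_rows[of "{\<mu>, \<nu>, \<kappa>}"] part by auto
  then have k: "\<And>i. k \<le> i \<Longrightarrow> \<mu> i = 0" "\<And>i. k \<le> i \<Longrightarrow> \<nu> i = 0" "\<And>i. k \<le> i \<Longrightarrow> \<kappa> i = 0"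
    by blast+
  have perm: "{b. b permutes {1..0::nat}} = {id}" by auto
  have col: "fixed_colorings {..<k} {1..0::nat} id = {\<lambda>_. undefined}"
    by (auto simp: fixed_colorings_def)
  have cnt: "cnt {1..0::nat} f i = 0" for f i by (simp add: cnt_def)
  have sizes: "psize \<mu> = psize \<mu> + 0" "psize \<nu> = 0 + psize \<nu>" "psize \<kappa> = psize \<mu> + (0 + psize \<nu>)"
    using size by simp_all
  have single: "(\<Sum>x\<in>{a}. f x) = f a" for a :: "nat \<Rightarrow> nat" and f :: "_ \<Rightarrow> complex" by simp
  have "of_nat (heisenberg_coeff \<mu> \<nu> \<kappa>) =
      frob_pairing k (psize \<mu>) (psize \<nu>) (rows_shape \<kappa>) (rows_shape \<mu>) (rows_shape \<nu>)"
    by (subst heisenberg_coeff_eq[OF part(1) k(1) part(2) k(2) part(3) k(3) sizes];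
        (assumption | simp only: perm single, unfold cnt of_nat_0 diff_0_right fact_0 div_by_1, subst col, simp only: single col))
  also have "\<dots> = of_nat (lr_coeff \<mu> \<nu> \<kappa>)"
    by (rule lr_coeff_eq_frob_pairing[OF part(1) k(1) part(2) k(2) part(3) k(3) size, symmetric])
  finally show ?thesis by simp
qed

theorem theorem3p6:
  fixes \<alpha> \<beta> \<gamma> :: "nat \<Rightarrow> nat"
  assumes "LR_stable \<alpha> \<beta> \<gamma>"
  shows "H_stable \<alpha> \<beta> \<gamma>"
  unfolding H_stable_def
proof (intro conjI allI impI)
  have part: "is_partition \<alpha>" "is_partition \<beta>" "is_partition \<gamma>"
    and size: "psize \<alpha> = psize \<beta> + psize \<gamma>" and pos: "lr_coeff \<beta> \<gamma> \<alpha> > 0"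
    using assms by (auto simp: LR_stable_def LR_triple_def)
  show "H_triple \<alpha> \<beta> \<gamma>"
    using part size pos heisenberg_coeff_eq_lr_coeff[OF part(2,3,1) size] by (simp add: H_triple_def)
  fix \<kappa> \<mu> \<nu> :: "nat \<Rightarrow> nat"
  assume H: "is_partition \<kappa> \<and> is_partition \<mu> \<and> is_partition \<nu> \<and>
    max (psize \<mu>) (psize \<nu>) \<le> psize \<kappa> \<and> psize \<kappa> \<le> psize \<mu> + psize \<nu>"
  obtain k where "\<forall>\<tau>\<in>{\<alpha>, \<beta>, \<gamma>, \<kappa>, \<mu>, \<nu>}. \<forall>i\<ge>k. \<tau> i = 0"
    using partitions_rows[of "{\<alpha>, \<beta>, \<gamma>, \<kappa>, \<mu>, \<nu>}"] part H by auto
  then have k: "\<And>i. k \<le> i \<Longrightarrow> \<alpha> i = 0" "\<And>i. k \<le> i \<Longrightarrow> \<beta> i = 0" "\<And>i. k \<le> i \<Longrightarrow> \<gamma> i = 0"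
      "\<And>i. k \<le> i \<Longrightarrow> \<kappa> i = 0" "\<And>i. k \<le> i \<Longrightarrow> \<mu> i = 0" "\<And>i. k \<le> i \<Longrightarrow> \<nu> i = 0"
    by blast+
  \<comment> \<open>The degrees at \<open>n = 0\<close>. Along the sequence \<open>p\<close> and
    \<open>r\<close> grow by \<open>n * psize \<beta>\<close> and \<open>n * psize \<gamma>\<close>,
    while the increments cancel in \<open>q\<close>.\<close>
  define p q r where "p = psize \<kappa> - psize \<nu>" and "q = psize \<mu> + psize \<nu> - psize \<kappa>" and "r = psize \<kappa> - psize \<mu>"
  have pqr: "psize \<mu> = p + q" "psize \<nu> = q + r" "psize \<kappa> = p + (q + r)"
    using H by (auto simp: p_def q_def r_def)
  let ?h = "\<lambda>n. heisenberg_coeff (\<lambda>i. \<mu> i + n * \<beta> i) (\<lambda>i. \<nu> i + n * \<gamma> i) (\<lambda>i. \<kappa> i + n * \<alpha> i)"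
  let ?F = "\<lambda>b. fixed_colorings {..<k} {1..q} b"
  \<comment> \<open>Moving along the sequence adds a multiple of the direction to the fixed vector
    left after subtracting a content, the form in which the pairings are known to stabilize.\<close>
  have shift: "(\<lambda>i. rows_shape (\<lambda>i. \<tau> i + n * \<alpha>' i) i - int (cnt {1..q} f i)) =
      (\<lambda>i. (rows_shape \<tau> i - int (cnt {1..q} f i)) + int n * int (\<alpha>' i))" for \<tau> \<alpha>' n f
    by (simp add: fun_eq_iff rows_shape_def)
  have "of_nat (?h n) = (\<Sum>b | b permutes {1..q}. \<Sum>f\<in>?F b. \<Sum>g\<in>?F b. \<Sum>h\<in>?F b.
      frob_pairing k (p + n * psize \<beta>) (r + n * psize \<gamma>)
        (\<lambda>i. (rows_shape \<kappa> i - int (cnt {1..q} f i)) + int n * int (\<alpha> i))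
        (\<lambda>i. (rows_shape \<mu> i - int (cnt {1..q} g i)) + int n * int (\<beta> i))
        (\<lambda>i. (rows_shape \<nu> i - int (cnt {1..q} h i)) + int n * int (\<gamma> i))) / fact q" for n
    unfolding shift[symmetric]
  proof (rule heisenberg_coeff_eq)
    show "psize (\<lambda>i. \<mu> i + n * \<beta> i) = p + n * psize \<beta> + q"
      using psize_add[OF k(5,2)] by (simp add: pqr)
    show "psize (\<lambda>i. \<nu> i + n * \<gamma> i) = q + (r + n * psize \<gamma>)"
      using psize_add[OF k(6,3)] by (simp add: pqr)
    show "psize (\<lambda>i. \<kappa> i + n * \<alpha> i) = p + n * psize \<beta> + (q + (r + n * psize \<gamma>))"
      using psize_add[OF k(4,1)] by (simp add: pqr size algebra_simps)
  qed (use H part k is_partition_add in auto)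
  \<comment> \<open>The sums are finite and their index sets depend on \<open>q\<close> and
    \<open>k\<close> alone, so each pairing may be treated separately.\<close>
  moreover have "eventually_constant (\<lambda>n. (\<Sum>b | b permutes {1..q}. \<Sum>f\<in>?F b. \<Sum>g\<in>?F b. \<Sum>h\<in>?F b.
      frob_pairing k (p + n * psize \<beta>) (r + n * psize \<gamma>)
        (\<lambda>i. (rows_shape \<kappa> i - int (cnt {1..q} f i)) + int n * int (\<alpha> i))
        (\<lambda>i. (rows_shape \<mu> i - int (cnt {1..q} g i)) + int n * int (\<beta> i))
        (\<lambda>i. (rows_shape \<nu> i - int (cnt {1..q} h i)) + int n * int (\<gamma> i))) / fact q)"
    by (intro eventually_constant_comp[where g = "\<lambda>x. x / fact q"] eventually_constant_sum
      frob_pairing_eventually_constant[OF assms] k)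
  ultimately have "eventually_constant (\<lambda>n. of_nat (?h n) :: complex)" by (simp only:)
  \<comment> \<open>The character formula lives in the complex numbers; real part and floor recover
    the natural number.\<close>
  from eventually_constant_comp[OF this, where g = "\<lambda>z. nat \<lfloor>Re z\<rfloor>"]
  show "eventually_constant ?h" by simp
qed

end
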